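(* Let $k,m\in\mathbb{N}$ and $a\in(0,1)$. Let $L_m^k(a)$ be the error of the best uniform approximation of $\operatorname{sgn}(x)$ on $[-1,-a]\cup[a,1]$ by Laurent polynomials of degree $(2k-1,2m-1)$, let $f(x;k,m;a)$ be the extremal (best approximating) Laurent polynomial, and let $B_m^k(a)>0$ and the conformal maps $\phi(\,\cdot\,;k,m;B)$ be as defined in the context. Then $$L_m^k(a)=\frac{1}{\cosh B_m^k(a)},$$ and the extremal function is of the form $$f(x;k,m;a)=1-(-1)^k L_m^k(a)\cos\phi\bigl(x;k,m;B_m^k(a)\bigr),\qquad x>0.$$
   Context: A Laurent polynomial of degree $(l,n)$ is a function of the form $f(x)=a_{-l}x^{-l}+\dots+a_n x^n$ (all integer powers from $-l$ to $n$ allowed). The approximation error is $$L_m^k(a)=\inf_{f}\ \sup_{a\le|x|\le1}|\operatorname{sgn}(x)-f(x)|,$$ the infimum being over Laurent polynomials $f$ of degree $(2k-1,2m-1)$. The minimizer $f(x;k,m;a)$ is an odd function of $x$. For $B>0$ and $k,m\in\mathbb{N}$, $\Omega_m^k(B)$ denotes the subdomain of the half-strip $\{w=u+iv: v>0,\ 0<u<(k+m)\pi\}$ obtained by deleting the set $$\Bigl\{w=u+iv:\ |u-\pi k|\le\arccos\Bigl(\frac{\cosh B}{\cosh v}\Bigr),\ v\ge B\Bigr\}.$$ The boundary of this domain has two infinite points: $\infty_1$, the one reached as $v\to+\infty$ in the left channel (to the left of the deleted set, asymptotically $0<u<\pi(k-\frac12)$), and $\infty_2$, the one reached as $v\to+\infty$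 in the right channel (asymptotically $\pi(k+\frac12)<u<\pi(k+m)$). Let $\phi(z)=\phi(z;k,m;B)$ be the conformal map of the first quadrant $\{\operatorname{Re}z>0,\operatorname{Im}z>0\}$ onto $\Omega_m^k(B)$, extended to the boundary, such that $\phi(0)=\infty_1$, $\phi(1)=(k+m)\pi$, $\phi(\infty)=\infty_2$. Put $a(B)=\phi^{-1}(0)\in(0,1)$. Then $a(B)$ is a continuous strictly increasing function of $B$ with $\lim_{B\to0}a(B)=0$ and $\lim_{B\to\infty}a(B)=1$; its inverse function is denoted $B_m^k(a)$, $a\in(0,1)$. *)

theory Defs
  imports "HOL-Complex_Analysis.Complex_Analysis"
begin

(* powi is total, with 0 powi j = 0 for j < 0; the value of a Laurent polynomial at 0
   is therefore its constant coefficient, so it carries no extra information. *)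
definition laurent_polys :: "nat \<Rightarrow> nat \<Rightarrow> (real \<Rightarrow> real) set" where
  "laurent_polys l n =
     {f. \<exists>c :: int \<Rightarrow> real. \<forall>x. f x = (\<Sum>j = - int l..int n. c j * x powi j)}"

definition sgn_deviation :: "real \<Rightarrow> (real \<Rightarrow> real) \<Rightarrow> real" where
  "sgn_deviation a f = (SUP x\<in>{x. a \<le> \<bar>x\<bar> \<and> \<bar>x\<bar> \<le> 1}. \<bar>sgn x - f x\<bar>)"

definition approx_error :: "nat \<Rightarrow> nat \<Rightarrow> real \<Rightarrow> real" where
  "approx_error k m a = (INF f\<in>laurent_polys (2*k - 1) (2*m - 1). sgn_deviation a f)"

definition extremal_laurent :: "nat \<Rightarrow> nat \<Rightarrow> real \<Rightarrow> real \<Rightarrow> real" where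
  "extremal_laurent k m a =
     (THE f. f \<in> laurent_polys (2*k - 1) (2*m - 1) \<and>
             (\<forall>g\<in>laurent_polys (2*k - 1) (2*m - 1). sgn_deviation a f \<le> sgn_deviation a g))"

definition first_quadrant :: "complex set" where
  "first_quadrant = {z. 0 < Re z \<and> 0 < Im z}"

definition Omega :: "nat \<Rightarrow> nat \<Rightarrow> real \<Rightarrow> complex set" where
  "Omega k m B =
     {w. 0 < Im w \<and> 0 < Re w \<and> Re w < real (k + m) * pi} -
     {w. \<bar>Re w - pi * real k\<bar> \<le> arccos (cosh B / cosh (Im w)) \<and> B \<le> Im w}"

(* The two infinite boundary points (prime ends) of Omega k m B, as filters on the w-plane.
   For Im w \<ge> B the line Re w = pi k lies in the deleted set, so in the closure of Omega k m B
   it separates the left channel from the right one. *)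
definition infty_left :: "nat \<Rightarrow> complex filter" where
  "infty_left k = inf (filtercomap Im at_top) (principal {w. Re w < pi * real k})"

definition infty_right :: "nat \<Rightarrow> complex filter" where
  "infty_right k = inf (filtercomap Im at_top) (principal {w. Re w > pi * real k})"

definition is_quadrant_map :: "nat \<Rightarrow> nat \<Rightarrow> real \<Rightarrow> (complex \<Rightarrow> complex) \<Rightarrow> bool" where
  "is_quadrant_map k m B \<phi> \<longleftrightarrow>
     \<phi> holomorphic_on first_quadrant \<and>
     bij_betw \<phi> first_quadrant (Omega k m B) \<and>
     continuous_on (closure first_quadrant - {0}) \<phi> \<and>
     filterlim \<phi> (infty_left k) (at 0 within closure first_quadrant) \<and>
     \<phi> 1 = complex_of_real (real (k + m) * pi) \<and>
     filterlim \<phi> (infty_right k) (inf at_infinity (principal (closure first_quadrant)))"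

(* is_quadrant_map determines the map uniquely on closure first_quadrant - {0};
   its values elsewhere are irrelevant, hence SOME rather than THE. *)
definition quadrant_map :: "nat \<Rightarrow> nat \<Rightarrow> real \<Rightarrow> complex \<Rightarrow> complex" where
  "quadrant_map k m B = (SOME \<phi>. is_quadrant_map k m B \<phi>)"

definition a_of_B :: "nat \<Rightarrow> nat \<Rightarrow> real \<Rightarrow> real" where
  "a_of_B k m B = (THE a. 0 < a \<and> a < 1 \<and> quadrant_map k m B (complex_of_real a) = 0)"

definition B_of_a :: "nat \<Rightarrow> nat \<Rightarrow> real \<Rightarrow> real" where
  "B_of_a k m = inv_into {0<..} (a_of_B k m)"

end

theory Submission
  imports Defs "HOL-Computational_Algebra.Computational_Algebra"
begin

text \<open>The best odd approximant \<open>f(x) = P(x\<^sup>2) / x^(2 * k - 1)\<close> equioscillates at \<open>N + 1 = k + m + 1\<close> points of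
  \<open>[a, 1]\<close>. Counting the zeros of \<open>\<tau> - f\<close> by the variation of the argument along the imaginary axis,
  one finds that \<open>F = (-1)\<^sup>k (1 - f) / L\<close> takes values in \<open>(-1, 1)\<close> in the right half-plane only on
  \<open>[a, 1]\<close>, where each is taken exactly \<open>N\<close> times. Hence \<open>1 - F\<^sup>2\<close> has an analytic square root \<open>S\<close> on the
  first quadrant, and in the coordinate \<open>\<zeta> = log z\<close>, which turns the quadrant into a strip,
  \<open>exp (\<i> \<psi>) = F + \<i> S\<close> defines a branch \<open>\<psi>\<close> of \<open>arccos F\<close>. The maximum principle, applied to
  \<open>\<psi>(\<zeta> + t) - \<psi>(\<zeta>)\<close>, gives \<open>Re \<psi>' > 0\<close>, so \<open>\<psi>\<close> is injective. It maps the boundary of the strip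
  out of \<open>Omega k m B\<close>, \<open>cosh B = 1 / L\<close>, so its image, being open and relatively closed, is this
  domain. An automorphism argument shows that the normalised map is unique; therefore \<open>\<phi> = \<psi> \<circ> log\<close>
  and \<open>a(B) = a\<close>. Finally, a compactness argument shows that every \<open>L\<close> in \<open>(0, 1)\<close> is the error for
  some \<open>a\<close>, so every \<open>B > 0\<close> arises in this way, and \<open>B\<close> is determined by \<open>a(B)\<close>.\<close>

subsection \<open>Equioscillation of odd approximants\<close>

text \<open>The shape of \<open>Omega k m B\<close> comes from oddness: on the imaginary axis
  \<open>f\<close> is purely imaginary, so \<open>F\<close> has the constant real part
  \<open>(-1)^k / L\<close>. With \<open>\<psi> = u + i v\<close> this reads
  \<open>cos (u - k pi) * cosh v = cosh B\<close>, the boundary of the deleted set.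

  The zero count is rigid. For \<open>\<tau> > 0\<close> the polynomial
  \<open>\<tau> z^j - P(z^2)\<close> has degree \<open>2 * N - 2\<close>, and on the imaginary axis
  it is \<open>z^j\<close> times a number of real part \<open>\<tau>\<close>, whose argument stays
  in an interval of length \<open>pi\<close>; so at most 2 more zeros lie to the right of the axis
  than to the left. Equioscillation supplies \<open>N\<close> zeros on the right, and the other
  \<open>N - 2\<close> must then all lie on the left. Equality in this estimate also determines the
  signs of \<open>P\<close> at 0 and of its leading coefficient, hence the sign of the error at
  \<open>a\<close>.

  In the coordinate \<open>\<zeta>\<close> the dilations of the quadrant are translations. The
  boundary values of \<open>Re \<psi>\<close> increase along both edges of the strip, which is what
  the maximum principle for the translated difference needs.\<close>

lemma lagrange_expansion:
  fixes R :: "real poly"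
  assumes "finite T" "degree R < card T"
  shows "R = (\<Sum>t\<in>T. smult (poly R t / (\<Prod>s\<in>T - {t}. t - s)) (\<Prod>s\<in>T - {t}. [:- s, 1:]))"
    (is "R = ?Q")
proof (rule poly_eqI_degree)
  show "card T > degree R" by fact
  have "degree (\<Prod>s\<in>T - {t}. [:- s, 1:]) \<le> card T - 1" if "t \<in> T" for t
    using that assms by (subst degree_prod_sum_eq) auto
  hence "degree ?Q \<le> card T - 1"
    using assms by (intro degree_sum_le) (auto intro: order.trans[OF degree_smult_le])
  thus "card T > degree ?Q" using assms by linarith
  fix u assume u: "u \<in> T"
  have "poly ?Q u = (\<Sum>t\<in>T. if t = u then poly R u else 0)"
    unfolding poly_sum
  proof (rule sum.cong[OF refl])
    fix t assume t: "t \<in> T"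
    show "poly (smult (poly R t / (\<Prod>s\<in>T - {t}. t - s)) (\<Prod>s\<in>T - {t}. [:- s, 1:])) u =
        (if t = u then poly R u else 0)"
    proof (cases "t = u")
      case True
      have "(\<Prod>s\<in>T - {u}. u - s) \<noteq> 0" using assms by auto
      thus ?thesis using True by (simp add: poly_prod)
    next
      case False
      have "(\<Prod>s\<in>T - {t}. poly [:- s, 1:] u) = 0"
        using assms u False by (subst prod_zero_iff) auto
      thus ?thesis using False by (simp add: poly_prod)
    qed
  qed
  thus "poly R u = poly ?Q u" using u assms by simp
qed

text \<open>The coefficient of degree \<open>N\<close> of the interpolation polynomial is a divided difference in which
  all terms have the same sign, so all of them vanish.\<close>

lemma weakly_alternating_poly_eq_0:
  fixes R :: "real poly" and t :: "nat \<Rightarrow> real"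
  assumes mono: "\<And>i j. i < j \<Longrightarrow> j \<le> N \<Longrightarrow> t i < t j"
    and deg: "degree R < N" and "\<sigma> \<noteq> 0"
    and alt: "\<And>i. i \<le> N \<Longrightarrow> 0 \<le> \<sigma> * (-1) ^ i * poly R (t i)"
  shows "R = 0"
proof -
  have inj: "inj_on t {..N}"
    by (rule inj_onI) (metis atMost_iff linorder_neqE_nat mono order_less_irrefl)
  define T where "T = t ` {..N}"
  have T: "finite T" "card T = Suc N" using inj by (auto simp: T_def card_image)
  define w where "w = (\<lambda>i. \<Prod>l\<in>{..N} - {i}. t i - t l)"
  have w: "(-1) ^ (N - i) * w i > 0" if i: "i \<le> N" for i
  proof -
    have "{..N} - {i} = {..<i} \<union> {i<..N}" using i by auto
    hence "w i = (\<Prod>l\<in>{..<i} \<union> {i<..N}. t i - t l)" by (simp only: w_def)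
    also have "\<dots> = (\<Prod>l\<in>{..<i}. t i - t l) * (\<Prod>l\<in>{i<..N}. t i - t l)"
      by (rule prod.union_disjoint) auto
    also have "(\<Prod>l\<in>{i<..N}. t i - t l) = (\<Prod>l\<in>{i<..N}. (-1) * (t l - t i))" by simp
    also have "\<dots> = (-1) ^ (N - i) * (\<Prod>l\<in>{i<..N}. t l - t i)"
      unfolding prod.distrib by simp
    finally have "(-1) ^ (N - i) * w i = ((-1) ^ (N - i) * (-1) ^ (N - i)) *
        ((\<Prod>l\<in>{..<i}. t i - t l) * (\<Prod>l\<in>{i<..N}. t l - t i))"
      by simp
    also have "(-1 :: real) ^ (N - i) * (-1) ^ (N - i) = 1" by (simp add: power_mult_distrib[symmetric])
    finally show ?thesis using mono i
      by (simp only: mult_1_left) (intro mult_pos_pos prod_pos, auto)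
  qed
  have "coeff R N = (\<Sum>u\<in>T. poly R u / (\<Prod>s\<in>T - {u}. u - s))"
  proof -
    have "coeff (\<Prod>s\<in>T - {u}. [:- s, 1:]) N = 1" if "u \<in> T" for u
    proof -
      have "degree (\<Prod>s\<in>T - {u}. [:- s, 1:]) = N"
        using that T by (subst degree_prod_sum_eq) auto
      moreover have "lead_coeff (\<Prod>s\<in>T - {u}. [:- s, 1:]) = 1"
        by (subst lead_coeff_prod) simp
      ultimately show ?thesis by simp
    qed
    thus ?thesis
      using T deg by (subst lagrange_expansion[of T R]) (auto simp: coeff_sum)
  qed
  also have "\<dots> = (\<Sum>i\<le>N. poly R (t i) / w i)"
    unfolding T_def
  proof (subst sum.reindex[OF inj], rule sum.cong[OF refl])
    fix i assume i: "i \<in> {..N}"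
    have "t ` {..N} - {t i} = t ` ({..N} - {i})" using inj i by (auto simp: inj_on_def)
    hence "(\<Prod>s\<in>t ` {..N} - {t i}. t i - s) = w i"
      using inj by (simp add: w_def prod.reindex inj_on_diff)
    thus "((\<lambda>u. poly R u / (\<Prod>s\<in>t ` {..N} - {u}. u - s)) \<circ> t) i = poly R (t i) / w i" by simp
  qed
  finally have "(\<Sum>i\<le>N. poly R (t i) / w i) = 0" using deg by (simp add: coeff_eq_0)
  hence sum0: "(\<Sum>i\<le>N. \<sigma> * (-1) ^ N * (poly R (t i) / w i)) = 0"
    by (simp only: sum_distrib_left[symmetric])
  have nonneg: "0 \<le> \<sigma> * (-1) ^ N * (poly R (t i) / w i)" if i: "i \<le> N" for i
  proof -
    have "(-1 :: real) ^ N = (-1) ^ i * (-1) ^ (N - i)" using i by (simp flip: power_add)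
    moreover have "(-1 :: real) ^ (N - i) / w i = 1 / ((-1) ^ (N - i) * w i)"
      by (simp add: power_one_over[symmetric] divide_simps)
    ultimately have "\<sigma> * (-1) ^ N * (poly R (t i) / w i) =
        (\<sigma> * (-1) ^ i * poly R (t i)) * (1 / ((-1) ^ (N - i) * w i))"
      by (metis (no_types, opaque_lifting) mult.assoc mult.commute times_divide_eq_right)
    thus ?thesis using alt[OF i] w[OF i] by simp
  qed
  have "poly R (t i) = 0" if i: "i \<le> N" for i
  proof -
    have "\<sigma> * (-1) ^ N * (poly R (t i) / w i) = 0"
      using sum0 nonneg i by (subst (asm) sum_nonneg_eq_0_iff) auto
    thus ?thesis using w[OF i] \<open>\<sigma> \<noteq> 0\<close> by auto
  qed
  thus "R = 0"
    using T deg by (intro poly_eqI_degree[of T]) (auto simp: T_def)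
qed

section \<open>Compactness of bounded families of polynomials, and existence of best
  approximants\<close>

lemma pointwise_bounded_common_subseq:
  fixes v :: "nat \<Rightarrow> 'a \<Rightarrow> real"
  assumes "finite T" "\<And>t n. t \<in> T \<Longrightarrow> \<bar>v n t\<bar> \<le> M"
  shows "\<exists>r. strict_mono (r :: nat \<Rightarrow> nat) \<and> (\<forall>t\<in>T. convergent (\<lambda>n. v (r n) t))"
  using assms
proof (induction T rule: finite_induct)
  case empty
  show ?case by (intro exI[of _ id]) (auto simp: strict_mono_def)
next
  case (insert s T)
  then obtain r :: "nat \<Rightarrow> nat" where r: "strict_mono r" "\<forall>t\<in>T. convergent (\<lambda>n. v (r n) t)"
    by auto
  have "bounded (range (\<lambda>n. v (r n) s))"
    using insert.prems by (auto simp: bounded_iff intro!: exI[of _ M])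
  then obtain l q where q: "strict_mono (q :: nat \<Rightarrow> nat)" "((\<lambda>n. v (r n) s) \<circ> q) \<longlonglongrightarrow> l"
    using bounded_imp_convergent_subsequence by blast
  have "convergent (\<lambda>n. v ((r \<circ> q) n) t)" if "t \<in> insert s T" for t
  proof (cases "t = s")
    case True thus ?thesis using q by (auto simp: convergent_def o_def)
  next
    case False
    thus ?thesis using r(2) that convergent_subseq_convergent[OF _ q(1), of "\<lambda>n. v (r n) t"] by (auto simp: o_def)
  qed
  thus ?case using strict_mono_o[OF r(1) q(1)] by blast
qed

text \<open>The values at \<open>N\<close> nodes determine a polynomial of degree below
  \<open>N\<close> linearly, through the Lagrange formula. Convergence at the nodes therefore gives
  convergence at every real point, inside \<open>{c..d}\<close> or not, and the limit is again such
  a polynomial.\<close>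

lemma poly_compactness:
  fixes P :: "nat \<Rightarrow> real poly"
  assumes deg: "\<And>n. degree (P n) < N" and "c < d"
    and bnd: "\<And>n t. t \<in> {c..d} \<Longrightarrow> \<bar>poly (P n) t\<bar> \<le> M"
  shows "\<exists>r Q. strict_mono (r :: nat \<Rightarrow> nat) \<and> degree Q < N \<and> (\<forall>t. (\<lambda>n. poly (P (r n)) t) \<longlonglongrightarrow> poly Q t)"
proof -
  obtain T where T: "finite T" "card T = N" "T \<subseteq> {c..d}"
    using infinite_arbitrarily_large[of "{c..d}" N] \<open>c < d\<close> infinite_Icc by blast
  obtain r :: "nat \<Rightarrow> nat" where r: "strict_mono r" "\<forall>t\<in>T. convergent (\<lambda>n. poly (P (r n)) t)"
    using pointwise_bounded_common_subseq[of T "\<lambda>n. poly (P n)" M] T bnd by blast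
  define l where "l = (\<lambda>t. lim (\<lambda>n. poly (P (r n)) t))"
  have l: "(\<lambda>n. poly (P (r n)) t) \<longlonglongrightarrow> l t" if "t \<in> T" for t
    using r(2) that by (auto simp: l_def convergent_LIMSEQ_iff)
  define b where "b = (\<lambda>t. \<Prod>s\<in>T - {t}. [:- s, 1:] :: real poly)"
  define w where "w = (\<lambda>t. \<Prod>s\<in>T - {t}. t - s)"
  define Q where "Q = (\<Sum>t\<in>T. smult (l t / w t) (b t))"
  have N: "N > 0" using deg[of 0] by simp
  have "degree (b t) < N" if "t \<in> T" for t
    using that T N unfolding b_def by (subst degree_prod_sum_eq) auto
  hence "degree Q < N" unfolding Q_def
    by (intro degree_sum_less N) (meson degree_smult_le le_less_trans)
  moreover have "(\<lambda>n. poly (P (r n)) t) \<longlonglongrightarrow> poly Q t" for t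
  proof -
    have "poly (P n) t = (\<Sum>s\<in>T. poly (P n) s / w s * poly (b s) t)" for n
      using deg[of n] T
      by (subst lagrange_expansion[of T "P n"]) (auto simp: poly_sum b_def w_def)
    moreover have "w s \<noteq> 0" if "s \<in> T" for s using T by (auto simp: w_def)
    ultimately show ?thesis
      unfolding Q_def by (auto simp: poly_sum intro!: tendsto_intros l)
  qed
  ultimately show ?thesis using r(1) by blast
qed

text \<open>Odd Laurent polynomials are encoded as \<open>P(x\<^sup>2) / x\<^sup>j\<close> with \<open>j\<close> odd; by symmetry only the error
  on \<open>[a, 1]\<close> matters.\<close>

definition odd_approx_by :: "nat \<Rightarrow> nat \<Rightarrow> real \<Rightarrow> real \<Rightarrow> real poly \<Rightarrow> bool" where
  "odd_approx_by N j a c P \<longleftrightarrow> degree P < N \<and> (\<forall>x\<in>{a..1}. \<bar>1 - poly P (x\<^sup>2) / x ^ j\<bar> \<le> c)"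

text \<open>A relation, so that it can be solved for either variable: for \<open>c\<close> with
  \<open>a\<close> given (\<open>odd_error_exists\<close>) and for \<open>a\<close> with
  \<open>c\<close> given (\<open>odd_error_attained\<close>).\<close>

definition odd_error :: "nat \<Rightarrow> nat \<Rightarrow> real \<Rightarrow> real \<Rightarrow> bool" where
  "odd_error N j a c \<longleftrightarrow> (\<exists>P. odd_approx_by N j a c P) \<and> (\<forall>c'<c. \<nexists>P. odd_approx_by N j a c' P)"

text \<open>Endpoint and bound may both vary: with constant \<open>\<alpha>\<close> the limit is a
  best approximant, with constant \<open>\<gamma>\<close> it belongs to the least endpoint. The
  interval in the conclusion is half-open because \<open>a = 0\<close> is allowed, where the
  quotient is meaningless.\<close>

lemma odd_approx_limit:
  assumes \<alpha>: "\<alpha> \<longlonglongrightarrow> a" and a: "0 \<le> a" "a < 1"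
    and c: "\<gamma> \<longlonglongrightarrow> c" and ok: "\<And>n. \<exists>P. odd_approx_by N j (\<alpha> n) (\<gamma> n) P"
  shows "\<exists>P. degree P < N \<and> (\<forall>x\<in>{a<..1}. \<bar>1 - poly P (x\<^sup>2) / x ^ j\<bar> \<le> c)"
proof -
  obtain P where P: "\<And>n. odd_approx_by N j (\<alpha> n) (\<gamma> n) (P n)" using ok by metis
  \<comment> \<open>Eventually all the intervals \<open>{\<alpha> n..1}\<close> contain
    \<open>{b..1}\<close>, so bounds on this fixed interval are enough for compactness.\<close>
  define b where "b = (a + 1) / 2"
  have b: "a < b" "b < 1" "0 < b" using a by (auto simp: b_def)
  obtain n0 where n0: "\<And>n. n \<ge> n0 \<Longrightarrow> \<alpha> n < b"
    using order_tendstoD(2)[OF \<alpha> b(1)] by (auto simp: eventually_sequentially)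
  obtain C where C: "\<And>n. \<bar>\<gamma> n\<bar> \<le> C"
    using convergent_imp_bounded[OF c] by (auto simp: bounded_iff)
  have bnd: "\<bar>poly (P (n + n0)) t\<bar> \<le> 1 + C" if t: "t \<in> {b\<^sup>2..1}" for n t
  proof -
    define x where "x = sqrt t"
    have t0: "t > 0" using t b by (smt (verit) atLeastAtMost_iff zero_less_power)
    have x: "x\<^sup>2 = t" "x \<in> {b..1}" "x > 0" using t b t0
      by (auto simp: x_def real_le_rsqrt real_le_lsqrt)
    have "\<bar>1 - poly (P (n + n0)) (x\<^sup>2) / x ^ j\<bar> \<le> \<gamma> (n + n0)"
      using P[of "n + n0"] n0[of "n + n0"] x by (auto simp: odd_approx_by_def)
    hence "\<bar>poly (P (n + n0)) t / x ^ j\<bar> \<le> 1 + C" using C[of "n + n0"] x by auto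
    hence "\<bar>poly (P (n + n0)) t\<bar> \<le> (1 + C) * x ^ j" using x by (simp add: abs_divide field_simps)
    also have "\<dots> \<le> (1 + C) * 1" using x C[of 0] by (intro mult_left_mono power_le_one) auto
    finally show ?thesis by simp
  qed
  have "b\<^sup>2 < 1" using b by (simp add: power_less_one_iff)
  then obtain r Q where r: "strict_mono (r :: nat \<Rightarrow> nat)" and Q: "degree Q < N"
      "\<And>t. (\<lambda>n. poly (P (r n + n0)) t) \<longlonglongrightarrow> poly Q t"
    using poly_compactness[of "\<lambda>n. P (n + n0)" N "b\<^sup>2" 1 "1 + C"] bnd P
    by (auto simp: odd_approx_by_def)
  have sub: "strict_mono (\<lambda>n. r n + n0)" using r by (auto simp: strict_mono_def)
  have "\<bar>1 - poly Q (x\<^sup>2) / x ^ j\<bar> \<le> c" if x: "x \<in> {a<..1}" for x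
  proof (rule tendsto_le[OF sequentially_bot])
    show "(\<lambda>n. \<gamma> (r n + n0)) \<longlonglongrightarrow> c" using LIMSEQ_subseq_LIMSEQ[OF c sub] by (simp add: o_def)
    show "(\<lambda>n. \<bar>1 - poly (P (r n + n0)) (x\<^sup>2) / x ^ j\<bar>) \<longlonglongrightarrow> \<bar>1 - poly Q (x\<^sup>2) / x ^ j\<bar>"
      using x a by (intro tendsto_intros Q) auto
    have "(\<lambda>n. \<alpha> (r n + n0)) \<longlonglongrightarrow> a" using LIMSEQ_subseq_LIMSEQ[OF \<alpha> sub] by (simp add: o_def)
    hence "eventually (\<lambda>n. \<alpha> (r n + n0) < x) sequentially" using x by (auto dest: order_tendstoD(2))
    thus "\<forall>\<^sub>F n in sequentially. \<bar>1 - poly (P (r n + n0)) (x\<^sup>2) / x ^ j\<bar> \<le> \<gamma> (r n + n0)"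
      by eventually_elim (use P x in \<open>auto simp: odd_approx_by_def\<close>)
  qed
  thus ?thesis using Q(1) by blast
qed

lemma odd_approx_closed_endpoint:
  assumes "0 < a" "a < 1" "degree P < N" and "\<And>x. x \<in> {a<..1} \<Longrightarrow> \<bar>1 - poly P (x\<^sup>2) / x ^ j\<bar> \<le> c"
  shows "odd_approx_by N j a c P"
proof -
  have "\<bar>1 - poly P (x\<^sup>2) / x ^ j\<bar> \<le> c" if "x \<in> {a..1}" for x
  proof (rule continuous_le_on_closure[of "{a<..<1}" "\<lambda>x. \<bar>1 - poly P (x\<^sup>2) / x ^ j\<bar>"])
    show "continuous_on (closure {a<..<1}) (\<lambda>x. \<bar>1 - poly P (x\<^sup>2) / x ^ j\<bar>)"
      using assms by (auto intro!: continuous_intros)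
  qed (use assms that in auto)
  thus ?thesis using assms by (auto simp: odd_approx_by_def)
qed

text \<open>\<open>monom 1 k\<close> encodes the approximant \<open>f(x) = x\<close>. It makes the
  sets of admissible errors and of admissible endpoints nonempty, and bounds the best error by
  \<open>1 - a\<close>.\<close>

lemma odd_approx_identity:
  assumes "k \<ge> 1" "k < N" "0 < a"
  shows "odd_approx_by N (2 * k - 1) a (1 - a) (monom 1 k)"
proof -
  have "poly (monom 1 k) (x\<^sup>2) / x ^ (2 * k - 1) = x" if "x > 0" for x :: real
  proof -
    have "(x\<^sup>2) ^ k = x ^ (2 * k - 1) * x"
      using assms by (simp flip: power_mult power_Suc2)
    thus ?thesis using that by (simp add: poly_monom)
  qed
  thus ?thesis using assms by (auto simp: odd_approx_by_def degree_monom_eq)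
qed

lemma odd_approx_by_mono:
  "odd_approx_by N j a c P \<Longrightarrow> a \<le> a' \<Longrightarrow> c \<le> c' \<Longrightarrow> odd_approx_by N j a' c' P"
  unfolding odd_approx_by_def by (meson atLeastAtMost_iff order.trans)

lemma poly_eq_on_interval:
  fixes p q :: "real poly"
  assumes "a < b" "\<And>x. x \<in> {a..b} \<Longrightarrow> poly p x = poly q x"
  shows "p = q"
proof (rule ccontr)
  assume "p \<noteq> q"
  hence "finite {x. poly (p - q) x = 0}" by (intro poly_roots_finite) auto
  moreover have "{a..b} \<subseteq> {x. poly (p - q) x = 0}" using assms by auto
  ultimately show False using infinite_Icc[OF assms(1)] finite_subset by blast
qed

text \<open>The bound \<open>c < 1\<close> comes from \<open>f(x) = x\<close>. Error 0 is impossible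
  by parity: it would make \<open>P(x^2)\<close> and the odd power \<open>x^j\<close> the same
  polynomial.\<close>

lemma odd_error_exists:
  assumes k: "k \<ge> 1" "k < N" and a: "0 < a" "a < 1"
  shows "\<exists>c. 0 < c \<and> c < 1 \<and> odd_error N (2 * k - 1) a c"
proof -
  define j where "j = 2 * k - 1"
  have "odd j" using k by (simp add: j_def)
  define S where "S = {c. \<exists>P. odd_approx_by N j a c P}"
  have S1: "1 - a \<in> S" using odd_approx_identity[OF k a(1)] by (auto simp: S_def j_def)
  have Slow: "0 \<le> c" if "c \<in> S" for c
  proof -
    have "1 \<in> {a..1}" using a by simp
    thus ?thesis using that unfolding S_def odd_approx_by_def by fastforce
  qed
  hence bdd: "bdd_below S" by (auto simp: bdd_below_def)
  define c where "c = Inf S"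
  have c1: "c \<le> 1 - a" unfolding c_def by (intro cInf_lower S1 bdd)
  have c0: "0 \<le> c" unfolding c_def using S1 Slow by (intro cInf_greatest) auto
  have "\<exists>P. odd_approx_by N j a (c + 1 / real (Suc n)) P" for n
  proof -
    obtain c' where "c' \<in> S" "c' < c + 1 / real (Suc n)"
      using cInf_less_iff[OF _ bdd, of "c + 1 / real (Suc n)"] S1 by (auto simp: c_def)
    thus ?thesis using odd_approx_by_mono[of N j a c' _ a "c + 1 / real (Suc n)"] by (auto simp: S_def)
  qed
  moreover have "(\<lambda>n. c + 1 / real (Suc n)) \<longlonglongrightarrow> c + 0"
    by (intro tendsto_intros LIMSEQ_Suc lim_1_over_n)
  ultimately obtain P where "degree P < N" "\<forall>x\<in>{a<..1}. \<bar>1 - poly P (x\<^sup>2) / x ^ j\<bar> \<le> c"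
    using odd_approx_limit[of "\<lambda>_. a" a "\<lambda>n. c + 1 / real (Suc n)" c N j] a by auto
  hence P: "odd_approx_by N j a c P" using odd_approx_closed_endpoint a by blast
  have "c \<noteq> 0"
  proof
    assume "c = 0"
    have "poly (pcompose P [:0, 0, 1:]) x = poly (monom 1 j) x" if "x \<in> {a..1}" for x
      using P that a \<open>c = 0\<close> by (auto simp: odd_approx_by_def poly_pcompose poly_monom power2_eq_square)
    hence "pcompose P [:0, 0, 1:] = monom 1 j" using poly_eq_on_interval a by blast
    hence "poly (pcompose P [:0, 0, 1:]) x = poly (monom 1 j) x" for x by simp
    hence "poly P (x * x) = x ^ j" for x by (simp add: poly_pcompose poly_monom)
    from this[of 1] this[of "-1"] show False using \<open>odd j\<close> by simp
  qed
  moreover have "\<nexists>P. odd_approx_by N j a c' P" if "c' < c" for c'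
    using cInf_lower[OF _ bdd, of c'] that by (auto simp: S_def c_def)
  ultimately show ?thesis
    using P c0 c1 a unfolding odd_error_def j_def by (intro exI[of _ c]) auto
qed

text \<open>An error bound below 1 makes \<open>P(x^2)\<close> comparable with \<open>x^j\<close>
  near 0, but \<open>P(x^2)\<close> vanishes there to the even order \<open>2 * l\<close>. If
  \<open>2 * l > j\<close> the lower bound fails, if \<open>2 * l < j\<close> the upper one.\<close>

lemma no_odd_approx_near_0:
  fixes P :: "real poly"
  assumes "odd j" "c < 1" "\<And>x. x \<in> {0<..1} \<Longrightarrow> \<bar>1 - poly P (x\<^sup>2) / x ^ j\<bar> \<le> c"
  shows False
proof -
  have bnds: "(1 - c) * x ^ j \<le> poly P (x\<^sup>2)" "poly P (x\<^sup>2) \<le> 2 * x ^ j" if "x \<in> {0<..1}" for x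
  proof -
    have "1 - c \<le> poly P (x\<^sup>2) / x ^ j" "poly P (x\<^sup>2) / x ^ j \<le> 2"
      using assms(3)[OF that] assms(2) by linarith+
    thus "(1 - c) * x ^ j \<le> poly P (x\<^sup>2)" "poly P (x\<^sup>2) \<le> 2 * x ^ j"
      using that by (auto simp: field_simps)
  qed
  have "P \<noteq> 0" using bnds(1)[of 1] assms(2) by auto
  then obtain q where q: "P = [:- 0, 1:] ^ order 0 P * q" "\<not> [:- 0, 1:] dvd q"
    using order_decomp by blast
  define l where "l = order 0 P"
  have q0: "poly q 0 \<noteq> 0" using q(2) poly_eq_0_iff_dvd by blast
  have Pq: "poly P (x\<^sup>2) = x ^ (2 * l) * poly q (x\<^sup>2)" for x
    by (subst q(1)) (simp add: l_def power_mult)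
  have ev: "eventually (\<lambda>x::real. x \<in> {0<..1}) (at_right 0)"
    by (rule eventually_mono[OF eventually_at_right_real[of 0 1]]) auto
  have "2 * l \<noteq> j" using \<open>odd j\<close> by auto
  then consider "2 * l > j" | "2 * l < j" by linarith
  thus False
  proof cases
    case 1
    have "((\<lambda>x. x ^ (2 * l - j) * poly q (x\<^sup>2)) \<longlongrightarrow> 0 ^ (2 * l - j) * poly q (0\<^sup>2)) (at_right (0::real))"
      by (intro tendsto_intros)
    moreover have "eventually (\<lambda>x. 1 - c \<le> x ^ (2 * l - j) * poly q (x\<^sup>2)) (at_right 0)"
      using ev
    proof eventually_elim
      case (elim x)
      have "x ^ (2 * l) = x ^ j * x ^ (2 * l - j)" using 1 by (simp flip: power_add)
      hence "x ^ j * (1 - c) \<le> x ^ j * (x ^ (2 * l - j) * poly q (x\<^sup>2))"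
        using bnds(1)[OF elim] Pq by (simp add: mult_ac)
      thus ?case using elim by simp
    qed
    ultimately have "1 - c \<le> 0 ^ (2 * l - j) * poly q (0\<^sup>2)"
      by (intro tendsto_lowerbound) auto
    thus False using 1 assms(2) by (simp add: power_0_left)
  next
    case 2
    have lq: "((\<lambda>x. poly q (x\<^sup>2)) \<longlongrightarrow> poly q (0\<^sup>2)) (at_right (0::real))"
      by (intro tendsto_intros)
    have l2: "((\<lambda>x. 2 * x ^ (j - 2 * l)) \<longlongrightarrow> 2 * 0 ^ (j - 2 * l)) (at_right (0::real))"
      by (intro tendsto_intros)
    have e: "eventually (\<lambda>x. 0 \<le> poly q (x\<^sup>2) \<and> poly q (x\<^sup>2) \<le> 2 * x ^ (j - 2 * l)) (at_right 0)"
      using ev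
    proof eventually_elim
      case (elim x)
      have "x ^ j = x ^ (2 * l) * x ^ (j - 2 * l)" using 2 by (simp flip: power_add)
      hence "x ^ (2 * l) * poly q (x\<^sup>2) \<le> x ^ (2 * l) * (2 * x ^ (j - 2 * l))"
        using bnds(2)[OF elim] Pq by (simp add: mult_ac)
      moreover have "0 \<le> x ^ (2 * l) * poly q (x\<^sup>2)"
        using order.trans[OF _ bnds(1)[OF elim]] Pq elim assms(2) by simp
      moreover have "x ^ (2 * l) > 0" using elim by simp
      ultimately show ?case by (simp add: zero_le_mult_iff)
    qed
    have "poly q (0\<^sup>2) \<le> 2 * 0 ^ (j - 2 * l)"
      by (rule tendsto_le[OF _ l2 lq]) (use e in \<open>auto elim: eventually_mono\<close>)
    moreover have "0 \<le> poly q (0\<^sup>2)"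
      by (rule tendsto_lowerbound[OF lq]) (use e in \<open>auto elim: eventually_mono\<close>)
    ultimately
    have "poly q (0\<^sup>2) \<le> 2 * 0 ^ (j - 2 * l)" "0 \<le> poly q (0\<^sup>2)" .
    thus False using 2 q0 by (simp add: power_0_left)
  qed
qed

text \<open>\<open>a\<close> is the least endpoint for which the error \<open>c\<close> can be
  reached; it is positive by \<open>no_odd_approx_near_0\<close>. A better error at \<open>a\<close>
  would by continuity stay below \<open>c\<close> slightly to the left of \<open>a\<close>, contrary
  to minimality.\<close>

lemma odd_error_attained:
  assumes k: "k \<ge> 1" "k < N" and c: "0 < c" "c < 1"
  shows "\<exists>a. 0 < a \<and> a < 1 \<and> odd_error N (2 * k - 1) a c"
proof -
  define j where "j = 2 * k - 1"
  have "odd j" using k by (simp add: j_def)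
  define S where "S = {a. 0 < a \<and> a < 1 \<and> (\<exists>P. odd_approx_by N j a c P)}"
  have "odd_approx_by N j (1 - c) c (monom 1 k)"
    using odd_approx_identity[OF k, of "1 - c"] c by (simp add: j_def)
  hence S1: "1 - c \<in> S" using c by (auto simp: S_def)
  have bdd: "bdd_below S" by (auto simp: S_def bdd_below_def intro!: exI[of _ 0])
  define a where "a = Inf S"
  have a1: "a \<le> 1 - c" unfolding a_def by (intro cInf_lower S1 bdd)
  have a0: "0 \<le> a" unfolding a_def by (rule cInf_greatest) (use S1 in blast, auto simp: S_def)
  have "\<exists>a'. a' \<in> S \<and> a \<le> a' \<and> a' < a + 1 / real (Suc n)" for n
  proof -
    have "S \<noteq> {}" using S1 by blast
    moreover have "Inf S < a + 1 / real (Suc n)" by (simp add: a_def)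
    ultimately obtain a' where "a' \<in> S" "a' < a + 1 / real (Suc n)"
      using cInf_less_iff[OF _ bdd] by blast
    thus ?thesis using cInf_lower[OF _ bdd, of a'] by (auto simp: a_def)
  qed
  then obtain \<alpha> where \<alpha>: "\<And>n. \<alpha> n \<in> S" "\<And>n. a \<le> \<alpha> n" "\<And>n. \<alpha> n < a + 1 / real (Suc n)" by metis
  have "(\<lambda>n. a + 1 / real (Suc n)) \<longlonglongrightarrow> a + 0"
    by (intro tendsto_intros LIMSEQ_Suc lim_1_over_n)
  hence "\<alpha> \<longlonglongrightarrow> a"
    using \<alpha> by (intro tendsto_sandwich[of "\<lambda>_. a" \<alpha> _ "\<lambda>n. a + 1 / real (Suc n)"])
      (auto intro!: always_eventually less_imp_le)
  then obtain P where P: "degree P < N" "\<And>x. x \<in> {a<..1} \<Longrightarrow> \<bar>1 - poly P (x\<^sup>2) / x ^ j\<bar> \<le> c"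
    using odd_approx_limit[of \<alpha> a "\<lambda>n. c" c N j] a0 a1 c \<alpha>(1) by (auto simp: S_def)
  have "a \<noteq> 0" using no_odd_approx_near_0[OF \<open>odd j\<close> c(2)] P by blast
  hence a: "0 < a" "a < 1" using a0 a1 c by auto
  have ok: "odd_approx_by N j a c P" using odd_approx_closed_endpoint[OF a] P by blast
  have "\<nexists>P. odd_approx_by N j a c' P" if c': "c' < c" for c'
  proof
    assume "\<exists>P. odd_approx_by N j a c' P"
    then obtain P where P: "odd_approx_by N j a c' P" by blast
    have "((\<lambda>x. \<bar>1 - poly P (x\<^sup>2) / x ^ j\<bar>) \<longlongrightarrow> \<bar>1 - poly P (a\<^sup>2) / a ^ j\<bar>) (at_left a)"
      using a by (intro tendsto_intros) auto
    moreover have "\<bar>1 - poly P (a\<^sup>2) / a ^ j\<bar> \<le> c'" using P a by (auto simp: odd_approx_by_def)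
    hence "\<bar>1 - poly P (a\<^sup>2) / a ^ j\<bar> < c" using c' by linarith
    ultimately have "eventually (\<lambda>x. \<bar>1 - poly P (x\<^sup>2) / x ^ j\<bar> < c) (at_left a)"
      by (rule order_tendstoD(2))
    then obtain b where b: "b < a" "\<And>x. b < x \<Longrightarrow> x < a \<Longrightarrow> \<bar>1 - poly P (x\<^sup>2) / x ^ j\<bar> < c"
      unfolding eventually_at_left_field by blast
    define d where "d = max ((a + b) / 2) (a / 2)"
    have d: "0 < d" "d < a" "b < d" using a b by (auto simp: d_def less_max_iff_disj)
    have "odd_approx_by N j d c P" unfolding odd_approx_by_def
    proof (intro conjI ballI)
      show "degree P < N" using P by (simp add: odd_approx_by_def)
      fix x assume x: "x \<in> {d..1}"
      show "\<bar>1 - poly P (x\<^sup>2) / x ^ j\<bar> \<le> c"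
      proof (cases "x < a")
        case True
        thus ?thesis using b(2)[of x] d x by auto
      next
        case False
        hence "\<bar>1 - poly P (x\<^sup>2) / x ^ j\<bar> \<le> c'" using P x by (auto simp: odd_approx_by_def)
        thus ?thesis using c' by linarith
      qed
    qed
    hence "d \<in> S" using d a by (auto simp: S_def)
    thus False using cInf_lower[OF _ bdd, of d] d by (simp add: a_def)
  qed
  thus ?thesis using ok a unfolding odd_error_def j_def by blast
qed

text \<open>\<open>r\<close> counts the sign changes of \<open>s\<close> along \<open>Z\<close>. In
  the induction from left to right a new last point either repeats the previous sign, or is recorded
  in \<open>t\<close> while \<open>q\<close> receives a simple root in the gap before it. The
  clauses about \<open>Max Z\<close> are what the induction step consumes.\<close>

lemma sign_alternation:
  fixes s :: "real \<Rightarrow> real"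
  assumes "finite Z" "Z \<noteq> {}" "\<And>z. z \<in> Z \<Longrightarrow> s z \<noteq> 0"
  shows "\<exists>(q :: real poly) t (r :: nat). degree q \<le> r \<and> (\<forall>i<r. t i < t (Suc i) \<and> s (t i) * s (t (Suc i)) < 0) \<and>
     t ` {..r} \<subseteq> Z \<and> s (t r) * s (Max Z) > 0 \<and> (\<forall>y\<ge>Max Z. poly q y * s (Max Z) > 0) \<and>
     (\<forall>z\<in>Z. poly q z * s z > 0)"
  using assms
proof (induction Z rule: finite_linorder_max_induct)
  case (insert b A)
  have sb: "s b \<noteq> 0" using insert.prems by auto
  show ?case
  proof (cases "A = {}")
    case True
    show ?thesis using sb
      by (intro exI[of _ "[:s b:]"] exI[of _ "\<lambda>_. b"] exI[of _ 0]) (auto simp: True zero_less_mult_iff)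
  next
    case False
    then obtain q t r where IH: "degree q \<le> r" "\<And>i. i < r \<Longrightarrow> t i < t (Suc i) \<and> s (t i) * s (t (Suc i)) < 0"
     "t ` {..r} \<subseteq> A" "s (t r) * s (Max A) > 0" "\<And>y. y \<ge> Max A \<Longrightarrow> poly q y * s (Max A) > 0"
     "\<And>z. z \<in> A \<Longrightarrow> poly q z * s z > 0"
      using insert by (auto simp: Bex_def) blast
    have M: "Max (insert b A) = b" using insert(1,2) by (intro Max_eqI) (auto intro: less_imp_le)
    have MA: "Max A \<in> A" "Max A < b" using insert(1,2) False by auto
    have sM: "s (Max A) \<noteq> 0" using insert.prems MA by auto
    show ?thesis
    proof (cases "s b * s (Max A) > 0")
      case True
      have pos: "poly q y * s b > 0" if "y \<ge> b" for y
      proof -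
        have "poly q y * s (Max A) > 0" using IH(5)[of y] that MA by auto
        thus ?thesis using True by (auto simp: zero_less_mult_iff)
      qed
      have "s (t r) * s b > 0" using IH(4) True by (auto simp: zero_less_mult_iff)
      thus ?thesis using IH pos unfolding M
        by (intro exI[of _ q] exI[of _ t] exI[of _ r]) auto
    next
      case False
      hence opp: "s b * s (Max A) < 0" using sb sM by (auto simp: mult_less_0_iff zero_less_mult_iff)
      define u where "u = (Max A + b) / 2"
      have u: "Max A < u" "u < b" using MA by (auto simp: u_def)
      \<comment> \<open>The factor \<open>u - y\<close> is positive at all earlier points and
        negative from \<open>b\<close> on: the earlier agreement of signs survives, and the sign
        beyond is reversed.\<close>
      define q' where "q' = q * [:u, -1:]"
      have q': "poly q' y = poly q y * (u - y)" for y by (simp add: q'_def algebra_simps)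
      define t' where "t' = t(Suc r := b)"
      have "degree q' \<le> Suc r"
        unfolding q'_def using order.trans[OF degree_mult_le[of q "[:u, -1:]"]] IH(1) by simp
      moreover have "t' i < t' (Suc i) \<and> s (t' i) * s (t' (Suc i)) < 0" if i: "i < Suc r" for i
      proof (cases "i = r")
        case True
        have "t r \<in> A" using IH(3) by auto
        moreover have "s (t r) * s b < 0" using IH(4) opp by (auto simp: mult_less_0_iff zero_less_mult_iff)
        ultimately show ?thesis using True insert(2) by (auto simp: t'_def)
      next
        case False
        thus ?thesis using i IH(2)[of i] by (auto simp: t'_def)
      qed
      moreover have "t' ` {..Suc r} \<subseteq> insert b A"
        using IH(3) by (auto simp: t'_def image_subset_iff)
      moreover have pos: "poly q' y * s b > 0" if "y \<ge> b" for y
      proof -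
        have "poly q y * s (Max A) > 0" using IH(5)[of y] that MA by auto
        hence "poly q y * s b < 0" using opp by (auto simp: mult_less_0_iff zero_less_mult_iff)
        hence "(poly q y * s b) * (u - y) > 0" using that u by (intro mult_neg_neg) auto
        thus ?thesis by (simp only: q' mult_ac)
      qed
      moreover have "poly q' z * s z > 0" if "z \<in> insert b A" for z
      proof (cases "z = b")
        case True thus ?thesis using pos by auto
      next
        case False
        hence "z \<in> A" using that by auto
        hence "z \<le> Max A" using insert(1) by auto
        hence "(poly q z * s z) * (u - z) > 0"
          using u mult_pos_pos[OF IH(6)[OF \<open>z \<in> A\<close>], of "u - z"] by auto
        thus ?thesis by (simp only: q' mult_ac)
      qed
      moreover have "s (t' (Suc r)) * s b > 0" using sb by (auto simp: t'_def zero_less_mult_iff)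
      ultimately show ?thesis unfolding M
        by (intro exI[of _ q'] exI[of _ t'] exI[of _ "Suc r"]) auto
    qed
  qed
qed simp

text \<open>Kolmogorov's criterion: small steps along a correction that agrees in sign with
  \<open>e\<close> at all extremal points lower the maximum. If the steps \<open>1 / (n + 1)\<close>
  all failed, the points of failure would accumulate at an extremal point, near which
  \<open>(e - d p)^2 = e^2 - d (2 e p - d p^2)\<close> is smaller than \<open>e^2\<close> for small
  \<open>d\<close>.\<close>

lemma kolmogorov_improvement:
  fixes e p :: "real \<Rightarrow> real"
  assumes K: "compact K" "K \<noteq> {}" and cont: "continuous_on K e" "continuous_on K p"
    and L: "0 < L" "\<And>x. x \<in> K \<Longrightarrow> \<bar>e x\<bar> \<le> L"
    and pos: "\<And>x. x \<in> K \<Longrightarrow> \<bar>e x\<bar> = L \<Longrightarrow> e x * p x > 0"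
  shows "\<exists>\<epsilon> c'. c' < L \<and> (\<forall>x\<in>K. \<bar>e x - \<epsilon> * p x\<bar> \<le> c')"
proof -
  have "\<exists>n. \<forall>x\<in>K. \<bar>e x - (1 / real (Suc n)) * p x\<bar> < L"
  proof (rule ccontr)
    assume "\<not> ?thesis"
    hence "\<exists>x. x \<in> K \<and> \<bar>e x - (1 / real (Suc n)) * p x\<bar> \<ge> L" for n by (meson not_less)
    then obtain x where x: "\<And>n. x n \<in> K" "\<And>n. \<bar>e (x n) - (1 / real (Suc n)) * p (x n)\<bar> \<ge> L" by metis
    obtain y r where y: "y \<in> K" "strict_mono (r :: nat \<Rightarrow> nat)" "(x \<circ> r) \<longlonglongrightarrow> y"
      using K(1) x(1) unfolding compact_def by metis
    have lim: "(\<lambda>n. f (x (r n))) \<longlonglongrightarrow> f y" if "continuous_on K f" for f :: "real \<Rightarrow> real"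
      using continuous_on_tendsto_compose[OF that y(3) y(1)] x(1) by (auto simp: o_def)
    note le = lim[OF cont(1)] and lp = lim[OF cont(2)]
    have l0: "(\<lambda>n. 1 / real (Suc (r n))) \<longlonglongrightarrow> 0"
      using LIMSEQ_subseq_LIMSEQ[OF LIMSEQ_Suc[OF lim_1_over_n] y(2)] by (simp add: o_def)
    have "(\<lambda>n. \<bar>e (x (r n)) - (1 / real (Suc (r n))) * p (x (r n))\<bar>) \<longlonglongrightarrow> \<bar>e y - 0 * p y\<bar>"
      by (intro tendsto_intros le lp l0)
    hence "L \<le> \<bar>e y - 0 * p y\<bar>" using x(2) by (intro Lim_bounded2) auto
    hence "e y * p y > 0" using L(2)[OF y(1)] pos[OF y(1)] by auto
    hence pos2: "0 < 2 * (e y * p y) - 0 * (p y)\<^sup>2" by simp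
    have "(\<lambda>n. 2 * (e (x (r n)) * p (x (r n))) - (1 / real (Suc (r n))) * (p (x (r n)))\<^sup>2)
        \<longlonglongrightarrow> 2 * (e y * p y) - 0 * (p y)\<^sup>2"
      by (intro tendsto_intros le lp l0)
    hence "eventually (\<lambda>n. 2 * (e (x (r n)) * p (x (r n))) - (1 / real (Suc (r n))) * (p (x (r n)))\<^sup>2 > 0) sequentially"
      using pos2 by (rule order_tendstoD(1))
    then obtain n where n: "2 * (e (x (r n)) * p (x (r n))) - (1 / real (Suc (r n))) * (p (x (r n)))\<^sup>2 > 0"
      by (auto simp: eventually_sequentially)
    define d where "d = 1 / real (Suc (r n))"
    have d: "d > 0" by (simp add: d_def)
    have "(e (x (r n)) - d * p (x (r n)))\<^sup>2 = (e (x (r n)))\<^sup>2 - d * (2 * (e (x (r n)) * p (x (r n))) - d * (p (x (r n)))\<^sup>2)"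
      by (simp add: power2_eq_square algebra_simps)
    also have "\<dots> < (e (x (r n)))\<^sup>2" using d n by (simp add: d_def)
    finally have "\<bar>e (x (r n)) - d * p (x (r n))\<bar> < \<bar>e (x (r n))\<bar>"
      by (simp add: abs_le_square_iff flip: not_le)
    thus False using x(2)[of "r n"] L(2)[OF x(1)[of "r n"]] by (simp add: d_def)
  qed
  then obtain n where n: "\<forall>x\<in>K. \<bar>e x - (1 / real (Suc n)) * p x\<bar> < L" by blast
  have "continuous_on K (\<lambda>x. \<bar>e x - (1 / real (Suc n)) * p x\<bar>)"
    by (intro continuous_intros cont)
  from continuous_attains_sup[OF K this] obtain z where z: "z \<in> K"
    "\<forall>x\<in>K. \<bar>e x - (1 / real (Suc n)) * p x\<bar> \<le> \<bar>e z - (1 / real (Suc n)) * p z\<bar>"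
    by blast
  thus ?thesis using n by blast
qed

text \<open>All such points are zeros of \<open>W\<close>. That \<open>W\<close> is not zero is
  tested at 1 and -1: as \<open>j\<close> is odd, \<open>(1 - P(1))^2 = L^2 = (1 + P(1))^2\<close>
  would give \<open>P(1) = 0\<close> and \<open>L = 1\<close>.\<close>

lemma finite_extremal_points:
  assumes "odd j" "L < 1" "0 < L"
  shows "finite {x::real. x > 0 \<and> \<bar>1 - poly P (x\<^sup>2) / x ^ j\<bar> = L}"
proof -
  define W where "W = (monom 1 j - pcompose P [:0, 0, 1:])\<^sup>2 - smult (L\<^sup>2) (monom 1 (2 * j))"
  have W: "poly W x = (x ^ j - poly P (x\<^sup>2))\<^sup>2 - L\<^sup>2 * (x ^ j)\<^sup>2" for x
    by (simp add: W_def poly_monom poly_pcompose power2_eq_square mult_2 power_add)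
  have "W \<noteq> 0"
  proof
    assume "W = 0"
    hence "(1 - poly P 1)\<^sup>2 = L\<^sup>2" "(-1 - poly P 1)\<^sup>2 = L\<^sup>2"
      using W[of 1] W[of "-1"] \<open>odd j\<close> by auto
    hence "poly P 1 = 0" "(1 - poly P 1)\<^sup>2 = L\<^sup>2" by (auto simp: power2_eq_square algebra_simps)
    thus False using assms by (auto simp: power2_eq_1_iff)
  qed
  hence "finite {x. poly W x = 0}" by (rule poly_roots_finite)
  moreover have "{x. x > 0 \<and> \<bar>1 - poly P (x\<^sup>2) / x ^ j\<bar> = L} \<subseteq> {x. poly W x = 0}"
  proof safe
    fix x :: real assume x: "x > 0" "L = \<bar>1 - poly P (x\<^sup>2) / x ^ j\<bar>"
    have "L * x ^ j = \<bar>x ^ j - poly P (x\<^sup>2)\<bar>"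
      unfolding x(2) using x(1) by (simp add: abs_if field_simps)
    hence "L\<^sup>2 * (x ^ j)\<^sup>2 = (x ^ j - poly P (x\<^sup>2))\<^sup>2" by (metis power2_abs power_mult_distrib)
    thus "poly W x = 0" by (simp add: W)
  qed
  ultimately show ?thesis using finite_subset by blast
qed

text \<open>Chebyshev alternation. If the error at its extremal points changed sign fewer than
  \<open>N\<close> times, the polynomial of \<open>sign_alternation\<close> would have degree below
  \<open>N\<close> and be an admissible correction, contradicting minimality through
  \<open>kolmogorov_improvement\<close>.\<close>

lemma odd_error_alternation:
  assumes j: "odd j" and a: "0 < a" "a < 1" and L: "0 < L" "L < 1" and best: "odd_error N j a L"
  shows "\<exists>P x \<sigma>. odd_approx_by N j a L P \<and> (\<forall>i<N. x i < x (Suc i)) \<and> x ` {..N} \<subseteq> {a..1} \<and>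
     (\<sigma> = 1 \<or> \<sigma> = -1) \<and> (\<forall>i\<le>N. 1 - poly P ((x i)\<^sup>2) / x i ^ j = \<sigma> * (-1) ^ i * L)"
proof -
  obtain P where P: "odd_approx_by N j a L P" and min: "\<And>c' P. c' < L \<Longrightarrow> \<not> odd_approx_by N j a c' P"
    using best by (auto simp: odd_error_def)
  define e where "e = (\<lambda>x. 1 - poly P (x\<^sup>2) / x ^ j)"
  have conte: "continuous_on {a..1} e" unfolding e_def using a by (auto intro!: continuous_intros)
  have eL: "\<bar>e x\<bar> \<le> L" if "x \<in> {a..1}" for x using P that by (auto simp: odd_approx_by_def e_def)
  have improve: "N \<le> degree q" if q: "\<And>x. x \<in> {a..1} \<Longrightarrow> \<bar>e x\<bar> = L \<Longrightarrow> e x * poly q (x\<^sup>2) > 0" for q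
  proof (rule ccontr)
    assume deg: "\<not> N \<le> degree q"
    have cq: "continuous_on {a..1} (\<lambda>x. poly q (x\<^sup>2) / x ^ j)" using a by (auto intro!: continuous_intros)
    have pos: "e x * (poly q (x\<^sup>2) / x ^ j) > 0" if "x \<in> {a..1}" "\<bar>e x\<bar> = L" for x
    proof -
      have "e x * poly q (x\<^sup>2) / x ^ j > 0" using q[OF that] that a by (intro divide_pos_pos) auto
      thus ?thesis by simp
    qed
    have "{a..1} \<noteq> {}" using a by simp
    then obtain \<epsilon> c' where c': "c' < L" "\<forall>x\<in>{a..1}. \<bar>e x - \<epsilon> * (poly q (x\<^sup>2) / x ^ j)\<bar> \<le> c'"
      using kolmogorov_improvement[OF compact_Icc _ conte cq L(1) eL pos] by blast
    have "degree (P + smult \<epsilon> q) < N"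
      using P deg by (intro degree_add_less) (auto simp: odd_approx_by_def intro: le_less_trans[OF degree_smult_le])
    moreover have "e x - \<epsilon> * (poly q (x\<^sup>2) / x ^ j) = 1 - poly (P + smult \<epsilon> q) (x\<^sup>2) / x ^ j" for x
      by (simp add: e_def add_divide_distrib)
    ultimately have "odd_approx_by N j a c' (P + smult \<epsilon> q)"
      using c'(2) by (auto simp: odd_approx_by_def)
    thus False using min c'(1) by blast
  qed
  \<comment> \<open>In the variable \<open>t = x^2\<close> the corrections become ordinary
    polynomials, as \<open>sign_alternation\<close> requires.\<close>
  define Z where "Z = (\<lambda>x. x\<^sup>2) ` {x \<in> {a..1}. \<bar>e x\<bar> = L}"
  define s where "s = (\<lambda>t. e (sqrt t))"
  have sqa: "sqrt (x\<^sup>2) = x" if "x \<in> {a..1}" for x using that a by auto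
  have "finite Z" unfolding Z_def e_def
    by (intro finite_imageI finite_subset[OF _ finite_extremal_points[OF j L(2,1), of P]]) (use a in auto)
  moreover have "Z \<noteq> {}"
  proof
    assume "Z = {}"
    hence "N \<le> degree (0 :: real poly)" by (intro improve) (auto simp: Z_def)
    thus False using P by (auto simp: odd_approx_by_def)
  qed
  moreover have "s z \<noteq> 0" if "z \<in> Z" for z using that sqa L by (auto simp: Z_def s_def)
  ultimately obtain q t r where q: "degree q \<le> r"
      "\<And>i. i < r \<Longrightarrow> t i < t (Suc i) \<and> s (t i) * s (t (Suc i)) < 0"
      "t ` {..r} \<subseteq> Z" "\<And>z. z \<in> Z \<Longrightarrow> poly q z * s z > 0"
    using sign_alternation[of Z s] by (auto simp: Bex_def) blast
  have "e x * poly q (x\<^sup>2) > 0" if "x \<in> {a..1}" "\<bar>e x\<bar> = L" for x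
    using q(4)[of "x\<^sup>2"] that sqa[OF that(1)] by (auto simp: Z_def s_def mult.commute)
  hence Nr: "N \<le> r" using improve q(1) by (meson order.trans)
  define x where "x = (\<lambda>i. sqrt (t i))"
  have tx: "x i \<in> {a..1} \<and> \<bar>e (x i)\<bar> = L" if "i \<le> N" for i
  proof -
    have "t i \<in> Z" using q(3) that Nr by auto
    then obtain y where "y \<in> {a..1}" "\<bar>e y\<bar> = L" "t i = y\<^sup>2" by (auto simp: Z_def)
    thus ?thesis using sqa[of y] by (simp add: x_def)
  qed
  have alt: "e (x (Suc i)) = - e (x i)" if "i < N" for i
    using q(2)[of i] that Nr tx[of i] tx[of "Suc i"] by (auto simp: x_def s_def abs_if mult_less_0_iff split: if_splits)
  define \<sigma> where "\<sigma> = e (x 0) / L"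
  have "e (x i) = \<sigma> * (-1) ^ i * L" if "i \<le> N" for i
    using that by (induction i) (use L alt in \<open>auto simp: \<sigma>_def\<close>)
  moreover have "\<sigma> = 1 \<or> \<sigma> = -1" using tx[of 0] L by (auto simp: \<sigma>_def abs_if split: if_splits)
  moreover have "x i < x (Suc i)" if "i < N" for i using q(2)[of i] that Nr by (auto simp: x_def)
  moreover have "x ` {..N} \<subseteq> {a..1}" using tx by auto
  ultimately show ?thesis using P unfolding e_def by (intro exI[of _ P] exI[of _ x] exI[of _ \<sigma>]) auto
qed

subsection \<open>Laurent polynomials\<close>

text \<open>The coefficient sum is kept next to the quotient \<open>poly G x / x^l\<close> because
  the two differ at 0: there the sum is the constant coefficient, while the quotient is 0 when
  \<open>l > 0\<close>.\<close>

lemma laurent_polys_iff: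
  assumes "l + n = d"
  shows "f \<in> laurent_polys l n \<longleftrightarrow>
    (\<exists>G. degree G \<le> d \<and> f = (\<lambda>x. \<Sum>i = - int l..int n. coeff G (nat (i + int l)) * x powi i))"
proof
  assume "f \<in> laurent_polys l n"
  then obtain c where c: "f = (\<lambda>x. \<Sum>i = - int l..int n. c i * x powi i)"
    by (auto simp: laurent_polys_def fun_eq_iff)
  define G where "G = (\<Sum>i\<le>d. monom (c (int i - int l)) i)"
  have "coeff G (nat (i + int l)) = c i" if "i \<in> {- int l..int n}" for i
  proof -
    have "coeff G (nat (i + int l)) = (\<Sum>u\<le>d. if u = nat (i + int l) then c (int u - int l) else 0)"
      by (auto simp: G_def coeff_sum intro!: sum.cong)
    also have "\<dots> = c (int (nat (i + int l)) - int l)"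
      using that assms by (subst sum.delta) auto
    finally show ?thesis using that by simp
  qed
  moreover have "degree G \<le> d" unfolding G_def
    by (intro degree_sum_le) (auto intro: order.trans[OF degree_monom_le])
  ultimately show "\<exists>G. degree G \<le> d \<and> f = (\<lambda>x. \<Sum>i = - int l..int n. coeff G (nat (i + int l)) * x powi i)"
    by (intro exI[of _ G]) (simp add: c)
next
  assume "\<exists>G. degree G \<le> d \<and> f = (\<lambda>x. \<Sum>i = - int l..int n. coeff G (nat (i + int l)) * x powi i)"
  then obtain G where "f = (\<lambda>x. \<Sum>i = - int l..int n. coeff G (nat (i + int l)) * x powi i)" by blast
  thus "f \<in> laurent_polys l n"
    unfolding laurent_polys_def by (intro CollectI exI[of _ "\<lambda>i. coeff G (nat (i + int l))"]) simp
qed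

lemma laurent_sum_eq_quotient:
  fixes x :: real
  assumes "l + n = d" "degree G \<le> d" "x \<noteq> 0"
  shows "(\<Sum>i = - int l..int n. coeff G (nat (i + int l)) * x powi i) = poly G x / x ^ l"
proof -
  have "(\<Sum>i = - int l..int n. coeff G (nat (i + int l)) * x powi i) =
    (\<Sum>u\<le>d. coeff G u * (x ^ u / x ^ l))"
  proof (rule sum.reindex_bij_witness[where j = "\<lambda>i. nat (i + int l)" and i = "\<lambda>u. int u - int l"])
    fix i assume "i \<in> {- int l..int n}"
    hence "x powi i = x ^ nat (i + int l) / x ^ l"
      using \<open>x \<noteq> 0\<close> power_int_diff[of x "i + int l" "int l"] by (simp add: power_int_def)
    thus "coeff G (nat (i + int l)) * (x ^ nat (i + int l) / x ^ l) = coeff G (nat (i + int l)) * x powi i"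
      by simp
  qed (use assms in auto)
  also have "\<dots> = poly G x / x ^ l"
  proof -
    have "poly G x = poly (\<Sum>u\<le>d. monom (coeff G u) u) x"
      using poly_as_sum_of_monoms'[OF assms(2)] by simp
    thus ?thesis by (simp add: poly_sum poly_monom sum_divide_distrib)
  qed
  finally show ?thesis .
qed

lemma laurent_polys_quotient:
  assumes "f \<in> laurent_polys l n"
  obtains G where "degree G \<le> l + n" "\<And>x. x \<noteq> 0 \<Longrightarrow> f x = poly G x / x ^ l"
  using assms laurent_sum_eq_quotient by (auto simp: laurent_polys_iff[OF refl])

text \<open>Equality is needed as functions on the whole line, 0 included, because
  \<open>extremal_laurent\<close> is a definite description over such functions. It follows from
  equality of the coefficient polynomials.\<close>

lemma laurent_polys_eqI:
  assumes f: "f \<in> laurent_polys l n" and g: "g \<in> laurent_polys l n"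
    and eq: "\<And>x. x \<in> A \<Longrightarrow> f x = g x" "0 \<notin> A" "card A > l + n"
  shows "f = g"
proof -
  obtain G where G: "degree G \<le> l + n" "f = (\<lambda>x. \<Sum>i = - int l..int n. coeff G (nat (i + int l)) * x powi i)"
    using f by (auto simp: laurent_polys_iff[OF refl])
  obtain H where H: "degree H \<le> l + n" "g = (\<lambda>x. \<Sum>i = - int l..int n. coeff H (nat (i + int l)) * x powi i)"
    using g by (auto simp: laurent_polys_iff[OF refl])
  have "G = H"
  proof (rule poly_eqI_degree)
    show "card A > degree G" "card A > degree H" using G H eq(3) by auto
    fix x assume x: "x \<in> A"
    hence x0: "x \<noteq> 0" using eq(2) by auto
    have "poly G x / x ^ l = poly H x / x ^ l"
      using eq(1)[OF x] unfolding G(2) H(2) laurent_sum_eq_quotient[OF refl G(1) x0] laurent_sum_eq_quotient[OF refl H(1) x0] .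
    thus "poly G x = poly H x" using x0 by simp
  qed
  thus ?thesis using G H by simp
qed

text \<open>For a numerator over \<open>x^j\<close> with \<open>j\<close> odd, \<open>Q\<close>
  carries the odd part of the Laurent polynomial and \<open>R\<close> the even part. The two
  exchange roles in each \<open>pCons\<close> step.\<close>

lemma poly_even_odd_parts:
  fixes G :: "'a::comm_ring_1 poly"
  shows "\<exists>Q R. 2 * degree Q \<le> degree G \<and> (R = 0 \<or> 2 * degree R + 1 \<le> degree G) \<and>
    (\<forall>x. poly G x = poly Q (x\<^sup>2) + x * poly R (x\<^sup>2))"
proof (induction G)
  case 0
  show ?case by (intro exI[of _ 0]) auto
next
  case (pCons a G)
  then obtain Q R where QR: "2 * degree Q \<le> degree G" "R = 0 \<or> 2 * degree R + 1 \<le> degree G"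
    "\<And>x. poly G x = poly Q (x\<^sup>2) + x * poly R (x\<^sup>2)" by blast
  show ?case
  proof (cases "G = 0")
    case True
    show ?thesis by (intro exI[of _ "[:a:]"] exI[of _ 0]) (auto simp: True)
  next
    case False
    have "degree (pCons a R) \<le> Suc (degree R)" by (rule degree_pCons_le)
    hence "2 * degree (pCons a R) \<le> degree (pCons a G)" using QR(2) False by auto
    moreover have "2 * degree Q + 1 \<le> degree (pCons a G)" using QR(1) False by simp
    moreover have "poly (pCons a G) x = poly (pCons a R) (x\<^sup>2) + x * poly Q (x\<^sup>2)" for x
      by (simp add: QR(3) algebra_simps power2_eq_square)
    ultimately show ?thesis by blast
  qed
qed

text \<open>A supremum of reals says nothing about an unbounded set, so this comes before any
  comparison of \<open>sgn_deviation\<close> with a number.\<close>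

lemma sgn_deviation_bdd:
  assumes "0 < a" "f \<in> laurent_polys l n"
  shows "bdd_above ((\<lambda>x. \<bar>sgn x - f x\<bar>) ` {x. a \<le> \<bar>x\<bar> \<and> \<bar>x\<bar> \<le> 1})"
proof -
  obtain G where G: "\<And>x. x \<noteq> 0 \<Longrightarrow> f x = poly G x / x ^ l"
    using laurent_polys_quotient[OF assms(2)] by metis
  have "compact ({x. a \<le> \<bar>x\<bar>} \<inter> {-1..1::real})"
    by (intro closed_Int_compact closed_Collect_le continuous_intros compact_Icc)
  moreover have "continuous_on ({x. a \<le> \<bar>x\<bar>} \<inter> {-1..1}) (\<lambda>x. poly G x / x ^ l)"
    using \<open>0 < a\<close> by (auto intro!: continuous_intros)
  ultimately have "bounded ((\<lambda>x. poly G x / x ^ l) ` ({x. a \<le> \<bar>x\<bar>} \<inter> {-1..1}))"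
    using compact_continuous_image compact_imp_bounded by blast
  then obtain M where M: "\<forall>x\<in>{x. a \<le> \<bar>x\<bar>} \<inter> {-1..1}. \<bar>poly G x / x ^ l\<bar> \<le> M"
    by (auto simp: bounded_iff simp del: abs_divide)
  have "\<bar>sgn x - f x\<bar> \<le> 1 + M" if "a \<le> \<bar>x\<bar>" "\<bar>x\<bar> \<le> 1" for x
  proof -
    have "x \<in> {x. a \<le> \<bar>x\<bar>} \<inter> {-1..1}" using that by auto
    hence "\<bar>f x\<bar> \<le> M" using bspec[OF M] G[of x] that \<open>0 < a\<close> by auto
    moreover have "\<bar>sgn x\<bar> \<le> 1" by (simp add: sgn_if)
    ultimately show ?thesis by linarith
  qed
  thus ?thesis by (auto simp: bdd_above_def)
qed

lemma sgn_deviation_le_iff: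
  assumes "0 < a" "a < 1" "f \<in> laurent_polys l n"
  shows "sgn_deviation a f \<le> c \<longleftrightarrow> (\<forall>x. a \<le> \<bar>x\<bar> \<and> \<bar>x\<bar> \<le> 1 \<longrightarrow> \<bar>sgn x - f x\<bar> \<le> c)"
proof -
  have "1 \<in> {x. a \<le> \<bar>x\<bar> \<and> \<bar>x\<bar> \<le> 1}" using assms by auto
  hence "{x. a \<le> \<bar>x\<bar> \<and> \<bar>x\<bar> \<le> 1} \<noteq> {}" by blast
  from cSUP_le_iff[OF this sgn_deviation_bdd[OF assms(1,3)], of c]
  show ?thesis unfolding sgn_deviation_def by auto
qed

text \<open>A competitor with error at most \<open>L\<close> has an odd part whose difference to the alternating
  approximant weakly alternates in sign at \<open>N + 1\<close> points, so the odd parts agree. As the errors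
  at \<open>\<plusminus>x i\<close> are extremal, the even part of the competitor then vanishes at these points.\<close>

lemma alternation_imp_extremal:
  assumes k: "k \<ge> 1" and m: "m \<ge> 1" and a: "0 < a" "a < 1"
    and P: "odd_approx_by (k + m) (2 * k - 1) a L P"
    and mono: "\<And>i. i < k + m \<Longrightarrow> x i < x (Suc i)" and xa: "x ` {..k + m} \<subseteq> {a..1}"
    and \<sigma>: "\<sigma> = 1 \<or> \<sigma> = -1"
    and alt: "\<And>i. i \<le> k + m \<Longrightarrow> 1 - poly P ((x i)\<^sup>2) / x i ^ (2 * k - 1) = \<sigma> * (-1) ^ i * L"
    and L: "0 < L"
  shows "approx_error k m a = L"
    and "\<And>y. y \<noteq> 0 \<Longrightarrow> extremal_laurent k m a y = poly P (y\<^sup>2) / y ^ (2 * k - 1)"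
proof -
  define N where "N = k + m"
  define j where "j = 2 * k - 1"
  define LP where "LP = laurent_polys (2 * k - 1) (2 * m - 1)"
  have jn: "(2 * k - 1) + (2 * m - 1) = 2 * N - 2" using k m by (simp add: N_def)
  have "odd j" using k by (simp add: j_def)
  have xpos: "x i > 0" "x i \<in> {a..1}" if "i \<le> N" for i using xa that a by (auto simp: N_def)
  have xm: "x i < x l" if "i < l" "l \<le> N" for i l
    using that
  proof (induction l)
    case (Suc l)
    thus ?case using mono[of l] by (cases "i = l") (auto simp: N_def)
  qed simp
  have degP: "degree P < N" and errP: "\<And>y. y \<in> {a..1} \<Longrightarrow> \<bar>1 - poly P (y\<^sup>2) / y ^ j\<bar> \<le> L"
    using P by (auto simp: odd_approx_by_def N_def j_def)
  define G where "G = pcompose P [:0, 0, 1:]"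
  have degG: "degree G \<le> 2 * N - 2" using degP by (simp add: G_def degree_pcompose)
  have polG: "poly G y = poly P (y\<^sup>2)" for y by (simp add: G_def poly_pcompose power2_eq_square)
  define f where "f = (\<lambda>x. \<Sum>i = - int (2 * k - 1)..int (2 * m - 1). coeff G (nat (i + int (2 * k - 1))) * x powi i)"
  have fLP: "f \<in> LP" unfolding LP_def laurent_polys_iff[OF jn] f_def using degG by blast
  have f: "f y = poly P (y\<^sup>2) / y ^ j" if "y \<noteq> 0" for y
    using laurent_sum_eq_quotient[OF jn degG that] by (simp add: f_def polG j_def)
  have fodd: "f (- y) = - f y" if "y \<noteq> 0" for y
    using f[of y] f[of "- y"] that \<open>odd j\<close> by simp
  note le_iff = sgn_deviation_le_iff[OF a, of _ "2 * k - 1" "2 * m - 1", folded LP_def]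
  have devf: "sgn_deviation a f \<le> L"
    unfolding le_iff[OF fLP]
  proof safe
    fix y assume y: "a \<le> \<bar>y\<bar>" "\<bar>y\<bar> \<le> 1"
    show "\<bar>sgn y - f y\<bar> \<le> L"
    proof (cases "y > 0")
      case True thus ?thesis using errP[of y] f[of y] y by auto
    next
      case False
      hence y': "y < 0" using y a by auto
      have "\<bar>1 - f (- y)\<bar> \<le> L" using errP[of "- y"] f[of "- y"] y y' by auto
      thus ?thesis using fodd[of y] y' by auto
    qed
  qed
  have unique: "g = f" if g: "g \<in> LP" and dev: "sgn_deviation a g \<le> L" for g
  proof -
    have gdev: "\<bar>sgn y - g y\<bar> \<le> L" if "a \<le> \<bar>y\<bar>" "\<bar>y\<bar> \<le> 1" for y
      using dev that unfolding le_iff[OF g] by auto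
    obtain H where H: "degree H \<le> 2 * N - 2" "\<And>y. y \<noteq> 0 \<Longrightarrow> g y = poly H y / y ^ j"
      using g laurent_polys_quotient[of g "2 * k - 1" "2 * m - 1"] unfolding LP_def jn j_def by metis
    obtain Q R where Q: "2 * degree Q \<le> degree H" "\<And>y. poly H y = poly Q (y\<^sup>2) + y * poly R (y\<^sup>2)"
      using poly_even_odd_parts[of H] by blast
    have degQ: "degree Q < N" using Q(1) H(1) k by (simp add: N_def)
    \<comment> \<open>\<open>Q\<close> carries the odd part of \<open>g\<close>, and the error of
      the odd part is the mean of the error of \<open>g\<close> at \<open>y\<close> and of its
      negated error at \<open>- y\<close>.\<close>
    have avg: "1 - poly Q (y\<^sup>2) / y ^ j = ((1 - g y) + (1 + g (- y))) / 2" if "y > 0" for y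
    proof -
      have "g y - g (- y) = 2 * poly Q (y\<^sup>2) / y ^ j"
        using H(2)[of y] H(2)[of "- y"] that \<open>odd j\<close> Q(2)[of y] Q(2)[of "- y"]
        by (simp add: add_divide_distrib[symmetric] diff_divide_distrib[symmetric])
      thus ?thesis by (simp add: field_simps)
    qed
    have bnd: "\<bar>1 - g y\<bar> \<le> L" "\<bar>1 + g (- y)\<bar> \<le> L" if "y \<in> {a..1}" for y
      using gdev[of y] gdev[of "- y"] that a by auto
    have "Q - P = 0"
    proof (rule weakly_alternating_poly_eq_0[where N = N and t = "\<lambda>i. (x i)\<^sup>2" and \<sigma> = \<sigma>])
      show "(x i)\<^sup>2 < (x l)\<^sup>2" if "i < l" "l \<le> N" for i l
        using xm[OF that] xpos[of i] that by (intro power_strict_mono) auto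
      show "degree (Q - P) < N" using degP degQ by (intro degree_diff_less)
      show "\<sigma> \<noteq> 0" using \<sigma> by auto
      fix i assume i: "i \<le> N"
      have "\<bar>1 - poly Q ((x i)\<^sup>2) / x i ^ j\<bar> \<le> L"
        unfolding avg[OF xpos(1)[OF i]] using bnd[OF xpos(2)[OF i]] by (auto simp: abs_le_iff)
      moreover have "\<bar>\<sigma> * (-1) ^ i\<bar> = 1" using \<sigma> by (auto simp: power_abs abs_mult)
      ultimately have "\<sigma> * (-1) ^ i * (1 - poly Q ((x i)\<^sup>2) / x i ^ j) \<le> L"
        by (metis abs_ge_self abs_mult mult_1 order.trans)
      moreover have "\<sigma> * (-1) ^ i * (1 - poly P ((x i)\<^sup>2) / x i ^ j) = L"
      proof -
        have "1 - poly P ((x i)\<^sup>2) / x i ^ j = \<sigma> * (-1) ^ i * L" using alt[of i] i by (simp add: N_def j_def)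
        moreover have "\<sigma> * (-1) ^ i * (\<sigma> * (-1) ^ i * L) = L"
          using \<sigma> by (auto simp: power_mult_distrib[symmetric] simp flip: mult.assoc)
        ultimately show ?thesis by simp
      qed
      ultimately have "0 \<le> \<sigma> * (-1) ^ i * (1 - poly P ((x i)\<^sup>2) / x i ^ j) -
          \<sigma> * (-1) ^ i * (1 - poly Q ((x i)\<^sup>2) / x i ^ j)" by linarith
      also have "\<dots> = \<sigma> * (-1) ^ i * ((poly Q ((x i)\<^sup>2) - poly P ((x i)\<^sup>2)) / x i ^ j)"
        by (simp only: right_diff_distrib diff_divide_distrib)
      finally have "0 \<le> \<sigma> * (-1) ^ i * ((poly Q ((x i)\<^sup>2) - poly P ((x i)\<^sup>2)) / x i ^ j)" .
      hence "0 \<le> (\<sigma> * (-1) ^ i * (poly Q ((x i)\<^sup>2) - poly P ((x i)\<^sup>2))) / x i ^ j"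
        by simp
      moreover have "x i ^ j > 0" using xpos(1)[OF i] by simp
      ultimately show "0 \<le> \<sigma> * (-1) ^ i * poly (Q - P) ((x i)\<^sup>2)"
        by (simp only: poly_diff) (simp add: zero_le_divide_iff not_le)
    qed
    hence QP: "Q = P" by simp
    have eq: "g (x i) = f (x i) \<and> g (- x i) = f (- x i)" if i: "i \<le> N" for i
    proof -
      have mid: "u = w" "v = w" if "u = v" "w = (u + v) / 2" for u v w :: real using that by simp_all
      have "((1 - g (x i)) + (1 + g (- x i))) / 2 = \<sigma> * (-1) ^ i * L"
        using alt[of i] i by (simp only: avg[OF xpos(1)[OF i], unfolded QP j_def] N_def)
      moreover have "\<bar>\<sigma> * (-1) ^ i * L\<bar> = L" using \<sigma> L by (auto simp: abs_mult power_abs)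
      ultimately have "\<bar>((1 - g (x i)) + (1 + g (- x i))) / 2\<bar> = L" by (simp only:)
      hence "\<bar>(1 - g (x i)) + (1 + g (- x i))\<bar> / 2 = L" by (simp only: abs_divide abs_numeral)
      hence "\<bar>(1 - g (x i)) + (1 + g (- x i))\<bar> = 2 * L" by (simp only: field_simps)
      \<comment> \<open>Two numbers in \<open>[-L, L]\<close> whose mean is \<open>L\<close> or
        \<open>- L\<close> coincide.\<close>
      hence "1 - g (x i) = 1 + g (- x i)" using bnd[OF xpos(2)[OF i]] by linarith
      hence "1 - g (x i) = 1 - poly P ((x i)\<^sup>2) / x i ^ j" "1 + g (- x i) = 1 - poly P ((x i)\<^sup>2) / x i ^ j"
        using avg[OF xpos(1)[OF i], unfolded QP] mid by blast+
      thus ?thesis using f[of "x i"] fodd[of "x i"] xpos(1)[OF i] by auto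
    qed
    have inj: "inj_on x {..N}"
      by (rule inj_onI) (metis atMost_iff linorder_neqE_nat xm order_less_irrefl)
    \<comment> \<open>\<open>2 * N + 2\<close> points against the \<open>2 * N - 1\<close>
      coefficients of a Laurent polynomial of this degree.\<close>
    have "card (x ` {..N} \<union> uminus ` x ` {..N}) = card (x ` {..N}) + card (uminus ` x ` {..N})"
    proof (rule card_Un_disjoint)
      show "x ` {..N} \<inter> uminus ` x ` {..N} = {}"
        using xpos(1) by (auto simp: disjoint_iff) (smt (verit) atMost_iff)
    qed auto
    also have "card (uminus ` x ` {..N}) = card (x ` {..N})" by (rule card_image) simp
    also have "card (x ` {..N}) = N + 1" using inj by (simp add: card_image)
    finally have "card (x ` {..N} \<union> uminus ` x ` {..N}) > 2 * N - 2" by simp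
    hence card: "card (x ` {..N} \<union> uminus ` x ` {..N}) > (2 * k - 1) + (2 * m - 1)" by (simp only: jn)
    have "x i \<noteq> 0" if "i \<le> N" for i using xpos(1)[OF that] by simp
    hence "0 \<notin> x ` {..N} \<union> uminus ` x ` {..N}" by force
    moreover have "g y = f y" if "y \<in> x ` {..N} \<union> uminus ` x ` {..N}" for y
      using that eq by auto
    ultimately show "g = f"
      using card by (intro laurent_polys_eqI[OF g[unfolded LP_def] fLP[unfolded LP_def]])
  qed
  have devfL: "sgn_deviation a f = L"
  proof (rule antisym[OF devf], rule ccontr)
    assume "\<not> L \<le> sgn_deviation a f"
    moreover have "\<bar>sgn (x 0) - f (x 0)\<bar> \<le> sgn_deviation a f"
      using iffD1[OF le_iff[OF fLP] order_refl, rule_format, of "x 0"] xpos[of 0] by simp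
    moreover have "\<bar>1 - f (x 0)\<bar> = L" using alt[of 0] f[of "x 0"] xpos(1)[of 0] \<sigma> L by (auto simp: j_def)
    ultimately show False using xpos(1)[of 0] by simp
  qed
  have low: "L \<le> sgn_deviation a g" if "g \<in> LP" for g
    using unique[OF that] devfL by (cases "sgn_deviation a g \<le> L") auto
  show "approx_error k m a = L"
    unfolding approx_error_def LP_def[symmetric]
  proof (rule antisym)
    show "(INF f\<in>LP. sgn_deviation a f) \<le> L"
      using cINF_lower[of "sgn_deviation a" LP f] fLP low devfL by (auto simp: bdd_below_def)
    show "L \<le> (INF f\<in>LP. sgn_deviation a f)"
      using low fLP by (intro cINF_greatest) auto
  qed
  have "extremal_laurent k m a = f"
    unfolding extremal_laurent_def LP_def[symmetric]
    by (rule the_equality) (use fLP low devfL unique in fastforce)+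
  thus "extremal_laurent k m a y = poly P (y\<^sup>2) / y ^ (2 * k - 1)" if "y \<noteq> 0" for y
    using f[OF that] by (simp add: j_def)
qed

subsection \<open>The argument along the imaginary axis\<close>

text \<open>Logarithms and arguments are compared only modulo \<open>2 * pi\<close>; along a
  connected set this turns such a congruence into an equality of values.\<close>

lemma continuous_lattice_valued_constant:
  fixes g :: "'a::topological_space \<Rightarrow> real"
  assumes "connected S" "continuous_on S g" "c > 0"
    and lat: "\<And>x. x \<in> S \<Longrightarrow> \<exists>n::int. g x = b + c * of_int n"
    and "x \<in> S" "y \<in> S"
  shows "g x = g y"
proof -
  have "g constant_on S"
  proof (rule continuous_discrete_range_constant[OF assms(1,2)])
    fix x assume x: "x \<in> S"
    have "c \<le> norm (g y - g x)" if y: "y \<in> S" "g y \<noteq> g x" for y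
    proof -
      obtain n l :: int where nl: "g x = b + c * of_int n" "g y = b + c * of_int l"
        using lat x y by blast
      hence "n \<noteq> l" using y by auto
      hence "1 \<le> \<bar>l - n\<bar>" by linarith
      hence "1 \<le> \<bar>real_of_int (l - n)\<bar>" by linarith
      moreover have "g y - g x = c * real_of_int (l - n)" using nl by (simp add: algebra_simps)
      ultimately show ?thesis using \<open>c > 0\<close> by (simp add: abs_mult)
    qed
    thus "\<exists>e>0. \<forall>y. y \<in> S \<and> g y \<noteq> g x \<longrightarrow> e \<le> norm (g y - g x)" using \<open>c > 0\<close> by blast
  qed
  thus ?thesis using assms(5,6) by (auto simp: constant_on_def)
qed

lemma cis_arctan: "Complex 1 (- t) = of_real (sqrt (1 + t\<^sup>2)) * cis (- arctan t)"
proof -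
  have "sqrt (1 + t\<^sup>2) \<noteq> 0" by (smt (verit) real_sqrt_eq_0_iff zero_le_power2)
  thus ?thesis by (auto simp: complex_eq_iff cos_arctan sin_arctan)
qed

text \<open>Each factor is \<open>- Re z * (1 - i t)\<close> with
  \<open>t = (y - Im z) / Re z\<close>. Leaving the sign of \<open>- Re z\<close> in the real factor
  makes the remaining argument, a sum of arctangents, continuous on the whole line and explicit at
  both ends.\<close>

lemma prod_roots_polar:
  assumes "\<forall>z\<in>#M. Re z \<noteq> 0"
  shows "\<exists>r>0. (\<Prod>z\<in>#M. \<i> * of_real y - z) =
           of_real (r * (\<Prod>z\<in>#M. - Re z)) * cis (- (\<Sum>z\<in>#M. arctan ((y - Im z) / Re z)))"
  using assms
proof (induction M)
  case empty
  show ?case by (intro exI[of _ 1]) simp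
next
  case (add z M)
  then obtain r where r: "r > 0" "(\<Prod>z\<in>#M. \<i> * of_real y - z) =
           of_real (r * (\<Prod>z\<in>#M. - Re z)) * cis (- (\<Sum>z\<in>#M. arctan ((y - Im z) / Re z)))"
    by auto
  define t where "t = (y - Im z) / Re z"
  have z: "Re z \<noteq> 0" using add by auto
  have "\<i> * of_real y - z = of_real (- Re z) * Complex 1 (- t)"
    using z by (auto simp: t_def complex_eq_iff field_simps)
  also have "\<dots> = of_real (- Re z * sqrt (1 + t\<^sup>2)) * cis (- arctan t)"
    by (simp add: cis_arctan)
  finally have "(\<Prod>z\<in>#add_mset z M. \<i> * of_real y - z) =
     of_real (- Re z * sqrt (1 + t\<^sup>2)) * cis (- arctan t) *
     (of_real (r * (\<Prod>z\<in>#M. - Re z)) * cis (- (\<Sum>z\<in>#M. arctan ((y - Im z) / Re z))))"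
    using r by simp
  also have "\<dots> = of_real ((sqrt (1 + t\<^sup>2) * r) * (\<Prod>z\<in>#add_mset z M. - Re z)) *
      (cis (- arctan t) * cis (- (\<Sum>z\<in>#M. arctan ((y - Im z) / Re z))))"
    by simp
  also have "cis (- arctan t) * cis (- (\<Sum>z\<in>#M. arctan ((y - Im z) / Re z))) =
    cis (- (\<Sum>z\<in>#add_mset z M. arctan ((y - Im z) / Re z)))"
    by (simp add: cis_mult t_def)
  finally show ?case
    using r(1) by (intro exI[of _ "sqrt (1 + t\<^sup>2) * r"]) (auto intro!: mult_pos_pos add_pos_nonneg)
qed

lemma sum_arctan_at_top:
  assumes "\<forall>z\<in>#M. Re z \<noteq> 0"
  shows "((\<lambda>y. \<Sum>z\<in>#M. arctan ((y - Im z) / Re z)) \<longlongrightarrow> (\<Sum>z\<in>#M. sgn (Re z) * (pi / 2))) at_top"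
  using assms
proof (induction M)
  case (add z M)
  have "((\<lambda>y. arctan ((y - Im z) / Re z)) \<longlongrightarrow> sgn (Re z) * (pi / 2)) at_top"
  proof (cases "Re z > 0")
    case True
    hence "filterlim (\<lambda>y. (y - Im z) / Re z) at_top at_top" by real_asymp
    thus ?thesis using True filterlim_compose[OF tendsto_arctan_at_top] by simp
  next
    case False
    hence z: "Re z < 0" using add.prems by auto
    hence "filterlim (\<lambda>y. (y - Im z) / Re z) at_bot at_top" by real_asymp
    thus ?thesis using z filterlim_compose[OF tendsto_arctan_at_bot] by simp
  qed
  thus ?case using add by (auto intro!: tendsto_add)
qed simp

lemma sum_arctan_at_bot:
  assumes "\<forall>z\<in>#M. Re z \<noteq> 0"
  shows "((\<lambda>y. \<Sum>z\<in>#M. arctan ((y - Im z) / Re z)) \<longlongrightarrow> - (\<Sum>z\<in>#M. sgn (Re z) * (pi / 2))) at_bot"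
  using assms
proof (induction M)
  case (add z M)
  have "((\<lambda>y. arctan ((y - Im z) / Re z)) \<longlongrightarrow> - (sgn (Re z) * (pi / 2))) at_bot"
  proof (cases "Re z > 0")
    case True
    hence "filterlim (\<lambda>y. (y - Im z) / Re z) at_bot at_bot" by real_asymp
    thus ?thesis using True filterlim_compose[OF tendsto_arctan_at_bot] by simp
  next
    case False
    hence z: "Re z < 0" using add.prems by auto
    hence "filterlim (\<lambda>y. (y - Im z) / Re z) at_top at_bot" by real_asymp
    thus ?thesis using z filterlim_compose[OF tendsto_arctan_at_top] by simp
  qed
  moreover have "((\<lambda>y. \<Sum>z\<in>#M. arctan ((y - Im z) / Re z)) \<longlongrightarrow> - (\<Sum>z\<in>#M. sgn (Re z) * (pi / 2))) at_bot"
    using add by auto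
  ultimately show ?case using tendsto_add by fastforce
qed simp

lemma cis_eqI_pos:
  assumes "r1 > 0" "r2 > 0" "of_real r1 * cis a = of_real r2 * cis b"
  shows "cis a = cis b"
proof -
  have "norm (of_real r1 * cis a) = norm (of_real r2 * cis b)" using assms(3) by (rule arg_cong)
  hence "r1 = r2" using assms(1,2) by (simp add: norm_mult)
  thus ?thesis using assms by auto
qed

text \<open>The argument of \<open>p\<close> on the imaginary axis is computed twice. The roots give
  \<open>- T\<close>, a sum of arctangents that is continuous on the whole line; the form of
  \<open>p\<close> gives \<open>- A\<close> on each half-line, up to the constant argument of
  \<open>(\<i> * y) ^ j\<close>. So \<open>A - T\<close> is constant on each half-line. In the
  comparison of the limits at 0 and at the two infinite ends, both constants and \<open>T 0\<close>
  cancel.\<close>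

lemma root_balance:
  fixes p :: "complex poly" and h :: "real \<Rightarrow> real"
  assumes p0: "p \<noteq> 0" and roots: "\<And>z. poly p z = 0 \<Longrightarrow> Re z \<noteq> 0"
    and \<tau>: "\<tau> > 0"
    and contp: "continuous_on {0<..} h" and odd: "\<And>y. h (- y) = - h y"
    and p: "\<And>y. y \<noteq> 0 \<Longrightarrow> poly p (\<i> * of_real y) = (\<i> * of_real y) ^ j * Complex \<tau> (- h y)"
    and lt: "((\<lambda>y. arctan (h y / \<tau>)) \<longlongrightarrow> \<alpha>) at_top"
    and l0: "((\<lambda>y. arctan (h y / \<tau>)) \<longlongrightarrow> \<beta>) (at_right 0)"
  shows "(\<Sum>z\<in>#proots p. sgn (Re z)) * pi = 2 * (\<alpha> - \<beta>)"
proof -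
  define M where "M = proots p"
  define T where "T = (\<lambda>y. \<Sum>z\<in>#M. arctan ((y - Im z) / Re z))"
  define A where "A = (\<lambda>y. arctan (h y / \<tau>))"
  have M: "\<forall>z\<in>#M. Re z \<noteq> 0" using roots p0 by (auto simp: M_def)
  define C where "C = lead_coeff p"
  define D where "D = (\<Prod>z\<in>#M. - Re z)"
  have C0: "C \<noteq> 0" using p0 by (simp add: C_def)
  have D0: "D \<noteq> 0" using M by (auto simp: D_def)
  have contT: "continuous_on S T" for S unfolding T_def
    using M by (induction M) (auto intro!: continuous_intros)
  have polT: "\<exists>r>0. poly p (\<i> * of_real y) = C * (of_real (r * D) * cis (- T y))" for y
  proof -
    have "poly (smult C (\<Prod>z\<in>#M. [:- z, 1:])) (\<i> * of_real y) = C * (\<Prod>z\<in>#M. \<i> * of_real y - z)"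
      by (simp add: poly_prod_mset)
    hence "poly p (\<i> * of_real y) = C * (\<Prod>z\<in>#M. \<i> * of_real y - z)"
      by (simp add: C_def M_def complex_poly_decompose_multiset)
    thus ?thesis using prod_roots_polar[OF M, of y] by (auto simp: D_def T_def)
  qed
  have polA: "\<exists>r>0. poly p (\<i> * of_real y) = (\<i> * of_real y) ^ j * (of_real r * cis (- A y))"
    if "y \<noteq> 0" for y
  proof -
    have "Complex \<tau> (- h y) = of_real \<tau> * Complex 1 (- (h y / \<tau>))"
      using \<tau> by (simp add: complex_eq_iff)
    also have "\<dots> = of_real (\<tau> * sqrt (1 + (h y / \<tau>)\<^sup>2)) * cis (- A y)"
      unfolding cis_arctan A_def by simp
    finally have "Complex \<tau> (- h y) = of_real (\<tau> * sqrt (1 + (h y / \<tau>)\<^sup>2)) * cis (- A y)" .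
    moreover have "\<tau> * sqrt (1 + (h y / \<tau>)\<^sup>2) > 0" using \<tau> by (auto intro!: mult_pos_pos add_pos_nonneg)
    ultimately show ?thesis using p[OF that] by auto
  qed
  have key: "A x - T x = A y - T y" if "connected S" "S \<subseteq> {0<..} \<or> S \<subseteq> {..<0}"
      "x \<in> S" "y \<in> S" "continuous_on S A" for S x y
  proof (rule continuous_lattice_valued_constant[OF \<open>connected S\<close> _ _ _ \<open>x \<in> S\<close> \<open>y \<in> S\<close>])
    show "continuous_on S (\<lambda>y. A y - T y)" using that contT by (intro continuous_intros)
    show "(2 * pi :: real) > 0" by simp
    fix s assume s: "s \<in> S"
    have s0: "s \<noteq> 0" "x \<noteq> 0" and sx: "s / x > 0"
      using s that by (auto simp: zero_less_divide_iff)
    have main: "\<exists>r q. r > 0 \<and> q > 0 \<and> C * of_real (r * D) * cis (A s - T s) = (\<i> * of_real s)^j * of_real q" if s0: "s \<noteq> 0" for s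
    proof -
      obtain r where r: "r > 0" "poly p (\<i> * of_real s) = C * (of_real (r * D) * cis (- T s))"
        using polT by blast
      obtain q where q: "q > 0" "poly p (\<i> * of_real s) = (\<i> * of_real s)^j * (of_real q * cis (- A s))"
        using polA s0 by blast
      have "C * (of_real (r * D) * cis (- T s)) * cis (A s) = (\<i> * of_real s)^j * (of_real q * cis (- A s)) * cis (A s)"
        using r q by simp
      moreover have "cis (- T s) * cis (A s) = cis (A s - T s)" by (simp add: cis_mult)
      moreover have "cis (- A s) * cis (A s) = 1" by (simp add: cis_mult)
      ultimately have "C * of_real (r * D) * cis (A s - T s) = (\<i> * of_real s)^j * of_real q"
        by (simp only: mult.assoc mult_1_right)
      thus ?thesis using r q by blast
    qed
    obtain r q where 1: "r > 0" "q > 0" "C * of_real (r * D) * cis (A s - T s) = (\<i> * of_real s)^j * of_real q"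
      using main s0 by blast
    obtain r' q' where 2: "r' > 0" "q' > 0" "C * of_real (r' * D) * cis (A x - T x) = (\<i> * of_real x)^j * of_real q'"
      using main s0 by blast
    \<comment> \<open>On one half-line the ratio \<open>s / x\<close> is positive, so the
      \<open>j\<close>-th powers differ by a positive factor and have the same argument.\<close>
    have "\<i> * of_real s = (\<i> * of_real x) * of_real (s / x)" using s0 by simp
    hence "(\<i> * of_real s)^j = ((\<i> * of_real x) * of_real (s / x))^j" by (rule arg_cong)
    also have "\<dots> = (\<i> * of_real x)^j * of_real ((s/x)^j)"
      by (simp only: power_mult_distrib of_real_power)
    finally have "(\<i> * of_real s)^j = (\<i> * of_real x)^j * of_real ((s/x)^j)" .
    hence "C * of_real (r * D) * cis (A s - T s) * of_real q' = (\<i> * of_real x)^j * of_real q' * of_real ((s/x)^j) * of_real q"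
      using 1 by simp
    also have "\<dots> = C * of_real (r' * D) * cis (A x - T x) * of_real ((s/x)^j) * of_real q"
      using 2 by simp
    finally have "(C * of_real D) * (of_real (r * q') * cis (A s - T s)) =
        (C * of_real D) * (of_real (r' * (s/x)^j * q) * cis (A x - T x))"
      by (simp add: mult_ac)
    hence "of_real (r * q') * cis (A s - T s) = of_real (r' * (s/x)^j * q) * cis (A x - T x)"
      using C0 D0 by (simp only: mult_cancel_left) auto
    hence "cis (A s - T s) = cis (A x - T x)"
      using 1 2 sx by (intro cis_eqI_pos[of "r * q'" "r' * (s/x)^j * q"]) auto
    hence "cos (A s - T s) = cos (A x - T x)" "sin (A s - T s) = sin (A x - T x)"
      by (auto simp: complex_eq_iff)
    hence "\<exists>n::int. A s - T s = A x - T x + 2 * pi * of_int n"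
      using sin_cos_eq_iff by (metis (no_types, opaque_lifting) mult.commute mult.assoc)
    thus "\<exists>n::int. A s - T s = A x - T x + 2 * pi * of_int n" .
  qed
  have contA: "continuous_on {0<..} A" unfolding A_def
    using contp \<tau> by (intro continuous_intros) auto
  have Aodd: "A (- y) = - A y" for y by (simp add: A_def odd arctan_minus)
  have contA': "continuous_on {..<0} A"
  proof -
    have "continuous_on {..<0} (\<lambda>y. - A (- y))"
      by (intro continuous_intros continuous_on_compose2[OF contA]) auto
    thus ?thesis by (simp add: Aodd)
  qed
  define c1 where "c1 = A 1 - T 1"
  define c2 where "c2 = A (-1) - T (-1)"
  have c1: "A y = c1 + T y" if "y > 0" for y
    using key[of "{0<..}" y 1] that contA by (simp add: c1_def)
  have c2: "A y = c2 + T y" if "y < 0" for y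
    using key[of "{..<0}" y "-1"] that contA' by (simp add: c2_def)
  define \<sigma> where "\<sigma> = (\<Sum>z\<in>#M. sgn (Re z) * (pi / 2))"
  have "(A \<longlongrightarrow> c1 + \<sigma>) at_top"
  proof (rule Lim_transform_eventually)
    show "((\<lambda>y. c1 + T y) \<longlongrightarrow> c1 + \<sigma>) at_top"
      unfolding \<sigma>_def T_def by (intro tendsto_intros sum_arctan_at_top M)
    show "\<forall>\<^sub>F y in at_top. c1 + T y = A y" using eventually_gt_at_top[of 0]
      by eventually_elim (simp add: c1)
  qed
  hence e1: "\<alpha> = c1 + \<sigma>" using lt tendsto_unique[OF _ lt[folded A_def]] by simp
  have Tc: "isCont T 0" using contT[of UNIV] by (simp add: continuous_on_eq_continuous_at)
  have "(A \<longlongrightarrow> c1 + T 0) (at_right 0)"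
  proof (rule Lim_transform_eventually)
    show "((\<lambda>y. c1 + T y) \<longlongrightarrow> c1 + T 0) (at_right 0)"
      using Tc by (intro tendsto_intros) (auto simp: isCont_def filterlim_at_split)
    show "\<forall>\<^sub>F y in at_right 0. c1 + T y = A y"
      by (auto simp: eventually_at_filter c1)
  qed
  hence e2: "\<beta> = c1 + T 0" using tendsto_unique[OF _ l0[folded A_def]] by simp
  have "((\<lambda>y. A (- y)) \<longlongrightarrow> c2 + - \<sigma>) at_top"
  proof (rule Lim_transform_eventually)
    show "((\<lambda>y. c2 + T (- y)) \<longlongrightarrow> c2 + - \<sigma>) at_top"
      unfolding \<sigma>_def T_def
      by (intro tendsto_intros filterlim_compose[OF sum_arctan_at_bot[OF M]] filterlim_uminus_at_bot_at_top)
    show "\<forall>\<^sub>F y in at_top. c2 + T (- y) = A (- y)" using eventually_gt_at_top[of 0]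
      by eventually_elim (simp add: c2)
  qed
  moreover have "((\<lambda>y. A (- y)) \<longlongrightarrow> - \<alpha>) at_top"
    using tendsto_minus[OF lt] by (simp only: Aodd) (simp only: A_def)
  ultimately have e3: "c2 + - \<sigma> = - \<alpha>" by (rule tendsto_unique[rotated]) simp
  have "((\<lambda>y. A (- y)) \<longlongrightarrow> c2 + T 0) (at_right 0)"
  proof (rule Lim_transform_eventually)
    have "((\<lambda>y. T (- y)) \<longlongrightarrow> T (- 0)) (at_right 0)"
      using contT[of UNIV] by (intro isCont_tendsto_compose[of _ T] tendsto_intros)
        (auto simp: continuous_on_eq_continuous_at)
    thus "((\<lambda>y. c2 + T (- y)) \<longlongrightarrow> c2 + T 0) (at_right 0)"
      by (intro tendsto_intros) auto
    show "\<forall>\<^sub>F y in at_right 0. c2 + T (- y) = A (- y)"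
      by (auto simp: eventually_at_filter c2)
  qed
  moreover have "((\<lambda>y. A (- y)) \<longlongrightarrow> - \<beta>) (at_right 0)"
    using tendsto_minus[OF l0] by (simp only: Aodd) (simp only: A_def)
  ultimately have e4: "c2 + T 0 = - \<beta>" by (rule tendsto_unique[rotated]) simp
  have "\<sigma> = (\<Sum>z\<in>#M. sgn (Re z)) * (pi / 2)"
    unfolding \<sigma>_def by (simp add: sum_mset_distrib_right)
  thus ?thesis using e1 e2 e3 e4 by (simp add: M_def)
qed

subsection \<open>Conformal automorphisms of the first quadrant\<close>

text \<open>The Cayley transform \<open>C\<close> carries the problem to the disc, after an affine
  change that moves \<open>G \<i>\<close> to \<open>\<i>\<close>. The Schwarz lemma for the map and
  for its left inverse forces equality of moduli at \<open>1/2\<close>, hence a rotation by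
  \<open>\<alpha>\<close>.\<close>

lemma upper_half_plane_automorphism:
  assumes hol: "G holomorphic_on {s. 0 < Im s}" "G' holomorphic_on {s. 0 < Im s}"
    and maps: "\<And>s. 0 < Im s \<Longrightarrow> 0 < Im (G s)" "\<And>s. 0 < Im s \<Longrightarrow> 0 < Im (G' s)"
    and inv: "\<And>s. 0 < Im s \<Longrightarrow> G' (G s) = s"
  shows "\<exists>(p::real) (q::real) (c::real) (d::real). q > (0::real) \<and> c\<^sup>2 + d\<^sup>2 = (1::real) \<and>
    (\<forall>s::complex. 0 < Im s \<longrightarrow> G s = of_real p + of_real q * ((of_real c * s + of_real d) / (of_real c - of_real d * s)))"
proof -
  define p where "p = Re (G \<i>)"
  define q where "q = Im (G \<i>)"
  have q: "q > 0" using maps(1)[of \<i>] by (simp add: q_def)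
  have Gi: "G \<i> = p + q * \<i>" by (simp add: complex_eq_iff p_def q_def)
  define C where "C = (\<lambda>s::complex. (s - \<i>) / (s + \<i>))"
  define D where "D = (\<lambda>w::complex. \<i> * (1 + w) / (1 - w))"
  have nz1: "s + \<i> \<noteq> 0" if "0 < Im s" for s using that by (auto simp: complex_eq_iff)
  have nz2: "1 - w \<noteq> 0" if "norm w < 1" for w :: complex using that by auto
  have Cball: "norm (C s) < 1" if s: "0 < Im s" for s
  proof -
    have "(norm (s - \<i>))\<^sup>2 < (norm (s + \<i>))\<^sup>2"
      unfolding cmod_power2 using s by (simp add: power2_eq_square algebra_simps)
    hence "norm (s - \<i>) < norm (s + \<i>)" by (rule power2_less_imp_less) simp
    thus ?thesis using nz1[OF s] by (simp add: C_def norm_divide)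
  qed
  have Dpos: "0 < Im (D w)" if w: "norm w < 1" for w
  proof -
    have "Im (D w) = (1 - (norm w)\<^sup>2) / (norm (1 - w))\<^sup>2"
      using nz2[OF w]
      by (simp add: D_def Im_divide cmod_power2) (simp add: field_simps power2_eq_square)
    moreover have "(norm w)\<^sup>2 < 1" using w by (simp add: power_less_one_iff)
    ultimately show ?thesis using nz2[OF w] by simp
  qed
  have DC: "D (C s) = s" if s: "0 < Im s" for s
  proof -
    have "1 - C s = 2 * \<i> / (s + \<i>)" "1 + C s = 2 * s / (s + \<i>)"
      using nz1[OF s] by (simp_all add: C_def field_simps)
    thus ?thesis using nz1[OF s] by (simp add: D_def)
  qed
  have CD: "C (D w) = w" if w: "norm w < 1" for w
  proof -
    have "D w - \<i> = \<i> * (2 * w) / (1 - w)" "D w + \<i> = \<i> * 2 / (1 - w)"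
      using nz2[OF w] by (simp_all add: D_def field_simps)
    thus ?thesis using nz2[OF w] by (simp add: C_def)
  qed
  define f where "f = (\<lambda>w. C ((G (D w) - p) / q))"
  define f' where "f' = (\<lambda>w. C (G' (p + q * D w)))"
  have pos1: "0 < Im ((G s - of_real p) / of_real q)" if "0 < Im s" for s
    using maps(1)[OF that] q by simp
  have pos2: "0 < Im (of_real p + of_real q * D w)" if "norm w < 1" for w
    using Dpos[OF that] q by simp
  have Dhol: "D holomorphic_on ball 0 1"
    unfolding D_def using nz2 by (auto intro!: holomorphic_intros)
  have Chol: "C holomorphic_on {s. 0 < Im s}"
    unfolding C_def using nz1 by (auto intro!: holomorphic_intros)
  have "D ` ball 0 1 \<subseteq> {s. 0 < Im s}" using Dpos by (auto simp: image_subset_iff)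
  hence "(\<lambda>w. G (D w)) holomorphic_on ball 0 1"
    using holomorphic_on_compose_gen[OF Dhol hol(1)] by (simp add: o_def)
  hence "(\<lambda>w. (G (D w) - p) / q) holomorphic_on ball 0 1" using q by (auto intro!: holomorphic_intros)
  hence fhol: "f holomorphic_on ball 0 1"
    using holomorphic_on_compose_gen[OF _ Chol, of "\<lambda>w. (G (D w) - p) / q" "ball 0 1"] pos1[OF Dpos]
    by (simp only: o_def f_def) (simp add: image_subset_iff)
  have "(\<lambda>w. p + q * D w) holomorphic_on ball 0 1" using Dhol by (auto intro!: holomorphic_intros)
  hence "(\<lambda>w. G' (p + q * D w)) holomorphic_on ball 0 1"
    using holomorphic_on_compose_gen[OF _ hol(2), of "\<lambda>w. p + q * D w" "ball 0 1"] pos2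
    by (simp only: o_def) (simp add: image_subset_iff)
  hence f'hol: "f' holomorphic_on ball 0 1"
    using holomorphic_on_compose_gen[OF _ Chol, of "\<lambda>w. G' (p + q * D w)" "ball 0 1"] maps(2)[OF pos2]
    by (simp only: o_def f'_def) (simp add: image_subset_iff)
  have fball: "norm (f w) < 1" if "norm w < 1" for w
    unfolding f_def using Cball pos1 Dpos that by blast
  have f'ball: "norm (f' w) < 1" if "norm w < 1" for w
    unfolding f'_def using Cball maps(2) pos2 that by blast
  have ff: "f' (f w) = w" if w: "norm w < 1" for w
  proof -
    have "D (f w) = (G (D w) - p) / q" unfolding f_def using DC pos1 Dpos w by blast
    hence "p + q * D (f w) = G (D w)" using q by simp
    thus ?thesis using inv[OF Dpos[OF w]] CD[OF w] by (simp add: f'_def)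
  qed
  have D0: "D 0 = \<i>" by (simp add: D_def)
  have Ci: "C \<i> = 0" by (simp add: C_def)
  have f0: "f 0 = 0" using Gi q Ci by (simp add: f_def D0)
  have f'0: "f' 0 = 0" using ff[of 0] f0 by simp
  have "norm (f (1/2)) \<le> norm (1/2 :: complex)"
    by (rule Schwarz_Lemma(1)[OF fhol f0 fball]) auto
  moreover have "norm (f' (f (1/2))) \<le> norm (f (1/2))"
    by (rule Schwarz_Lemma(1)[OF f'hol f'0 f'ball]) (auto intro: fball)
  ultimately have "norm (f (1/2)) = norm (1/2 :: complex)" using ff[of "1/2"] by simp
  hence "\<exists>z. norm z < 1 \<and> z \<noteq> 0 \<and> norm (f z) = norm z" by (intro exI[of _ "1/2"]) auto
  then obtain \<alpha> where \<alpha>: "\<And>z. norm z < 1 \<Longrightarrow> f z = \<alpha> * z" "norm \<alpha> = 1"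
    using Schwarz_Lemma(3)[OF fhol f0 fball, of 0] by auto
  \<comment> \<open>Half the angle of \<open>\<alpha>\<close>: a rotation of the disc by
    \<open>2 * \<theta>\<close> corresponds to the real Moebius map with matrix
    \<open>(c, d; - d, c)\<close>, \<open>c = cos \<theta>\<close>,
    \<open>d = sin \<theta>\<close>.\<close>
  define \<theta> where "\<theta> = Arg \<alpha> / 2"
  have \<alpha>cis: "\<alpha> = cis \<theta> * cis \<theta>"
    using rcis_cmod_Arg[of \<alpha>] \<alpha>(2) by (simp add: rcis_def \<theta>_def cis_mult)
  define c where "c = cos \<theta>"
  define d where "d = sin \<theta>"
  have cd: "c\<^sup>2 + d\<^sup>2 = 1" by (simp add: c_def d_def)
  have "G s = of_real p + of_real q * ((of_real c * s + of_real d) / (of_real c - of_real d * s))" if s: "0 < Im s" for s :: complex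
  proof -
    have den: "c - d * s \<noteq> 0"
    proof
      assume 0: "c - d * s = 0"
      hence "Im (c - d * s) = 0" by simp
      hence "d = 0" using s by simp
      thus False using 0 cd by simp
    qed
    have w: "norm (C s) < 1" by (rule Cball[OF s])
    have "f (C s) = C ((G s - p) / q)" by (simp add: f_def DC[OF s])
    hence "C ((G s - p) / q) = \<alpha> * C s" using \<alpha>(1)[OF w] by simp
    hence "(G s - p) / q = D (\<alpha> * C s)" using DC[OF pos1[OF s]] by metis
    also have "D (\<alpha> * C s) = (c * s + d) / (c - d * s)"
    proof -
      have k: "cis \<theta> = c + \<i> * d" by (simp add: complex_eq_iff c_def d_def)
      define e where "e = cis \<theta>"
      have k2: "e * (c - \<i> * d) = 1"
        using cd by (simp add: e_def k complex_eq_iff power2_eq_square algebra_simps)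
      have \<alpha>e: "\<alpha> = e * e" by (simp add: e_def \<alpha>cis)
      have ke: "c + \<i> * d = e" by (simp add: e_def k)
      have e0: "e \<noteq> 0" by (simp add: e_def)
      have n: "1 + \<alpha> * C s = ((s + \<i>) + \<alpha> * (s - \<i>)) / (s + \<i>)"
           "1 - \<alpha> * C s = ((s + \<i>) - \<alpha> * (s - \<i>)) / (s + \<i>)"
        using nz1[OF s] by (simp_all add: C_def field_simps)
      have n1: "(s + \<i>) + \<alpha> * (s - \<i>) = 2 * e * (c * s + d)"
      proof -
        have "(s + \<i>) + \<alpha> * (s - \<i>) = (e * (c - \<i> * d)) * (s + \<i>) + \<alpha> * (s - \<i>)"
          by (simp only: k2 mult_1_left)
        also have "\<dots> = e * ((c - \<i> * d) * (s + \<i>) + e * (s - \<i>))"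
          unfolding \<alpha>e by (simp only: algebra_simps)
        also have "\<dots> = e * ((c - \<i> * d) * (s + \<i>) + (c + \<i> * d) * (s - \<i>))"
          by (simp only: ke)
        finally show ?thesis by (simp add: algebra_simps)
      qed
      have n2: "(s + \<i>) - \<alpha> * (s - \<i>) = 2 * \<i> * e * (c - d * s)"
      proof -
        have "(s + \<i>) - \<alpha> * (s - \<i>) = (e * (c - \<i> * d)) * (s + \<i>) - \<alpha> * (s - \<i>)"
          by (simp only: k2 mult_1_left)
        also have "\<dots> = e * ((c - \<i> * d) * (s + \<i>) - e * (s - \<i>))"
          unfolding \<alpha>e by (simp only: algebra_simps)
        also have "\<dots> = e * ((c - \<i> * d) * (s + \<i>) - (c + \<i> * d) * (s - \<i>))"
          by (simp only: ke)
        finally show ?thesis by (simp add: algebra_simps)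
      qed
      show ?thesis unfolding D_def n n1 n2 using nz1[OF s] e0 den by simp
    qed
    finally show ?thesis using q by (simp add: field_simps)
  qed
  thus ?thesis using q cd by blast
qed

lemma open_first_quadrant: "open first_quadrant"
  unfolding first_quadrant_def
  by (auto intro!: open_Collect_conj open_Collect_less continuous_intros)

lemma quadrant_approach:
  assumes "0 \<le> Re z" "0 \<le> Im z"
  shows "(\<lambda>n. z + (1 + \<i>) / of_nat (Suc n)) \<longlonglongrightarrow> z" "z + (1 + \<i>) / of_nat (Suc n) \<in> first_quadrant"
proof -
  have "(\<lambda>n. z + (1 + \<i>) * (1 / of_nat (Suc n))) \<longlonglongrightarrow> z + (1 + \<i>) * 0"
    by (intro tendsto_intros LIMSEQ_Suc lim_1_over_n)
  thus "(\<lambda>n. z + (1 + \<i>) / of_nat (Suc n)) \<longlonglongrightarrow> z" by simp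
  have "(1 + \<i>) / of_nat (Suc n) = Complex (1 / real (Suc n)) (1 / real (Suc n))"
    by (simp add: complex_eq_iff Re_divide_of_nat Im_divide_of_nat)
  moreover have "1 / real (Suc n) > 0" by simp
  ultimately show "z + (1 + \<i>) / of_nat (Suc n) \<in> first_quadrant"
    using assms by (simp add: first_quadrant_def add_nonneg_pos)
qed

lemma closure_first_quadrant: "closure first_quadrant = {z. 0 \<le> Re z \<and> 0 \<le> Im z}"
proof
  show "closure first_quadrant \<subseteq> {z. 0 \<le> Re z \<and> 0 \<le> Im z}"
    by (intro closure_minimal closed_Collect_conj closed_Collect_le continuous_intros)
       (auto simp: first_quadrant_def)
  show "{z. 0 \<le> Re z \<and> 0 \<le> Im z} \<subseteq> closure first_quadrant"
  proof
    fix z :: complex assume "z \<in> {z. 0 \<le> Re z \<and> 0 \<le> Im z}"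
    hence "0 \<le> Re z" "0 \<le> Im z" by auto
    from quadrant_approach[OF this] show "z \<in> closure first_quadrant"
      unfolding closure_sequential by (intro exI[of _ "\<lambda>n. z + (1 + \<i>) / of_nat (Suc n)"]) auto
  qed
qed

lemma first_quadrant_subset: "first_quadrant \<subseteq> closure first_quadrant - {0}"
  by (simp only: closure_first_quadrant) (auto simp: first_quadrant_def)

lemma is_quadrant_map_limits:
  assumes "is_quadrant_map k m B \<phi>"
  shows "filterlim (\<lambda>z. Im (\<phi> z)) at_top (at 0 within closure first_quadrant)"
    "eventually (\<lambda>z. Re (\<phi> z) < pi * real k) (at 0 within closure first_quadrant)"
    "filterlim (\<lambda>z. Im (\<phi> z)) at_top (inf at_infinity (principal (closure first_quadrant)))"
    "eventually (\<lambda>z. Re (\<phi> z) > pi * real k) (inf at_infinity (principal (closure first_quadrant)))"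
  using assms
  by (auto simp: is_quadrant_map_def infty_left_def infty_right_def filterlim_inf
      filterlim_filtercomap_iff filterlim_principal o_def)

text \<open>Squaring turns the quadrant into the upper half-plane, where the inverse of
  \<open>\<phi>1\<close> after \<open>\<phi>2\<close> becomes a Moebius map \<open>G\<close>. The
  prescribed behaviour at 0 and at infinity makes \<open>G\<close> fix both points, so
  \<open>G s = q * s\<close>. The factor is pinned down in \<open>quadrant_map_eq\<close> by the
  value at 1.\<close>

lemma quadrant_maps_eq_up_to_scaling:
  assumes \<phi>1: "is_quadrant_map k m B \<phi>1" and \<phi>2: "is_quadrant_map k m B \<phi>2"
  shows "\<exists>l::real. l > 0 \<and> (\<forall>z\<in>closure first_quadrant - {0}. \<phi>2 z = \<phi>1 (of_real l * z))"
proof -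
  note o = open_first_quadrant
  have b1: "inj_on \<phi>1 first_quadrant" "\<phi>1 ` first_quadrant = Omega k m B" "\<phi>1 holomorphic_on first_quadrant"
    and b2: "inj_on \<phi>2 first_quadrant" "\<phi>2 ` first_quadrant = Omega k m B" "\<phi>2 holomorphic_on first_quadrant"
    using \<phi>1 \<phi>2 by (auto simp: is_quadrant_map_def bij_betw_def)
  obtain g1 where g1: "g1 holomorphic_on Omega k m B" "\<And>z. z \<in> first_quadrant \<Longrightarrow> g1 (\<phi>1 z) = z"
    using holomorphic_has_inverse[OF b1(3) o b1(1)] b1(2) by metis
  obtain g2 where g2: "g2 holomorphic_on Omega k m B" "\<And>z. z \<in> first_quadrant \<Longrightarrow> g2 (\<phi>2 z) = z"
    using holomorphic_has_inverse[OF b2(3) o b2(1)] b2(2) by metis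
  have g1Q: "g1 w \<in> first_quadrant \<and> \<phi>1 (g1 w) = w" if w: "w \<in> Omega k m B" for w
    using g1(2) w by (auto simp flip: b1(2))
  have g2Q: "g2 w \<in> first_quadrant \<and> \<phi>2 (g2 w) = w" if w: "w \<in> Omega k m B" for w
    using g2(2) w by (auto simp flip: b2(2))
  have sqH: "0 < Im (z\<^sup>2)" if "z \<in> first_quadrant" for z
    using that by (simp add: first_quadrant_def power2_eq_square)
  have rootQ: "csqrt s \<in> first_quadrant" if s: "0 < Im s" for s
  proof -
    define w where "w = csqrt s"
    have "2 * (Re w * Im w) = Im (w\<^sup>2)" by (simp add: power2_eq_square)
    hence "0 < Re w * Im w" using s by (simp add: w_def)
    moreover have "0 \<le> Re w" unfolding w_def by (rule Re_csqrt)
    ultimately show ?thesis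
      by (fold w_def) (auto simp: first_quadrant_def zero_less_mult_iff)
  qed
  have rootsq: "csqrt (z\<^sup>2) = z" if "z \<in> first_quadrant" for z
    using that by (intro csqrt_square) (auto simp: first_quadrant_def)
  define G where "G = (\<lambda>s. (g1 (\<phi>2 (csqrt s)))\<^sup>2)"
  define G' where "G' = (\<lambda>s. (g2 (\<phi>1 (csqrt s)))\<^sup>2)"
  have csH: "csqrt holomorphic_on {s. 0 < Im s}"
    by (intro holomorphic_on_subset[OF holomorphic_on_csqrt]) (auto simp: complex_nonpos_Reals_iff)
  have sub: "csqrt ` {s. 0 < Im s} \<subseteq> first_quadrant" using rootQ by auto
  have hG: "G holomorphic_on {s. 0 < Im s}"
  proof -
    have "(\<phi>2 \<circ> csqrt) holomorphic_on {s. 0 < Im s}"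
      by (rule holomorphic_on_compose_gen[OF csH b2(3) sub])
    moreover have "(\<phi>2 \<circ> csqrt) ` {s. 0 < Im s} \<subseteq> Omega k m B"
      using sub b2(2) by (auto simp: image_subset_iff)
    ultimately have "(g1 \<circ> (\<phi>2 \<circ> csqrt)) holomorphic_on {s. 0 < Im s}"
      by (rule holomorphic_on_compose_gen[OF _ g1(1)])
    thus ?thesis unfolding G_def o_def by (intro holomorphic_intros)
  qed
  have hG': "G' holomorphic_on {s. 0 < Im s}"
  proof -
    have "(\<phi>1 \<circ> csqrt) holomorphic_on {s. 0 < Im s}"
      by (rule holomorphic_on_compose_gen[OF csH b1(3) sub])
    moreover have "(\<phi>1 \<circ> csqrt) ` {s. 0 < Im s} \<subseteq> Omega k m B"
      using sub b1(2) by (auto simp: image_subset_iff)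
    ultimately have "(g2 \<circ> (\<phi>1 \<circ> csqrt)) holomorphic_on {s. 0 < Im s}"
      by (rule holomorphic_on_compose_gen[OF _ g2(1)])
    thus ?thesis unfolding G'_def o_def by (intro holomorphic_intros)
  qed
  define \<psi> where "\<psi> = (\<lambda>z. g1 (\<phi>2 z))"
  have \<psi>: "\<psi> z \<in> first_quadrant" "\<phi>1 (\<psi> z) = \<phi>2 z" "(\<psi> z)\<^sup>2 = G (z\<^sup>2)" if z: "z \<in> first_quadrant" for z
    using g1Q[of "\<phi>2 z"] z b2(2) rootsq[OF z] by (auto simp: \<psi>_def G_def)
  have GH: "0 < Im (G s)" if "0 < Im s" for s
    using \<psi>[OF rootQ[OF that]] sqH[OF \<psi>(1)[OF rootQ[OF that]]] by simp
  have GH': "0 < Im (G' s)" if "0 < Im s" for s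
    using g2Q[of "\<phi>1 (csqrt s)"] rootQ[OF that] b1(2) sqH by (auto simp: G'_def)
  have GG: "G' (G s) = s" if "0 < Im s" for s
  proof -
    have m: "\<phi>2 (csqrt s) \<in> Omega k m B" using rootQ[OF that] b2(2) by auto
    have "csqrt (G s) = g1 (\<phi>2 (csqrt s))"
      unfolding G_def using g1Q[OF m] by (intro rootsq) auto
    thus ?thesis using g1Q[OF m] g2(2)[OF rootQ[OF that]] by (simp add: G'_def)
  qed
  obtain p q c d :: real where q: "q > 0" and cd: "c\<^sup>2 + d\<^sup>2 = (1::real)"
    and G: "\<And>s::complex. 0 < Im s \<Longrightarrow> G s = of_real p + of_real q * ((of_real c * s + of_real d) / (of_real c - of_real d * s))"
    using upper_half_plane_automorphism[OF hG hG' GH GH' GG] by blast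
  note L1 = is_quadrant_map_limits[OF \<phi>1] and L2 = is_quadrant_map_limits[OF \<phi>2]
  \<comment> \<open>\<open>\<phi>1\<close> is bounded on the part of the quadrant between two
    positive radii, so points whose images run off to infinity cannot have moduli tending to a
    positive limit.\<close>
  have no_finite: False
    if w: "\<And>n. w n \<in> first_quadrant" and lim: "(\<lambda>n. norm (w n)) \<longlonglongrightarrow> r" "r > 0"
      and Im: "filterlim (\<lambda>n. Im (\<phi>1 (w n))) at_top sequentially" for w r
  proof -
    define K where "K = closure first_quadrant \<inter> {z. r / 2 \<le> norm z} \<inter> cball 0 (2 * r)"
    have "compact K" unfolding K_def
      by (intro closed_Int_compact closed_Int closed_closure closed_Collect_le continuous_intros) auto
    moreover have "continuous_on K \<phi>1"
      using \<phi>1 lim(2) unfolding is_quadrant_map_def K_def by (auto elim!: continuous_on_subset)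
    ultimately have "bounded (\<phi>1 ` K)" by (intro compact_imp_bounded compact_continuous_image)
    then obtain M where M: "\<And>z. z \<in> K \<Longrightarrow> norm (\<phi>1 z) \<le> M" by (auto simp: bounded_iff)
    have "eventually (\<lambda>n. r / 2 < norm (w n)) sequentially" "eventually (\<lambda>n. norm (w n) < 2 * r) sequentially"
      using lim(2) by (intro order_tendstoD[OF lim(1)]; simp)+
    moreover have "eventually (\<lambda>n. M < Im (\<phi>1 (w n))) sequentially"
      using Im by (auto simp: filterlim_at_top_dense)
    ultimately have "eventually (\<lambda>n. False) sequentially"
    proof eventually_elim
      case (elim n)
      hence "w n \<in> K" using w[of n] closure_subset by (auto simp: K_def)
      thus False using M[of "w n"] abs_Im_le_cmod[of "\<phi>1 (w n)"] elim by linarith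
    qed
    thus False by simp
  qed
  have at0: "eventually (\<lambda>n. Re (\<phi>1 (w n)) < pi * real k) sequentially"
    if w: "\<And>n. w n \<in> first_quadrant" and lim: "(\<lambda>n. norm (w n)) \<longlonglongrightarrow> 0" for w
  proof -
    have "w \<longlonglongrightarrow> 0" using lim by (simp add: tendsto_norm_zero_iff)
    moreover have "w n \<noteq> 0" "w n \<in> closure first_quadrant" for n
      using w[of n] first_quadrant_subset by auto
    ultimately have "filterlim w (at 0 within closure first_quadrant) sequentially"
      by (auto simp: filterlim_at)
    thus ?thesis using L1(2) by (auto simp: filterlim_iff)
  qed
  have atinf: "filterlim w (inf at_infinity (principal (closure first_quadrant))) sequentially"
    if w: "\<And>n. w n \<in> first_quadrant" and lim: "filterlim (\<lambda>n. norm (w n)) at_top sequentially" for w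
    using filterlim_at_infinity_conv_norm_at_top[of w sequentially] lim w closure_subset
    by (auto simp: filterlim_inf filterlim_principal intro!: always_eventually)
  have norm\<psi>: "norm (\<psi> z) = sqrt (norm (G (z\<^sup>2)))" if "z \<in> first_quadrant" for z
    using \<psi>(3)[OF that] by (metis norm_ge_zero norm_power real_sqrt_unique)
  define z0 where "z0 = (\<lambda>n. (1 + \<i>) / of_nat (Suc n))"
  define z1 where "z1 = (\<lambda>n. (1 + \<i>) * of_nat (Suc n))"
  have z0Q: "z0 n \<in> first_quadrant" for n using quadrant_approach(2)[of 0 n] by (simp add: z0_def)
  have z0lim: "z0 \<longlonglongrightarrow> 0" using quadrant_approach(1)[of 0] by (simp add: z0_def[abs_def])
  have z1Q: "z1 n \<in> first_quadrant" for n by (simp add: z1_def first_quadrant_def)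
  have z1n: "norm (z1 n) = norm (1 + \<i>) * real (Suc n)" for n
    unfolding z1_def by (simp only: norm_mult norm_of_nat)
  have z1lim: "filterlim (\<lambda>n. norm (z1 n)) at_top sequentially"
  proof -
    have "norm (1 + \<i>) > 0" by (simp add: complex_eq_iff)
    moreover have "filterlim (\<lambda>n. real (Suc n)) at_top sequentially"
      using filterlim_Suc filterlim_real_sequentially filterlim_compose by blast
    ultimately show ?thesis
      unfolding z1n by (intro filterlim_tendsto_pos_mult_at_top[OF tendsto_const])
  qed
  have z0f: "filterlim z0 (at 0 within closure first_quadrant) sequentially"
    using z0lim subsetD[OF first_quadrant_subset z0Q] by (auto simp: filterlim_at)
  have Im0: "filterlim (\<lambda>n. Im (\<phi>1 (\<psi> (z0 n)))) at_top sequentially"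
    using filterlim_compose[OF L2(1) z0f] \<psi>(2)[OF z0Q] by simp
  have Im1: "filterlim (\<lambda>n. Im (\<phi>1 (\<psi> (z1 n)))) at_top sequentially"
    using filterlim_compose[OF L2(3) atinf[OF z1Q z1lim]] \<psi>(2)[OF z1Q] by simp
  have Re0: "eventually (\<lambda>n. Re (\<phi>1 (\<psi> (z0 n))) < pi * real k) sequentially"
    using L2(2) z0f \<psi>(2)[OF z0Q] by (auto simp: filterlim_iff)
  have Re1: "eventually (\<lambda>n. Re (\<phi>1 (\<psi> (z1 n))) > pi * real k) sequentially"
    using L2(4) atinf[OF z1Q z1lim] \<psi>(2)[OF z1Q] by (auto simp: filterlim_iff)
  \<comment> \<open>\<open>c = 0\<close> would make \<open>G\<close> send 0 to infinity, but the two
    points belong to different channels.\<close>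
  have "c \<noteq> 0"
  proof
    assume c0: "c = 0"
    hence d0: "d \<noteq> 0" using cd by auto
    have "G ((z0 n)\<^sup>2) = p - q / (z0 n)\<^sup>2" for n
      using G[OF sqH[OF z0Q[of n]]] c0 d0 by simp
    moreover have "filterlim (\<lambda>n. p - q / (z0 n)\<^sup>2) at_infinity sequentially"
    proof -
      have "filterlim (\<lambda>n. (z0 n)\<^sup>2) (at 0) sequentially"
        using tendsto_power[OF z0lim, of 2] subsetD[OF first_quadrant_subset z0Q] by (auto simp: filterlim_at)
      hence "filterlim (\<lambda>n. inverse ((z0 n)\<^sup>2)) at_infinity sequentially"
        using filterlim_compose[OF filterlim_inverse_at_infinity] by blast
      hence "filterlim (\<lambda>n. of_real (- q) * inverse ((z0 n)\<^sup>2)) at_infinity sequentially"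
        using q by (intro tendsto_mult_filterlim_at_infinity[OF tendsto_const]) auto
      hence "filterlim (\<lambda>n. of_real p + of_real (- q) * inverse ((z0 n)\<^sup>2)) at_infinity sequentially"
        by (intro tendsto_add_filterlim_at_infinity[OF tendsto_const])
      thus ?thesis by (simp add: divide_inverse)
    qed
    ultimately have "filterlim (\<lambda>n. norm (G ((z0 n)\<^sup>2))) at_top sequentially"
      by (simp add: filterlim_at_infinity_conv_norm_at_top)
    hence "filterlim (\<lambda>n. norm (\<psi> (z0 n))) at_top sequentially"
      unfolding norm\<psi>[OF z0Q] by (rule filterlim_compose[OF sqrt_at_top])
    hence "filterlim (\<lambda>n. \<psi> (z0 n)) (inf at_infinity (principal (closure first_quadrant))) sequentially"
      by (intro atinf \<psi>(1)[OF z0Q])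
    hence "eventually (\<lambda>n. Re (\<phi>1 (\<psi> (z0 n))) > pi * real k) sequentially"
      using L1(4) by (auto simp: filterlim_iff)
    with Re0 have "eventually (\<lambda>n. False) sequentially" by eventually_elim linarith
    thus False by simp
  qed
  \<comment> \<open>The image of 0 under \<open>G\<close> is now the finite number
    \<open>p + q * (d / c)\<close>; by \<open>no_finite\<close> it has to be 0.\<close>
  have e1: "p + q * (d / c) = 0"
  proof (rule ccontr)
    assume nz: "p + q * (d / c) \<noteq> 0"
    have "(\<lambda>n. p + q * ((c * (z0 n)\<^sup>2 + d) / (c - d * (z0 n)\<^sup>2))) \<longlonglongrightarrow> of_real p + of_real q * ((of_real c * 0\<^sup>2 + of_real d) / (of_real c - of_real d * 0\<^sup>2))"
      using \<open>c \<noteq> 0\<close> by (intro tendsto_intros z0lim) auto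
    hence "(\<lambda>n. G ((z0 n)\<^sup>2)) \<longlonglongrightarrow> of_real (p + q * (d / c))"
      using G[OF sqH[OF z0Q]] by simp
    hence "(\<lambda>n. sqrt (norm (G ((z0 n)\<^sup>2)))) \<longlonglongrightarrow> sqrt (norm (of_real (p + q * (d / c)) :: complex))"
      by (intro tendsto_intros)
    hence "(\<lambda>n. norm (\<psi> (z0 n))) \<longlonglongrightarrow> sqrt (norm (of_real (p + q * (d / c)) :: complex))"
      by (simp only: norm\<psi>[OF z0Q])
    moreover have "sqrt (norm (of_real (p + q * (d / c)) :: complex)) > 0" using nz by (simp only: norm_of_real) simp
    ultimately show False using no_finite[OF \<psi>(1)[OF z0Q] _ _ Im0] by blast
  qed
  \<comment> \<open>Otherwise infinity goes to the finite number \<open>\<rho>\<close>: a nonzero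
    one is excluded by \<open>no_finite\<close>, and 0 belongs to the other channel.\<close>
  have "d = 0"
  proof (rule ccontr)
    assume d0: "d \<noteq> 0"
    define \<rho> where "\<rho> = p + q * (c / - d)"
    have i0: "(\<lambda>n. inverse ((z1 n)\<^sup>2)) \<longlonglongrightarrow> 0"
    proof -
      have "filterlim z1 at_infinity sequentially" using z1lim by (simp add: filterlim_at_infinity_conv_norm_at_top)
      hence "(\<lambda>n. inverse (z1 n)) \<longlonglongrightarrow> 0" using tendsto_inverse_0 filterlim_compose by blast
      from tendsto_power[OF this, of 2] show ?thesis by (simp add: power_inverse)
    qed
    have "(\<lambda>n. p + q * ((c + d * inverse ((z1 n)\<^sup>2)) / (c * inverse ((z1 n)\<^sup>2) - d))) \<longlonglongrightarrow> of_real p + of_real q * ((of_real c + of_real d * 0) / (of_real c * 0 - of_real d))"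
      using d0 by (intro tendsto_intros i0) auto
    moreover have "G ((z1 n)\<^sup>2) = p + q * ((c + d * inverse ((z1 n)\<^sup>2)) / (c * inverse ((z1 n)\<^sup>2) - d))" for n
    proof -
      have nz: "z1 n \<noteq> 0" using z1Q[of n] by (auto simp: first_quadrant_def)
      have "c * (z1 n)\<^sup>2 + d = (c + d * inverse ((z1 n)\<^sup>2)) * (z1 n)\<^sup>2"
           "c - d * (z1 n)\<^sup>2 = (c * inverse ((z1 n)\<^sup>2) - d) * (z1 n)\<^sup>2"
        using nz by (simp_all add: field_simps)
      thus ?thesis unfolding G[OF sqH[OF z1Q]] using nz by simp
    qed
    ultimately have "(\<lambda>n. G ((z1 n)\<^sup>2)) \<longlonglongrightarrow> of_real \<rho>" by (simp add: \<rho>_def)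
    hence "(\<lambda>n. sqrt (norm (G ((z1 n)\<^sup>2)))) \<longlonglongrightarrow> sqrt (norm (of_real \<rho> :: complex))"
      by (intro tendsto_intros)
    hence lim: "(\<lambda>n. norm (\<psi> (z1 n))) \<longlonglongrightarrow> sqrt (norm (of_real \<rho> :: complex))"
      by (simp only: norm\<psi>[OF z1Q])
    show False
    proof (cases "\<rho> = 0")
      case False
      hence "sqrt (norm (of_real \<rho> :: complex)) > 0" by simp
      thus False using no_finite[OF \<psi>(1)[OF z1Q] lim _ Im1] by blast
    next
      case True
      hence "eventually (\<lambda>n. Re (\<phi>1 (\<psi> (z1 n))) < pi * real k) sequentially"
        using at0[OF \<psi>(1)[OF z1Q]] lim by simp
      with Re1 have "eventually (\<lambda>n. False) sequentially" by eventually_elim linarith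
      thus False by simp
    qed
  qed
  hence "p = 0" using e1 by simp
  have \<psi>eq: "\<psi> z = of_real (sqrt q) * z" if z: "z \<in> first_quadrant" for z
  proof -
    have "(\<psi> z)\<^sup>2 = of_real q * z\<^sup>2"
      using \<psi>(3)[OF z] G[OF sqH[OF z]] \<open>d = 0\<close> \<open>p = 0\<close> \<open>c \<noteq> 0\<close> by simp
    also have "\<dots> = (of_real (sqrt q) * z)\<^sup>2" using q by (simp add: power_mult_distrib flip: of_real_power)
    finally have "csqrt ((\<psi> z)\<^sup>2) = csqrt ((of_real (sqrt q) * z)\<^sup>2)" by simp
    moreover have "of_real (sqrt q) * z \<in> first_quadrant" using z q by (simp add: first_quadrant_def)
    ultimately show ?thesis using rootsq \<psi>(1)[OF z] by simp
  qed
  have eqQ: "\<phi>2 z = \<phi>1 (of_real (sqrt q) * z)" if "z \<in> first_quadrant" for z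
    using \<psi>(2)[OF that] \<psi>eq[OF that] by simp
  have "\<phi>2 z = \<phi>1 (of_real (sqrt q) * z)" if z: "z \<in> closure first_quadrant - {0}" for z
  proof -
    have z': "0 \<le> Re z" "0 \<le> Im z" "z \<noteq> 0" using z by (auto simp: closure_first_quadrant)
    define w where "w = (\<lambda>n. z + (1 + \<i>) / of_nat (Suc n))"
    have w: "w \<longlonglongrightarrow> z" "\<And>n. w n \<in> first_quadrant"
      using quadrant_approach[OF z'(1,2)] by (auto simp: w_def)
    have c1: "continuous_on (closure first_quadrant - {0}) \<phi>1" and c2: "continuous_on (closure first_quadrant - {0}) \<phi>2"
      using \<phi>1 \<phi>2 by (auto simp: is_quadrant_map_def)
    have wC: "w n \<in> closure first_quadrant - {0}" for n
      using w(2)[of n] first_quadrant_subset by auto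
    have "(\<lambda>n. \<phi>2 (w n)) \<longlonglongrightarrow> \<phi>2 z"
      using continuous_on_tendsto_compose[OF c2 w(1) z] wC by auto
    moreover have "(\<lambda>n. \<phi>1 (of_real (sqrt q) * w n)) \<longlonglongrightarrow> \<phi>1 (of_real (sqrt q) * z)"
    proof (rule continuous_on_tendsto_compose[OF c1])
      show "(\<lambda>n. of_real (sqrt q) * w n) \<longlonglongrightarrow> of_real (sqrt q) * z" by (intro tendsto_intros w)
      show "of_real (sqrt q) * z \<in> closure first_quadrant - {0}" using z' q by (simp add: closure_first_quadrant)
      show "\<forall>\<^sub>F n in sequentially. of_real (sqrt q) * w n \<in> closure first_quadrant - {0}"
        using wC q by (auto simp: closure_first_quadrant)
    qed
    ultimately show ?thesis using eqQ[OF w(2)] LIMSEQ_unique by simp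
  qed
  thus ?thesis using q by (intro exI[of _ "sqrt q"]) auto
qed

subsection \<open>Analytic functions on a strip\<close>

text \<open>The image of the punctured closed quadrant under \<open>Ln\<close>; the edges
  \<open>Im \<zeta> = 0\<close> and \<open>Im \<zeta> = pi / 2\<close> correspond to the positive
  real and the positive imaginary axis.\<close>

definition closed_strip :: "complex set" where
  "closed_strip = {\<zeta>. 0 \<le> Im \<zeta> \<and> Im \<zeta> \<le> pi / 2}"

definition open_strip :: "complex set" where
  "open_strip = {\<zeta>. 0 < Im \<zeta> \<and> Im \<zeta> < pi / 2}"

text \<open>\<open>s = -1\<close> is the end that \<open>exp\<close> carries to 0,
  \<open>s = 1\<close> the one carried to infinity.\<close>

definition strip_end :: "real \<Rightarrow> complex filter" where
  "strip_end s = inf (filtercomap (\<lambda>\<zeta>. s * Re \<zeta>) at_top) (principal closed_strip)"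

lemma eventually_strip_end:
  "eventually P (strip_end s) \<longleftrightarrow> (\<exists>r. \<forall>\<zeta>\<in>closed_strip. r < s * Re \<zeta> \<longrightarrow> P \<zeta>)"
  unfolding strip_end_def eventually_inf_principal eventually_filtercomap_at_top_dense by blast

lemma convex_strips: "convex closed_strip" "convex open_strip"
proof -
  have 1: "closed_strip = {\<zeta>. \<i> \<bullet> \<zeta> \<ge> 0} \<inter> {\<zeta>. \<i> \<bullet> \<zeta> \<le> pi / 2}"
    and 2: "open_strip = {\<zeta>. \<i> \<bullet> \<zeta> > 0} \<inter> {\<zeta>. \<i> \<bullet> \<zeta> < pi / 2}"
    by (auto simp: closed_strip_def open_strip_def inner_complex_def)
  show "convex closed_strip" unfolding 1
    by (intro convex_Int convex_halfspace_ge convex_halfspace_le)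
  show "convex open_strip" unfolding 2
    by (intro convex_Int convex_halfspace_gt convex_halfspace_lt)
qed

lemma convex_strip_tail: "convex {\<zeta> \<in> closed_strip. r < s * Re \<zeta>}"
proof -
  have "{\<zeta> \<in> closed_strip. r < s * Re \<zeta>} = closed_strip \<inter> {\<zeta>. of_real s \<bullet> \<zeta> > r}"
    by (auto simp: inner_complex_def)
  thus ?thesis by (simp only:) (intro convex_Int convex_strips convex_halfspace_gt)
qed

lemma open_open_strip: "open open_strip"
  unfolding open_strip_def by (auto intro!: open_Collect_conj open_Collect_less continuous_intros)

lemma open_strip_subset: "open_strip \<subseteq> closed_strip"
  by (auto simp: open_strip_def closed_strip_def)

lemma exp_closed_strip: "exp ` closed_strip = closure first_quadrant - {0}"
  and Ln_closed_quadrant: "\<And>z. z \<in> closure first_quadrant - {0} \<Longrightarrow> Ln z \<in> closed_strip"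
  and exp_open_strip: "exp ` open_strip = first_quadrant"
  and Ln_first_quadrant: "\<And>z. z \<in> first_quadrant \<Longrightarrow> Ln z \<in> open_strip"
proof -
  show L: "Ln z \<in> closed_strip" if "z \<in> closure first_quadrant - {0}" for z
  proof -
    have "\<bar>Im (Ln z)\<bar> \<le> pi / 2" "0 \<le> Im (Ln z)"
      using that Re_Ln_pos_le[of z] Im_Ln_pos_le[of z] by (auto simp: closure_first_quadrant)
    thus ?thesis by (simp add: closed_strip_def)
  qed
  show L': "Ln z \<in> open_strip" if "z \<in> first_quadrant" for z
  proof -
    have "z \<noteq> 0" using that by (auto simp: first_quadrant_def)
    hence "\<bar>Im (Ln z)\<bar> < pi / 2" "0 < Im (Ln z)"
      using that Re_Ln_pos_lt[of z] Im_Ln_pos_lt[of z] by (auto simp: first_quadrant_def)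
    thus ?thesis by (simp add: open_strip_def)
  qed
  have e1: "exp \<zeta> \<in> closure first_quadrant - {0}" if "\<zeta> \<in> closed_strip" for \<zeta>
  proof -
    have "0 \<le> Im \<zeta>" "Im \<zeta> \<le> pi / 2" using that by (auto simp: closed_strip_def)
    hence "0 \<le> cos (Im \<zeta>)" "0 \<le> sin (Im \<zeta>)"
      using cos_ge_zero[of "Im \<zeta>"] sin_ge_zero[of "Im \<zeta>"] pi_gt_zero by linarith+
    thus ?thesis by (simp add: closure_first_quadrant Re_exp Im_exp)
  qed
  have e2: "z \<in> exp ` closed_strip" if "z \<in> closure first_quadrant - {0}" for z
    using L[OF that] that by (intro image_eqI[of _ _ "Ln z"]) auto
  show "exp ` closed_strip = closure first_quadrant - {0}"
    by (intro equalityI image_subsetI subsetI e1 e2)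
  have e3: "exp \<zeta> \<in> first_quadrant" if "\<zeta> \<in> open_strip" for \<zeta>
  proof -
    have "0 < Im \<zeta>" "Im \<zeta> < pi / 2" using that by (auto simp: open_strip_def)
    hence "0 < cos (Im \<zeta>)" "0 < sin (Im \<zeta>)"
      using cos_gt_zero[of "Im \<zeta>"] sin_gt_zero[of "Im \<zeta>"] pi_gt_zero by linarith+
    thus ?thesis by (simp add: first_quadrant_def Re_exp Im_exp)
  qed
  have e4: "z \<in> exp ` open_strip" if "z \<in> first_quadrant" for z
    using L'[OF that] that by (intro image_eqI[of _ _ "Ln z"]) (use subsetD[OF first_quadrant_subset that] in auto)
  show "exp ` open_strip = first_quadrant"
    by (intro equalityI image_subsetI subsetI e3 e4)
qed

lemma Ln_exp_closed_strip:
  assumes "\<zeta> \<in> closed_strip"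
  shows "Ln (exp \<zeta>) = \<zeta>"
proof -
  have "0 \<le> Im \<zeta>" "Im \<zeta> \<le> pi / 2" using assms by (auto simp: closed_strip_def)
  thus ?thesis using pi_gt_zero by (intro Ln_exp) linarith+
qed

lemma tendsto_exp_strip_end_left: "filterlim exp (at (0::complex)) (strip_end (-1))"
proof -
  have *: "((\<lambda>\<zeta>::complex. norm (exp \<zeta>)) \<longlongrightarrow> 0) (strip_end (-1))"
    unfolding norm_exp_eq_Re
  proof (rule filterlim_compose[OF exp_at_bot])
    have "filterlim (\<lambda>\<zeta>. - 1 * Re \<zeta>) at_top (strip_end (-1))"
      unfolding strip_end_def by (rule filterlim_mono[OF filterlim_filtercomap order_refl inf_le1])
    thus "filterlim Re at_bot (strip_end (-1))" by (simp add: filterlim_uminus_at_top)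
  qed
  show ?thesis using tendsto_norm_zero_cancel[OF *] by (simp add: filterlim_at)
qed

lemma filterlim_exp_strip_end_right: "filterlim exp (at_infinity :: complex filter) (strip_end 1)"
proof -
  have "filterlim (\<lambda>\<zeta>. 1 * Re \<zeta>) at_top (strip_end 1)"
    unfolding strip_end_def by (rule filterlim_mono[OF filterlim_filtercomap order_refl inf_le1])
  hence "filterlim (\<lambda>\<zeta>::complex. norm (exp \<zeta>)) at_top (strip_end 1)"
    unfolding norm_exp_eq_Re by (intro filterlim_compose[OF exp_at_top]) simp
  thus ?thesis by (simp add: filterlim_at_infinity_conv_norm_at_top)
qed

lemma filterlim_Ln_at_0: "filterlim Ln (strip_end (-1)) (at 0 within closure first_quadrant)"
  unfolding strip_end_def filterlim_inf
proof
  have ne: "eventually (\<lambda>z. z \<in> closure first_quadrant - {0}) (at 0 within closure first_quadrant)"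
    by (auto simp: eventually_at_filter)
  have "filterlim (\<lambda>z::complex. norm z) (at_right 0) (at 0 within closure first_quadrant)"
    unfolding filterlim_at by (auto intro!: tendsto_eq_intros simp: eventually_at_filter)
  hence "filterlim (\<lambda>z::complex. ln (norm z)) at_bot (at 0 within closure first_quadrant)"
    by (rule filterlim_compose[OF ln_at_0])
  hence "filterlim (\<lambda>z. Re (Ln z)) at_bot (at 0 within closure first_quadrant)"
    by (rule filterlim_cong[THEN iffD1, OF refl refl, rotated]) (auto simp: eventually_at_filter)
  thus "filterlim Ln (filtercomap (\<lambda>\<zeta>. - 1 * Re \<zeta>) at_top) (at 0 within closure first_quadrant)"
    by (simp add: filterlim_filtercomap_iff o_def filterlim_uminus_at_top)
  show "filterlim Ln (principal closed_strip) (at 0 within closure first_quadrant)"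
    unfolding filterlim_principal using ne by eventually_elim (rule Ln_closed_quadrant)
qed

lemma filterlim_Ln_at_infinity:
  "filterlim Ln (strip_end 1) (inf at_infinity (principal (closure first_quadrant)))"
  unfolding strip_end_def filterlim_inf
proof
  have e0: "eventually (\<lambda>z::complex. z \<noteq> 0) at_infinity"
    by (auto simp: eventually_at_infinity intro!: exI[of _ 1])
  have "filterlim (\<lambda>z::complex. norm z) at_top (inf at_infinity (principal (closure first_quadrant)))"
    by (rule filterlim_mono[OF filterlim_norm_at_top order_refl inf_le1])
  hence "filterlim (\<lambda>z::complex. ln (norm z)) at_top (inf at_infinity (principal (closure first_quadrant)))"
    by (rule filterlim_compose[OF ln_at_top])
  hence "filterlim (\<lambda>z. Re (Ln z)) at_top (inf at_infinity (principal (closure first_quadrant)))"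
    by (rule filterlim_cong[THEN iffD1, OF refl refl, rotated])
      (use e0 in \<open>auto simp: eventually_inf_principal elim: eventually_mono\<close>)
  thus "filterlim Ln (filtercomap (\<lambda>\<zeta>. 1 * Re \<zeta>) at_top) (inf at_infinity (principal (closure first_quadrant)))"
    by (simp add: filterlim_filtercomap_iff o_def)
  show "filterlim Ln (principal closed_strip) (inf at_infinity (principal (closure first_quadrant)))"
    unfolding filterlim_principal eventually_inf_principal using e0
    by eventually_elim (auto intro: Ln_closed_quadrant)
qed

text \<open>The strip is unbounded, so the maximum principle is applied on a rectangle reaching so
  far out that \<open>ends\<close> controls the vertical sides up to
  \<open>\<epsilon>\<close>.\<close>

lemma strip_minimum_principle:
  assumes hol: "f holomorphic_on open_strip" and cont: "continuous_on closed_strip f"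
    and bdry: "\<And>\<zeta>. Im \<zeta> = 0 \<or> Im \<zeta> = pi / 2 \<Longrightarrow> 0 \<le> Re (f \<zeta>)"
    and ends: "\<And>s \<epsilon>. s = 1 \<or> s = -1 \<Longrightarrow> \<epsilon> > 0 \<Longrightarrow> eventually (\<lambda>\<zeta>. - \<epsilon> \<le> Re (f \<zeta>)) (strip_end s)"
    and \<zeta>: "\<zeta> \<in> closed_strip"
  shows "0 \<le> Re (f \<zeta>)"
proof (rule field_le_epsilon)
  fix \<epsilon> :: real assume \<epsilon>: "0 < \<epsilon>"
  have "eventually (\<lambda>\<zeta>. - \<epsilon> \<le> Re (f \<zeta>)) (strip_end 1)" "eventually (\<lambda>\<zeta>. - \<epsilon> \<le> Re (f \<zeta>)) (strip_end (-1))"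
    by (rule ends; simp add: \<epsilon>)+
  then obtain r1 r2 where
    r1: "\<forall>\<zeta>\<in>closed_strip. r1 < 1 * Re \<zeta> \<longrightarrow> - \<epsilon> \<le> Re (f \<zeta>)" and
    r2: "\<forall>\<zeta>\<in>closed_strip. r2 < -1 * Re \<zeta> \<longrightarrow> - \<epsilon> \<le> Re (f \<zeta>)"
    unfolding eventually_strip_end by blast
  define R where "R = Max {r1 + 1, r2 + 1, \<bar>Re \<zeta>\<bar> + 1}"
  have R: "r1 < R" "r2 < R" "\<bar>Re \<zeta>\<bar> < R" by (auto simp: R_def max_def)
  define S where "S = cbox (Complex (- R) 0) (Complex R (pi / 2))"
  have SS: "S \<subseteq> closed_strip" by (auto simp: S_def in_cbox_complex_iff closed_strip_def)
  have "Re ((\<lambda>\<zeta>. - f \<zeta>) \<zeta>) \<le> \<epsilon>"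
  proof (rule maximum_real_frontier[of "\<lambda>\<zeta>. - f \<zeta>" S])
    have "interior S \<subseteq> open_strip"
      by (auto simp: S_def interior_cbox in_box_complex_iff open_strip_def)
    thus "(\<lambda>\<zeta>. - f \<zeta>) holomorphic_on interior S"
      using hol by (intro holomorphic_intros) (auto intro: holomorphic_on_subset)
    show "continuous_on (closure S) (\<lambda>\<zeta>. - f \<zeta>)"
      using cont SS by (intro continuous_intros) (auto simp: S_def intro: continuous_on_subset)
    show "bounded S" by (simp add: S_def bounded_cbox)
    show "\<zeta> \<in> S" using \<zeta> R by (auto simp: S_def in_cbox_complex_iff closed_strip_def)
    fix z assume z: "z \<in> frontier S"
    hence "z \<in> S" by (simp add: S_def frontier_def)
    hence zs: "z \<in> closed_strip" using SS by auto
    have "z \<in> S" "z \<notin> box (Complex (- R) 0) (Complex R (pi / 2))"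
      using z by (auto simp: S_def frontier_def interior_cbox)
    hence "Im z = 0 \<or> Im z = pi / 2 \<or> Re z = R \<or> Re z = - R"
      by (auto simp: S_def in_cbox_complex_iff in_box_complex_iff)
    thus "Re (- f z) \<le> \<epsilon>"
    proof (elim disjE)
      assume "Re z = R" thus ?thesis using bspec[OF r1 zs] R by simp
    next
      assume "Re z = - R" thus ?thesis using bspec[OF r2 zs] R by simp
    qed (use bdry[of z] \<epsilon> in auto)
  qed
  thus "0 \<le> Re (f \<zeta>) + \<epsilon>" by simp
qed

text \<open>A zero of \<open>Re f\<close> would put a boundary point of the half-plane
  \<open>Re \<ge> 0\<close> into the open image of a nonconstant \<open>f\<close>.\<close>

lemma Re_nonneg_imp_constant_or_pos:
  assumes hol: "f holomorphic_on S" and S: "open S" "connected S"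
    and nonneg: "\<And>z. z \<in> S \<Longrightarrow> 0 \<le> Re (f z)"
  shows "f constant_on S \<or> (\<forall>z\<in>S. 0 < Re (f z))"
proof (rule ccontr)
  assume *: "\<not> ?thesis"
  then obtain z where z: "z \<in> S" "Re (f z) = 0" using nonneg by force
  have "open (f ` S)"
    using open_mapping_thm[OF hol S S(1) order_refl] * by auto
  then obtain e where e: "e > 0" "ball (f z) e \<subseteq> f ` S"
    using z open_contains_ball by blast
  have "f z - of_real (e / 2) \<in> ball (f z) e" using e by (simp add: dist_norm)
  hence "f z - of_real (e / 2) \<in> f ` S" using e by blast
  then obtain y where y: "y \<in> S" "f y = f z - of_real (e / 2)" by (metis imageE)
  hence "Re (f y) = - (e / 2)" using z by simp
  thus False using nonneg[OF y(1)] e by simp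
qed

text \<open>Noshiro-Warschawski: along the segment from \<open>a\<close> to \<open>b\<close> the
  real part of \<open>cnj (b - a) * f\<close> has derivative \<open>|b - a|^2 * Re f' > 0\<close>,
  so \<open>f\<close> cannot agree at the ends.\<close>

lemma inj_on_convex_Re_deriv_pos:
  assumes hol: "f holomorphic_on S" and S: "open S" "convex S"
    and pos: "\<And>z. z \<in> S \<Longrightarrow> 0 < Re (deriv f z)"
  shows "inj_on f S"
proof (rule inj_onI, rule ccontr)
  fix a b assume ab: "a \<in> S" "b \<in> S" "f a = f b" "a \<noteq> b"
  define g where "g = (\<lambda>t::real. a + of_real t * (b - a))"
  define u where "u = (\<lambda>t. Re (cnj (b - a) * f (g t)))"
  have gS: "g t \<in> S" if "0 \<le> t" "t \<le> 1" for t
  proof -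
    have "g t = (1 - t) *\<^sub>R a + t *\<^sub>R b" by (simp add: g_def scaleR_conv_of_real algebra_simps)
    thus ?thesis using convexD_alt[OF S(2) ab(1,2)] that by simp
  qed
  have der: "(u has_real_derivative (norm (b - a))\<^sup>2 * Re (deriv f (g t))) (at t)" if "0 \<le> t" "t \<le> 1" for t
  proof -
    have "(f has_field_derivative deriv f (g t)) (at (g t))"
      using hol S(1) gS[OF that] holomorphic_derivI by blast
    moreover have "(g has_vector_derivative (b - a)) (at t)"
      unfolding g_def by (auto intro!: derivative_eq_intros)
    ultimately have "(f \<circ> g has_vector_derivative (b - a) * deriv f (g t)) (at t)"
      by (rule field_vector_diff_chain_at[rotated])
    hence "((\<lambda>t. cnj (b - a) * f (g t)) has_vector_derivative cnj (b - a) * ((b - a) * deriv f (g t))) (at t)"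
      by (auto simp: o_def intro!: derivative_eq_intros)
    hence "(u has_vector_derivative Re (cnj (b - a) * ((b - a) * deriv f (g t)))) (at t)"
      unfolding u_def by (rule bounded_linear.has_vector_derivative[OF bounded_linear_Re])
    moreover have "cnj (b - a) * ((b - a) * deriv f (g t)) = of_real ((norm (b - a))\<^sup>2) * deriv f (g t)"
      by (simp only: complex_norm_square mult.assoc mult.commute mult.left_commute)
    moreover have "Re (of_real r * w) = r * Re w" for r w by simp
    ultimately show ?thesis by (simp only: has_real_derivative_iff_has_vector_derivative)
  qed
  have "u 0 < u 1"
  proof (rule DERIV_pos_imp_increasing[of 0 1 u])
    fix t :: real assume t: "0 \<le> t" "t \<le> 1"
    show "\<exists>y. (u has_real_derivative y) (at t) \<and> 0 < y"
      using der[OF t] pos[OF gS[OF t]] ab(4)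
      by (intro exI[of _ "(norm (b - a))\<^sup>2 * Re (deriv f (g t))"]) auto
  qed simp
  moreover have "u 0 = u 1" using ab(3) by (simp add: u_def g_def)
  ultimately show False by simp
qed

text \<open>Near a point, \<open>g\<close> is a constant plus \<open>Ln\<close> of a quotient of
  exponentials, because continuity keeps its variation below \<open>pi\<close>.\<close>

lemma holomorphic_on_continuous_log:
  assumes S: "open S" and cont: "continuous_on S g" and hol: "(\<lambda>z. exp (g z)) holomorphic_on S"
  shows "g holomorphic_on S"
  unfolding holomorphic_on_open[OF S]
proof
  fix a assume a: "a \<in> S"
  have "isCont g a" using cont S a continuous_on_eq_continuous_at by blast
  hence "eventually (\<lambda>z. dist (g z) (g a) < pi) (nhds a)"
    by (intro tendstoD) (auto simp: isCont_def tendsto_at_iff_tendsto_nhds)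
  moreover have "eventually (\<lambda>z. z \<in> S) (nhds a)" using S a by (rule eventually_nhds_in_open)
  ultimately have ev: "eventually (\<lambda>z. g a + Ln (exp (g z) / exp (g a)) = g z) (nhds a)"
  proof eventually_elim
    case (elim z)
    have "\<bar>Im (g z - g a)\<bar> < pi"
      using elim(1) abs_Im_le_cmod[of "g z - g a"] by (simp add: dist_norm)
    hence "Ln (exp (g z - g a)) = g z - g a" by (intro Ln_exp) auto
    thus ?case by (simp add: exp_diff)
  qed
  have "(\<lambda>z. exp (g z)) field_differentiable (at a)"
    using hol S a holomorphic_on_imp_differentiable_at by blast
  then obtain D where D: "((\<lambda>z. exp (g z)) has_field_derivative D) (at a)"
    by (auto simp: field_differentiable_def)
  have "((\<lambda>z. exp (g z) / exp (g a)) has_field_derivative D / exp (g a)) (at a)"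
    using D by (rule DERIV_cdivide)
  moreover have "(Ln has_field_derivative inverse 1) (at (exp (g a) / exp (g a)))"
    using has_field_derivative_Ln[of 1] by simp
  ultimately have "((\<lambda>z. Ln (exp (g z) / exp (g a))) has_field_derivative inverse 1 * (D / exp (g a))) (at a)"
    by (rule DERIV_chain2[rotated])
  hence "((\<lambda>z. g a + Ln (exp (g z) / exp (g a))) has_field_derivative 0 + inverse 1 * (D / exp (g a))) (at a)"
    by (intro DERIV_add DERIV_const)
  hence "(g has_field_derivative (D / exp (g a))) (at a)"
    using ev by (subst (asm) DERIV_cong_ev[OF refl _ refl]) auto
  thus "\<exists>f'. (g has_field_derivative f') (at a)" by blast
qed

text \<open>The limit determines \<open>Im g\<close> only modulo \<open>2 * pi\<close>. Its
  vanishing on the real axis near the end selects the branch, and connectedness of the tail of the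
  strip spreads the choice.\<close>

lemma Im_log_tendsto_0:
  assumes cont: "continuous_on closed_strip g"
    and lim: "((\<lambda>\<zeta>. exp (g \<zeta>)) \<longlongrightarrow> 1) (strip_end s)" and s: "s = 1 \<or> s = -1"
    and real: "\<And>x::real. r0 < s * x \<Longrightarrow> Im (g (of_real x)) = 0"
  shows "((\<lambda>\<zeta>. Im (g \<zeta>)) \<longlongrightarrow> 0) (strip_end s)"
proof -
  have "eventually (\<lambda>\<zeta>. dist (exp (g \<zeta>)) 1 < 1) (strip_end s)"
    using lim by (rule tendstoD) simp
  then obtain r1 where r1: "\<And>\<zeta>. \<zeta> \<in> closed_strip \<Longrightarrow> r1 < s * Re \<zeta> \<Longrightarrow> dist (exp (g \<zeta>)) 1 < 1"
    by (auto simp: eventually_strip_end)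
  define r where "r = max r0 r1"
  define T where "T = {\<zeta> \<in> closed_strip. r < s * Re \<zeta>}"
  have T: "connected T" unfolding T_def by (intro convex_connected convex_strip_tail)
  have nn: "exp (g \<zeta>) \<notin> \<real>\<^sub>\<le>\<^sub>0" if "\<zeta> \<in> T" for \<zeta>
  proof
    assume "exp (g \<zeta>) \<in> \<real>\<^sub>\<le>\<^sub>0"
    hence "Re (exp (g \<zeta>)) \<le> 0" by (simp add: complex_nonpos_Reals_iff)
    moreover have "\<bar>Re (exp (g \<zeta>) - 1)\<bar> < 1"
      using r1[of \<zeta>] that abs_Re_le_cmod[of "exp (g \<zeta>) - 1"] by (auto simp: T_def r_def dist_norm)
    ultimately show False by simp
  qed
  define d where "d = (\<lambda>\<zeta>. Im (g \<zeta>) - Im (Ln (exp (g \<zeta>))))"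
  define x0 where "x0 = (complex_of_real (s * (r + 1)))"
  have ss: "s * s = 1" using s by auto
  have x0: "x0 \<in> T" using pi_gt_zero ss by (simp add: T_def x0_def closed_strip_def flip: mult.assoc)
  have img0: "Im (g x0) = 0" unfolding x0_def
    using ss by (intro real) (simp add: r_def flip: mult.assoc)
  have "d x0 = 0"
  proof -
    have "exp (g x0) = of_real (exp (Re (g x0)))"
      using img0 by (simp add: exp_eq_polar)
    thus ?thesis using img0 by (simp add: d_def Im_Ln_of_real)
  qed
  have "d \<zeta> = d x0" if "\<zeta> \<in> T" for \<zeta>
  proof (rule continuous_lattice_valued_constant[OF T _ _ _ that x0])
    show "continuous_on T d" unfolding d_def
      using nn by (intro continuous_intros continuous_on_subset[OF cont]) (auto simp: T_def)
    show "(2 * pi :: real) > 0" by simp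
    fix \<xi> assume "\<xi> \<in> T"
    have "exp (Ln (exp (g \<xi>))) = exp (g \<xi>)" by simp
    then obtain n :: int where "Ln (exp (g \<xi>)) = g \<xi> + (of_int (2 * n) * pi) * \<i>"
      unfolding exp_eq by blast
    hence "d \<xi> = 0 + 2 * pi * of_int (- n)" by (simp add: d_def)
    thus "\<exists>n::int. d \<xi> = 0 + 2 * pi * of_int n" by blast
  qed
  hence d0: "Im (g \<zeta>) = Im (Ln (exp (g \<zeta>)))" if "\<zeta> \<in> T" for \<zeta>
    using that \<open>d x0 = 0\<close> by (simp add: d_def)
  have "((\<lambda>\<zeta>. Im (Ln (exp (g \<zeta>)))) \<longlongrightarrow> Im (Ln 1)) (strip_end s)"
    by (intro tendsto_intros tendsto_Ln lim) auto
  moreover have "eventually (\<lambda>\<zeta>. Im (Ln (exp (g \<zeta>))) = Im (g \<zeta>)) (strip_end s)"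
    unfolding eventually_strip_end by (intro exI[of _ r]) (auto simp: d0 T_def)
  ultimately show ?thesis using Lim_transform_eventually by fastforce
qed

subsection \<open>Zeros of the equioscillating approximant\<close>

definition cpoly :: "real poly \<Rightarrow> complex poly" where
  "cpoly p = map_poly complex_of_real p"

lemma coeff_cpoly [simp]: "coeff (cpoly p) n = of_real (coeff p n)"
  by (simp add: cpoly_def coeff_map_poly)

lemma degree_cpoly [simp]: "degree (cpoly p) = degree p"
  by (simp add: cpoly_def degree_map_poly)

lemma cpoly_add: "cpoly (p + q) = cpoly p + cpoly q"
  and cpoly_diff: "cpoly (p - q) = cpoly p - cpoly q"
  and cpoly_mult: "cpoly (p * q) = cpoly p * cpoly q"
  and cpoly_0 [simp]: "cpoly 0 = 0"
  by (rule poly_eqI, simp add: coeff_mult)+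

lemma cpoly_monom: "cpoly (monom c n) = monom (of_real c) n"
  by (rule poly_eqI) simp

lemma cpoly_pCons: "cpoly (pCons c p) = pCons (of_real c) (cpoly p)"
  by (rule poly_eqI) (simp add: coeff_pCons split: nat.splits)

lemma cpoly_1 [simp]: "cpoly 1 = 1"
  using cpoly_monom[of 1 0] by (simp add: monom_0 one_pCons)

lemma cpoly_power: "cpoly (p ^ n) = cpoly p ^ n"
  by (induction n) (auto simp: cpoly_mult)

lemma cpoly_prod: "cpoly (prod f A) = (\<Prod>x\<in>A. cpoly (f x))"
  by (induction A rule: infinite_finite_induct) (auto simp: cpoly_mult)

lemma cpoly_eq_0_iff [simp]: "cpoly p = 0 \<longleftrightarrow> p = 0"
  by (simp add: poly_eq_iff)

lemma poly_cpoly_of_real [simp]: "poly (cpoly p) (of_real x) = of_real (poly p x)"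
  by (induction p) (auto simp: cpoly_pCons)

lemma poly_cpoly_pcompose_square: "poly (cpoly (pcompose p [:0, 0, 1:])) z = poly (cpoly p) (z\<^sup>2)"
  by (induction p) (auto simp: pcompose_pCons cpoly_add cpoly_mult cpoly_pCons power2_eq_square)

lemma poly_over_power_tendsto:
  fixes p :: "'a::real_normed_field poly"
  assumes g: "filterlim g at_infinity F" and deg: "degree p \<le> n"
  shows "((\<lambda>x. poly p (g x) / g x ^ n) \<longlongrightarrow> coeff p n) F"
proof -
  have g0: "eventually (\<lambda>x. g x \<noteq> 0) F"
    using g by (rule filterlim_at_infinity_imp_eventually_ne)
  have "((\<lambda>x. \<Sum>i\<le>n. coeff p i * inverse (g x) ^ (n - i)) \<longlongrightarrow> (\<Sum>i\<le>n. coeff p i * 0 ^ (n - i))) F"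
    by (intro tendsto_intros filterlim_compose[OF tendsto_inverse_0 g])
  moreover have "(\<Sum>i\<le>n. coeff p i * 0 ^ (n - i)) = (\<Sum>i\<le>n. if i = n then coeff p i else 0)"
    by (intro sum.cong) auto
  moreover have "eventually (\<lambda>x. (\<Sum>i\<le>n. coeff p i * inverse (g x) ^ (n - i)) = poly p (g x) / g x ^ n) F"
    using g0
  proof eventually_elim
    case (elim x)
    have "poly p (g x) = poly (\<Sum>i\<le>n. monom (coeff p i) i) (g x)"
      using poly_as_sum_of_monoms'[OF deg] by simp
    also have "\<dots> / g x ^ n = (\<Sum>i\<le>n. coeff p i * (g x ^ i / g x ^ n))"
      by (simp add: poly_sum poly_monom sum_divide_distrib)
    also have "\<dots> = (\<Sum>i\<le>n. coeff p i * inverse (g x) ^ (n - i))"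
    proof (rule sum.cong[OF refl])
      fix i assume "i \<in> {..n}"
      hence "g x ^ n = g x ^ i * g x ^ (n - i)" by (simp flip: power_add)
      thus "coeff p i * (g x ^ i / g x ^ n) = coeff p i * inverse (g x) ^ (n - i)"
        using elim by (simp add: field_simps power_inverse)
    qed
    finally show ?case by simp
  qed
  ultimately show ?thesis by (simp add: tendsto_cong)
qed

lemma dvd_if_double_root:
  fixes p :: "'a::field poly"
  assumes "poly p c = 0" "poly (pderiv p) c = 0"
  shows "[:- c, 1:]\<^sup>2 dvd p"
proof -
  obtain q where q: "p = [:- c, 1:] * q" using assms(1) poly_eq_0_iff_dvd by (metis dvdE)
  have "pderiv [:- c, 1:] = 1" by (simp add: pderiv_pCons one_pCons)
  hence "poly (pderiv p) c = poly q c" by (simp only: q pderiv_mult) simp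
  hence "[:- c, 1:] dvd q" using assms(2) poly_eq_0_iff_dvd by metis
  thus ?thesis unfolding q power2_eq_square by (rule mult_dvd_mono[OF dvd_refl])
qed

lemma prod_linear_powers_dvd:
  fixes p :: "'a::field poly"
  assumes "finite A" "\<And>c. c \<in> A \<Longrightarrow> [:- c, 1:] ^ e c dvd p"
  shows "(\<Prod>c\<in>A. [:- c, 1:] ^ e c) dvd p"
  using assms
proof (induction A rule: finite_induct)
  case (insert b A)
  define D where "D = (\<Prod>c\<in>A. [:- c, 1:] ^ e c)"
  obtain q where q: "p = D * q" using insert by (auto simp: D_def)
  have "poly D b \<noteq> 0" using insert by (auto simp: D_def poly_prod)
  hence D: "order b D = 0" by (simp add: order_0I)
  have "[:- b, 1:] ^ e b dvd q"
  proof (cases "p = 0")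
    case True
    thus ?thesis using q \<open>poly D b \<noteq> 0\<close> by auto
  next
    case False
    hence "order b p = order b q" unfolding q using D by (subst order_mult) auto
    moreover have "e b \<le> order b p" using insert.prems[of b] False by (simp add: order_divides)
    ultimately show ?thesis by (simp add: order_divides)
  qed
  thus ?case using insert(1,2) unfolding q by (simp add: D_def[symmetric] mult_dvd_mono mult.commute)
qed simp

text \<open>Zeros in the right half-plane minus zeros in the left one, with multiplicity.\<close>

definition root_balance_sum :: "complex poly \<Rightarrow> real" where
  "root_balance_sum p = (\<Sum>z\<in>#proots p. sgn (Re z))"

lemma root_balance_sum_mult:
  "p \<noteq> 0 \<Longrightarrow> q \<noteq> 0 \<Longrightarrow> root_balance_sum (p * q) = root_balance_sum p + root_balance_sum q"
  by (simp add: root_balance_sum_def proots_mult)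

lemma sum_sgn_lower: "- real (size M) \<le> (\<Sum>z\<in>#M. sgn (Re z))"
  by (induction M) (auto simp: sgn_if)

text \<open>All roots of \<open>p\<close> count \<open>+1\<close> and those of \<open>q\<close> at
  least \<open>-1\<close> each, so \<open>bal\<close> is the reverse of an automatic inequality.
  Equality then makes every root of \<open>q\<close> count exactly \<open>-1\<close>.\<close>

lemma remaining_roots_left:
  fixes p q :: "complex poly"
  assumes "p * q \<noteq> 0" and p: "\<And>z. poly p z = 0 \<Longrightarrow> 0 < Re z"
    and bal: "root_balance_sum (p * q) \<le> real (degree p) - real (degree q)"
  shows "root_balance_sum (p * q) = real (degree p) - real (degree q)"
    and "\<And>z. poly q z = 0 \<Longrightarrow> Re z < 0"
proof -
  have nz: "p \<noteq> 0" "q \<noteq> 0" using assms(1) by auto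
  have "root_balance_sum p = (\<Sum>z\<in>#proots p. 1)"
    unfolding root_balance_sum_def
    by (intro arg_cong[of _ _ sum_mset] image_mset_cong) (use p nz in auto)
  also have "\<dots> = real (degree p)" by (simp add: size_proots_complex)
  finally have bp: "root_balance_sum p = real (degree p)" .
  have low: "- real (degree q) \<le> root_balance_sum q"
    using sum_sgn_lower[of "proots q"] by (simp add: root_balance_sum_def size_proots_complex)
  show e: "root_balance_sum (p * q) = real (degree p) - real (degree q)"
    using bal low bp root_balance_sum_mult[OF nz] by simp
  hence bq: "root_balance_sum q = - real (degree q)" using bp root_balance_sum_mult[OF nz] by simp
  fix z assume "poly q z = 0"
  hence "z \<in># proots q" using nz by simp
  then obtain M where M: "proots q = add_mset z M" by (metis insert_DiffM)
  have "real (degree q) = real (size M) + 1" using M size_proots_complex[of q] by simp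
  moreover have "root_balance_sum q = sgn (Re z) + (\<Sum>z\<in>#M. sgn (Re z))"
    by (simp add: root_balance_sum_def M)
  ultimately have "sgn (Re z) \<le> -1" using bq sum_sgn_lower[of M] by simp
  thus "Re z < 0" by (auto simp: sgn_if split: if_splits)
qed

text \<open>An approximant together with its alternation points \<open>x\<close>. Two facts emerge
  from the assumptions: the end nodes are \<open>a\<close> and 1 (\<open>x_0\<close>,
  \<open>x_N\<close>), and \<open>\<sigma>\<close> is \<open>(-1)^k\<close>
  (\<open>sign\<close>).\<close>

locale alternation =
  fixes k m N j :: nat and a L \<sigma> :: real and P :: "real poly" and x :: "nat \<Rightarrow> real"
  assumes k: "k \<ge> 1" and m: "m \<ge> 1" and N: "N = k + m" and j: "j = 2 * k - 1"
    and a: "0 < a" "a < 1" and L: "0 < L" "L < 1"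
    and P: "odd_approx_by N j a L P"
    and mono: "\<And>i. i < N \<Longrightarrow> x i < x (Suc i)" and xa: "x ` {..N} \<subseteq> {a..1}"
    and \<sigma>: "\<sigma> = 1 \<or> \<sigma> = -1"
    and alt: "\<And>i. i \<le> N \<Longrightarrow> 1 - poly P ((x i)\<^sup>2) / x i ^ j = \<sigma> * (-1) ^ i * L"
begin

lemma odd_j: "odd j" and j_pos: "j > 0" and N2: "N \<ge> 2" and j_less: "j < 2 * N - 2"
  using k m by (auto simp: j N)

lemma minus1_j: "(-1::'a::comm_ring_1) ^ j = -1" "(- y) ^ j = - (y ^ j)" for y :: "'b::comm_ring_1"
  using odd_j by simp_all

lemma deg_P: "degree P < N" and err: "\<And>y. y \<in> {a..1} \<Longrightarrow> \<bar>1 - poly P (y\<^sup>2) / y ^ j\<bar> \<le> L"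
  using P by (auto simp: odd_approx_by_def)

lemma x_pos: "i \<le> N \<Longrightarrow> 0 < x i" and x_mem: "i \<le> N \<Longrightarrow> x i \<in> {a..1}"
  using xa a by force+

lemma x_less: "i < l \<Longrightarrow> l \<le> N \<Longrightarrow> x i < x l"
proof (induction l)
  case (Suc l)
  thus ?case using mono[of l] by (cases "i = l") auto
qed simp

lemma x_le: "i \<le> l \<Longrightarrow> l \<le> N \<Longrightarrow> x i \<le> x l"
  using x_less[of i l] by (cases "i = l") auto

lemma x_inj: "inj_on x {..N}"
  by (rule inj_onI) (metis atMost_iff linorder_neqE_nat x_less order_less_irrefl)

text \<open>\<open>y^(j+1)\<close> times the derivative of \<open>P(y^2) / y^j\<close>, written as a
  polynomial in \<open>y^2\<close>; its positive roots are the squares of the critical points of the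
  error.\<close>

definition Q :: "real poly" where
  "Q = smult 2 (pCons 0 (pderiv P)) - smult (real j) P"

lemma coeff_Q: "coeff Q n = (2 * real n - real j) * coeff P n"
  by (cases n) (auto simp: Q_def coeff_pderiv algebra_simps)

text \<open>Since \<open>j\<close> is odd, passing from \<open>P\<close> to \<open>Q\<close>
  multiplies every coefficient by a nonzero number.\<close>

lemma coeff_factor_nz: "2 * real n - real j \<noteq> 0"
proof
  assume "2 * real n - real j = 0"
  hence "real (2 * n) = real j" by simp
  hence "2 * n = j" by (simp only: of_nat_eq_iff)
  thus False using odd_j by auto
qed

lemma P_nz: "P \<noteq> 0"
proof
  assume "P = 0"
  thus False using alt[of 0] L \<sigma> by auto
qed

lemma Q_nz: "Q \<noteq> 0"
  using P_nz coeff_factor_nz by (auto simp: poly_eq_iff coeff_Q)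

lemma deg_Q: "degree Q \<le> degree P"
  by (rule degree_le) (simp add: coeff_Q coeff_eq_0)

text \<open>\<open>\<epsilon> = 1\<close> serves the real axis (\<open>e_deriv\<close>),
  \<open>\<epsilon> = -1\<close> the imaginary one (\<open>h_inj\<close>).\<close>

lemma has_derivative_quotient:
  assumes "y \<noteq> 0"
  shows "((\<lambda>y. poly P (\<epsilon> * y\<^sup>2) / y ^ j) has_real_derivative poly Q (\<epsilon> * y\<^sup>2) / y ^ Suc j) (at y)"
proof -
  have "((\<lambda>y. \<epsilon> * y\<^sup>2) has_real_derivative \<epsilon> * (2 * y)) (at y)"
    by (auto intro!: derivative_eq_intros)
  hence "((\<lambda>y. poly P (\<epsilon> * y\<^sup>2)) has_real_derivative poly (pderiv P) (\<epsilon> * y\<^sup>2) * (\<epsilon> * (2 * y))) (at y)"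
    by (rule DERIV_chain2[OF poly_DERIV])
  moreover have "((\<lambda>y. y ^ j) has_real_derivative real j * y ^ (j - 1)) (at y)"
    by (auto intro!: derivative_eq_intros)
  ultimately have "((\<lambda>y. poly P (\<epsilon> * y\<^sup>2) / y ^ j) has_real_derivative
     (poly (pderiv P) (\<epsilon> * y\<^sup>2) * (\<epsilon> * (2 * y)) * y ^ j - poly P (\<epsilon> * y\<^sup>2) * (real j * y ^ (j - 1))) / (y ^ j * y ^ j)) (at y)"
    using assms by (intro DERIV_divide) auto
  moreover have "y ^ j = y * y ^ (j - 1)" using j_pos by (simp flip: power_Suc)
  hence "(poly (pderiv P) (\<epsilon> * y\<^sup>2) * (\<epsilon> * (2 * y)) * y ^ j - poly P (\<epsilon> * y\<^sup>2) * (real j * y ^ (j - 1))) / (y ^ j * y ^ j)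
     = poly Q (\<epsilon> * y\<^sup>2) / y ^ Suc j"
    using assms by (simp add: Q_def field_simps power2_eq_square)
  ultimately show ?thesis by simp
qed

definition e :: "real \<Rightarrow> real" where "e y = 1 - poly P (y\<^sup>2) / y ^ j"

lemma e_deriv: "y \<noteq> 0 \<Longrightarrow> (e has_real_derivative - (poly Q (y\<^sup>2) / y ^ Suc j)) (at y)"
  using DERIV_diff[OF DERIV_const[of 1] has_derivative_quotient[of y 1]]
  by (simp add: e_def[abs_def])

lemma e_cont: "0 \<notin> S \<Longrightarrow> continuous_on S e"
  unfolding e_def by (auto intro!: continuous_intros)

lemma e_x: "i \<le> N \<Longrightarrow> e (x i) = \<sigma> * (-1) ^ i * L"
  using alt by (simp add: e_def)

lemma e_x_abs: "i \<le> N \<Longrightarrow> \<bar>e (x i)\<bar> = L"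
  using e_x \<sigma> L by (auto simp: abs_mult power_abs)

lemma e_bound: "y \<in> {a..1} \<Longrightarrow> \<bar>e y\<bar> \<le> L"
  using err by (simp add: e_def)

lemma critical:
  assumes "a < y" "y < 1" "\<bar>e y\<bar> = L"
  shows "poly Q (y\<^sup>2) = 0"
proof -
  define s where "s = sgn (e y)"
  have s: "s \<noteq> 0" "s * e y = L" "\<bar>s\<bar> = 1" using assms(3) L by (auto simp: s_def sgn_if abs_if)
  have y0: "y \<noteq> 0" using assms a by auto
  have "((\<lambda>y. s * e y) has_real_derivative s * - (poly Q (y\<^sup>2) / y ^ Suc j)) (at y)"
    by (intro DERIV_cmult e_deriv y0)
  moreover have "s * e z \<le> s * e y" if z: "\<bar>y - z\<bar> < min (y - a) (1 - y)" for z
  proof -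
    have "z \<in> {a..1}" using z by (auto simp: abs_less_iff)
    hence "\<bar>s * e z\<bar> \<le> L" using e_bound[of z] s(3) by (simp add: abs_mult)
    thus ?thesis using s(2) by simp
  qed
  ultimately have "s * - (poly Q (y\<^sup>2) / y ^ Suc j) = 0"
    using assms by (intro DERIV_local_max[of _ _ y "min (y - a) (1 - y)"]) auto
  thus ?thesis using s y0 by simp
qed

lemma card_inner: "card ((\<lambda>i. (x i)\<^sup>2) ` {1..<N}) = N - 1"
proof -
  have "inj_on (\<lambda>i. (x i)\<^sup>2) {1..<N}"
  proof (rule inj_onI)
    fix i l assume *: "i \<in> {1..<N}" "l \<in> {1..<N}" "(x i)\<^sup>2 = (x l)\<^sup>2"
    hence "x i = x l" using x_pos[of i] x_pos[of l] by simp
    thus "i = l" using x_inj * by (auto simp: inj_on_def)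
  qed
  thus ?thesis by (simp add: card_image)
qed

lemma inner_mem: "i \<in> {1..<N} \<Longrightarrow> a < x i \<and> x i < 1"
  using x_less[of 0 i] x_less[of i N] x_mem[of 0] x_mem[of N] by auto

text \<open>Each of the \<open>N - 1\<close> interior nodes is a critical point of the error, while
  \<open>Q\<close> has degree at most \<open>N - 1\<close>. The count is therefore exact, which
  rules out any further critical point and any root \<open>t \<le> 0\<close>.\<close>

lemma Q_roots: "{t. poly Q t = 0} = (\<lambda>i. (x i)\<^sup>2) ` {1..<N}" and degree_Q: "degree Q = N - 1"
proof -
  have sub: "(\<lambda>i. (x i)\<^sup>2) ` {1..<N} \<subseteq> {t. poly Q t = 0}"
    using inner_mem critical e_x_abs by auto
  have fin: "finite {t. poly Q t = 0}" using Q_nz by (rule poly_roots_finite)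
  have le: "card {t. poly Q t = 0} \<le> degree Q" by (rule card_poly_roots_bound[OF Q_nz])
  have "N - 1 \<le> card {t. poly Q t = 0}" using card_mono[OF fin sub] card_inner by simp
  moreover have "degree Q \<le> N - 1" using deg_Q deg_P by simp
  ultimately show "degree Q = N - 1" "{t. poly Q t = 0} = (\<lambda>i. (x i)\<^sup>2) ` {1..<N}"
    using le card_subset_eq[OF fin sub] card_inner by auto
qed

lemma Q_root_iff: "y > 0 \<Longrightarrow> poly Q (y\<^sup>2) = 0 \<longleftrightarrow> y \<in> x ` {1..<N}"
proof -
  assume y: "y > 0"
  have "poly Q (y\<^sup>2) = 0 \<longleftrightarrow> y\<^sup>2 \<in> (\<lambda>i. (x i)\<^sup>2) ` {1..<N}" using Q_roots by blast
  also have "\<dots> \<longleftrightarrow> (\<exists>i\<in>{1..<N}. y\<^sup>2 = (x i)\<^sup>2)" by blast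
  also have "\<dots> \<longleftrightarrow> (\<exists>i\<in>{1..<N}. y = x i)"
    using y x_pos by (intro bex_cong) (auto simp: power2_eq_iff_nonneg less_imp_le)
  finally show ?thesis by blast
qed

lemma Q_neg: "t \<le> 0 \<Longrightarrow> poly Q t \<noteq> 0"
proof
  assume t: "t \<le> 0" "poly Q t = 0"
  then obtain i where "i \<in> {1..<N}" "t = (x i)\<^sup>2" using Q_roots by blast
  thus False using x_pos[of i] t by auto
qed

text \<open>An end node inside the interval would be one more critical point, hence one of the
  interior nodes.\<close>

lemma x_0: "x 0 = a"
proof (rule ccontr)
  assume "x 0 \<noteq> a"
  hence "a < x 0" "x 0 < 1" using x_mem[of 0] x_less[of 0 N] x_mem[of N] N2 by auto
  hence "x 0 \<in> x ` {1..<N}" using critical[of "x 0"] e_x_abs[of 0] Q_root_iff[of "x 0"] x_pos[of 0] by auto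
  then obtain i where "i \<in> {1..<N}" "x 0 = x i" by blast
  thus False using x_less[of 0 i] by simp
qed

lemma x_N: "x N = 1"
proof (rule ccontr)
  assume "x N \<noteq> 1"
  hence "a < x N" "x N < 1" using x_mem[of N] x_less[of 0 N] x_mem[of 0] N2 by auto
  hence "x N \<in> x ` {1..<N}" using critical[of "x N"] e_x_abs[of N] Q_root_iff[of "x N"] x_pos[of N] by auto
  then obtain i where "i \<in> {1..<N}" "x N = x i" by blast
  thus False using x_less[of i N] by simp
qed

lemma P_0_nz: "poly P 0 \<noteq> 0"
  using Q_neg[of 0] coeff_Q[of 0] by (auto simp: poly_0_coeff_0)

lemma lead_P_nz: "coeff P (N - 1) \<noteq> 0"
proof -
  have "coeff Q (N - 1) \<noteq> 0" using degree_Q Q_nz by (metis leading_coeff_0_iff)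
  thus ?thesis by (simp add: coeff_Q)
qed

lemma degree_P: "degree P = N - 1"
  using lead_P_nz le_degree[of P "N - 1"] deg_P by auto

text \<open>On the imaginary axis, \<open>P(z\<^sup>2) / z\<^sup>j\<close> takes the values \<open>\<i> h(y)\<close> at \<open>z = \<i> y\<close>.\<close>

definition h :: "real \<Rightarrow> real" where "h y = (-1) ^ k * poly P (- (y\<^sup>2)) / y ^ j"

lemma h_odd: "h (- y) = - h y"
  by (simp add: h_def minus1_j)

lemma h_cont: "continuous_on {0<..} h"
  unfolding h_def by (auto intro!: continuous_intros)

text \<open>By the mean value theorem equal values would give a zero of the derivative of
  \<open>h\<close>, that is, a root of \<open>Q\<close> at a negative argument.\<close>

lemma h_inj: "inj_on h {0<..}"
proof -
  have "h y \<noteq> h z" if yz: "0 < y" "y < z" for y z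
  proof
    assume eq: "h y = h z"
    have "\<exists>w. y < w \<and> w < z \<and> h z - h y = (z - y) * ((-1) ^ k * (poly Q (- 1 * w\<^sup>2) / w ^ Suc j))"
    proof (rule MVT2[OF yz(2)])
      fix t assume "y \<le> t" "t \<le> z"
      hence "((\<lambda>y. (-1) ^ k * (poly P (- 1 * y\<^sup>2) / y ^ j)) has_real_derivative
          (-1) ^ k * (poly Q (- 1 * t\<^sup>2) / t ^ Suc j)) (at t)"
        using yz by (intro DERIV_cmult has_derivative_quotient) auto
      thus "(h has_real_derivative (-1) ^ k * (poly Q (- 1 * t\<^sup>2) / t ^ Suc j)) (at t)"
        by (simp add: h_def[abs_def])
    qed
    then obtain w where "y < w" "h z - h y = (z - y) * ((-1) ^ k * (poly Q (- 1 * w\<^sup>2) / w ^ Suc j))"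
      by blast
    moreover have "poly Q (- 1 * w\<^sup>2) \<noteq> 0" by (rule Q_neg) simp
    ultimately show False using eq yz by simp
  qed
  thus ?thesis unfolding inj_on_def by (metis greaterThan_iff linorder_neqE_linordered_idom)
qed

text \<open>The leading coefficients of \<open>h\<close>: near 0 it behaves like
  \<open>p0 / y^j\<close>, at infinity like \<open>p1 * y^(2 * N - 2 - j)\<close>. Their signs
  decide the limits of the arctangent in \<open>root_balance\<close>.\<close>

definition p0 :: real where "p0 = (-1) ^ k * poly P 0"
definition p1 :: real where "p1 = (-1) ^ k * ((-1) ^ (N - 1) * coeff P (N - 1))"

lemma p0_nz: "p0 \<noteq> 0" and p1_nz: "p1 \<noteq> 0"
  using P_0_nz lead_P_nz by (auto simp: p0_def p1_def)

lemma h_at_0: "p0 > 0 \<Longrightarrow> filterlim h at_top (at_right 0)" "p0 < 0 \<Longrightarrow> filterlim h at_bot (at_right 0)"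
proof -
  have 1: "((\<lambda>y. (-1) ^ k * poly P (- (y\<^sup>2))) \<longlongrightarrow> (-1) ^ k * poly P (- (0\<^sup>2))) (at_right 0)"
    by (intro tendsto_intros)
  have 2: "filterlim (\<lambda>y::real. inverse (y ^ j)) at_top (at_right 0)"
  proof (rule filterlim_compose[OF filterlim_inverse_at_top_right])
    have "((\<lambda>y::real. y ^ j) \<longlongrightarrow> 0 ^ j) (at_right 0)" by (intro tendsto_intros)
    thus "filterlim (\<lambda>y::real. y ^ j) (at_right 0) (at_right 0)"
      using j_pos by (auto simp: filterlim_at eventually_at_filter)
  qed
  have h: "h = (\<lambda>y. ((-1) ^ k * poly P (- (y\<^sup>2))) * inverse (y ^ j))"
    by (simp add: h_def[abs_def] divide_inverse)
  show "filterlim h at_top (at_right 0)" if "p0 > 0"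
    unfolding h using that by (intro filterlim_tendsto_pos_mult_at_top[OF 1 _ 2]) (simp add: p0_def)
  show "filterlim h at_bot (at_right 0)" if "p0 < 0"
    unfolding h using that by (intro filterlim_tendsto_neg_mult_at_bot[OF 1 _ 2]) (simp add: p0_def)
qed

lemma h_at_top: "p1 > 0 \<Longrightarrow> filterlim h at_top at_top" "p1 < 0 \<Longrightarrow> filterlim h at_bot at_top"
proof -
  have inf: "filterlim (\<lambda>y::real. - (y\<^sup>2)) at_infinity at_top"
    by (intro filterlim_at_bot_imp_at_infinity) real_asymp
  have "((\<lambda>y. poly P (- (y\<^sup>2)) / (- (y\<^sup>2)) ^ (N - 1)) \<longlongrightarrow> coeff P (N - 1)) at_top"
    by (rule poly_over_power_tendsto[OF inf]) (simp add: degree_P)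
  hence "((\<lambda>y. (-1) ^ k * ((-1) ^ (N - 1) * (poly P (- (y\<^sup>2)) / (- (y\<^sup>2)) ^ (N - 1)))) \<longlongrightarrow> p1) at_top"
    unfolding p1_def by (intro tendsto_mult_left)
  hence 1: "((\<lambda>y. (-1) ^ k * (poly P (- (y\<^sup>2)) / y ^ (2 * N - 2))) \<longlongrightarrow> p1) at_top"
  proof (rule Lim_transform_eventually)
    show "\<forall>\<^sub>F y in at_top. (-1) ^ k * ((-1) ^ (N - 1) * (poly P (- (y\<^sup>2)) / (- (y\<^sup>2)) ^ (N - 1))) =
       (-1) ^ k * (poly P (- (y\<^sup>2)) / y ^ (2 * N - 2))"
      using eventually_gt_at_top[of 0]
    proof eventually_elim
      case (elim y)
      have "(- (y\<^sup>2)) ^ (N - 1) = (-1) ^ (N - 1) * y ^ (2 * N - 2)"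
        by (subst power_minus) (simp add: diff_mult_distrib2 flip: power_mult)
      thus ?case using elim by (simp add: field_simps power_mult_distrib[symmetric])
    qed
  qed
  have 2: "filterlim (\<lambda>y::real. y ^ (2 * N - 2 - j)) at_top at_top"
    using j_less by (intro filterlim_pow_at_top filterlim_ident) auto
  have ev: "eventually (\<lambda>y. ((-1) ^ k * (poly P (- (y\<^sup>2)) / y ^ (2 * N - 2))) * y ^ (2 * N - 2 - j) = h y) at_top"
    using eventually_gt_at_top[of 0]
  proof eventually_elim
    case (elim y)
    have "y ^ (2 * N - 2) = y ^ j * y ^ (2 * N - 2 - j)" using j_less by (simp flip: power_add)
    thus ?case using elim by (simp add: h_def)
  qed
  show "filterlim h at_top at_top" if "p1 > 0"
    using filterlim_tendsto_pos_mult_at_top[OF 1 that 2] filterlim_cong[OF refl refl ev] by blast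
  show "filterlim h at_bot at_top" if "p1 < 0"
    using filterlim_tendsto_neg_mult_at_bot[OF 1 that 2] filterlim_cong[OF refl refl ev] by blast
qed

lemma arctan_h_limits:
  assumes "\<tau> > 0"
  shows "((\<lambda>y. arctan (h y / \<tau>)) \<longlongrightarrow> sgn p1 * (pi / 2)) at_top"
    "((\<lambda>y. arctan (h y / \<tau>)) \<longlongrightarrow> sgn p0 * (pi / 2)) (at_right 0)"
proof -
  have inv: "inverse \<tau> * h y = h y / \<tau>" for y by (simp add: divide_inverse)
  have edge: "((\<lambda>y. arctan (h y / \<tau>)) \<longlongrightarrow> pi / 2) F" if "filterlim h at_top F" for F
  proof -
    have "filterlim (\<lambda>y. inverse \<tau> * h y) at_top F"
      using that assms by (intro filterlim_tendsto_pos_mult_at_top[OF tendsto_const]) auto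
    from filterlim_compose[OF tendsto_arctan_at_top this] show ?thesis by (simp only: inv)
  qed
  have bot: "((\<lambda>y. arctan (h y / \<tau>)) \<longlongrightarrow> - (pi / 2)) F" if "filterlim h at_bot F" for F
  proof -
    have "filterlim (\<lambda>y. inverse \<tau> * h y) at_bot F"
      using that assms by (intro filterlim_tendsto_pos_mult_at_bot[OF tendsto_const]) auto
    from filterlim_compose[OF tendsto_arctan_at_bot this] show ?thesis by (simp only: inv)
  qed
  show "((\<lambda>y. arctan (h y / \<tau>)) \<longlongrightarrow> sgn p1 * (pi / 2)) at_top"
    using edge[OF h_at_top(1)] bot[OF h_at_top(2)] p1_nz by (cases "p1 > 0") (auto simp: sgn_if)
  show "((\<lambda>y. arctan (h y / \<tau>)) \<longlongrightarrow> sgn p0 * (pi / 2)) (at_right 0)"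
    using edge[OF h_at_0(1)] bot[OF h_at_0(2)] p0_nz by (cases "p0 > 0") (auto simp: sgn_if)
qed

text \<open>The nonzero roots are the points where \<open>P(z^2) / z^j\<close> takes the value
  \<open>\<tau>\<close>.\<close>

definition A :: "real \<Rightarrow> real poly" where
  "A \<tau> = monom \<tau> j - pcompose P [:0, 0, 1:]"

lemma poly_A: "poly (A \<tau>) y = \<tau> * y ^ j - poly P (y\<^sup>2)"
  by (simp add: A_def poly_monom poly_pcompose power2_eq_square)

lemma poly_cA: "poly (cpoly (A \<tau>)) z = of_real \<tau> * z ^ j - poly (cpoly P) (z\<^sup>2)"
  by (simp add: A_def cpoly_diff cpoly_monom poly_cpoly_pcompose_square poly_monom)

lemma degree_A: "degree (A \<tau>) = 2 * N - 2"
proof -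
  have d: "degree (pcompose P [:0, 0, 1:]) = 2 * N - 2" by (simp add: degree_pcompose degree_P)
  have "degree (monom \<tau> j) < 2 * N - 2" using j_less degree_monom_le[of \<tau> j] by linarith
  moreover have "A \<tau> = monom \<tau> j + (- pcompose P [:0, 0, 1:])" by (simp add: A_def)
  ultimately have "degree (A \<tau>) = degree (- pcompose P [:0, 0, 1:])"
    using d by (simp only: degree_add_eq_right degree_minus)
  thus ?thesis using d by simp
qed

lemma A_nz: "A \<tau> \<noteq> 0"
  using degree_A[of \<tau>] N2 by auto

lemma cpoly_P_imaginary:
  "poly (cpoly P) ((\<i> * of_real y)\<^sup>2) = (\<i> * of_real y) ^ j * (\<i> * of_real (h y))" if "y \<noteq> 0"
proof -
  have "(\<i> * of_real y)\<^sup>2 = of_real (- (y\<^sup>2))" by (simp add: power_mult_distrib)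
  hence 1: "poly (cpoly P) ((\<i> * of_real y)\<^sup>2) = of_real (poly P (- (y\<^sup>2)))"
    by (simp only: poly_cpoly_of_real)
  have "\<i> ^ j * \<i> = (-1) ^ k" using k unfolding j by (simp flip: power_Suc2 add: power_mult)
  hence "(\<i> * of_real y) ^ j * (\<i> * of_real (h y)) = (-1) ^ k * of_real (y ^ j * h y)"
    by (simp add: power_mult_distrib mult_ac)
  also have "y ^ j * h y = (-1) ^ k * poly P (- (y\<^sup>2))" using that by (simp add: h_def)
  also have "(-1) ^ k * of_real ((-1) ^ k * poly P (- (y\<^sup>2))) = (of_real (poly P (- (y\<^sup>2))) :: complex)"
    by (simp add: power_mult_distrib[symmetric] flip: mult.assoc)
  finally show ?thesis using 1 by simp
qed

lemma cA_imaginary: "y \<noteq> 0 \<Longrightarrow> poly (cpoly (A \<tau>)) (\<i> * of_real y) = (\<i> * of_real y) ^ j * Complex \<tau> (- h y)"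
proof -
  assume y: "y \<noteq> 0"
  have c: "Complex \<tau> (- h y) = of_real \<tau> - \<i> * of_real (h y)" by (simp add: complex_eq_iff)
  show ?thesis unfolding poly_cA cpoly_P_imaginary[OF y] c by (simp add: algebra_simps)
qed

lemma cA_roots:
  assumes "\<tau> > 0" "poly (cpoly (A \<tau>)) z = 0"
  shows "Re z \<noteq> 0"
proof
  assume "Re z = 0"
  hence z: "z = \<i> * of_real (Im z)" by (simp add: complex_eq_iff)
  show False
  proof (cases "Im z = 0")
    case True
    hence "z = of_real 0" using z by simp
    hence "poly (A \<tau>) 0 = 0" using assms(2) by (metis of_real_eq_0_iff poly_cpoly_of_real)
    thus False using P_0_nz zero_power[OF j_pos, where 'a = real] by (simp add: poly_A)
  next
    case False
    hence "poly (cpoly (A \<tau>)) z = (\<i> * of_real (Im z)) ^ j * Complex \<tau> (- h (Im z))"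
      using cA_imaginary[OF False] z by metis
    moreover have "Complex \<tau> (- h (Im z)) \<noteq> 0" using assms(1) by (simp add: complex_eq_iff)
    ultimately show False using assms(2) False by simp
  qed
qed

text \<open>The limits of the arctangent are \<open>\<plusminus> pi / 2\<close> according to the
  signs of \<open>p1\<close> and \<open>p0\<close>, whatever \<open>\<tau>\<close> is; so all
  positive levels have the same balance, at most 2.\<close>

lemma balance_A: "\<tau> > 0 \<Longrightarrow> root_balance_sum (cpoly (A \<tau>)) = sgn p1 - sgn p0"
proof -
  assume \<tau>: "\<tau> > 0"
  have "root_balance_sum (cpoly (A \<tau>)) * pi = 2 * (sgn p1 * (pi / 2) - sgn p0 * (pi / 2))"
    unfolding root_balance_sum_def
    using A_nz cA_roots[OF \<tau>] cA_imaginary arctan_h_limits[OF \<tau>]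
    by (intro root_balance[where h = h and \<tau> = \<tau> and j = j]) (auto simp: \<tau> h_cont h_odd)
  also have "\<dots> = (sgn p1 - sgn p0) * pi" by (simp add: algebra_simps)
  finally show ?thesis by simp
qed

lemma level_roots:
  assumes "\<bar>c\<bar> < L"
  shows "\<exists>r. (\<forall>i<N. x i < r i \<and> r i < x (Suc i) \<and> e (r i) = c)"
proof -
  have "\<exists>y. x i < y \<and> y < x (Suc i) \<and> e y = c" if i: "i < N" for i
  proof -
    have cont: "continuous_on {x i..x (Suc i)} e" using x_pos[of i] i by (intro e_cont) auto
    have ne: "e (x i) \<noteq> c" "e (x (Suc i)) \<noteq> c" using e_x_abs[of i] e_x_abs[of "Suc i"] i assms by auto
    have opp: "e (x (Suc i)) = - e (x i)" using e_x[of i] e_x[of "Suc i"] i by simp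
    have abs: "\<bar>e (x i)\<bar> = L" using e_x_abs i by simp
    have "\<exists>y\<ge>x i. y \<le> x (Suc i) \<and> e y = c"
    proof (cases "e (x i) < 0")
      case True
      thus ?thesis using opp abs assms mono[OF i] by (intro IVT' cont) auto
    next
      case False
      thus ?thesis using opp abs assms mono[OF i] by (intro IVT2' cont) auto
    qed
    thus ?thesis using ne by (metis order_le_less)
  qed
  thus ?thesis by metis
qed

lemma e_eq_iff_root: "y > 0 \<Longrightarrow> e y = c \<longleftrightarrow> poly (A (1 - c)) y = 0"
  by (auto simp: e_def poly_A field_simps)

text \<open>\<open>level_roots\<close> supplies \<open>N\<close> roots between consecutive nodes,
  and the cofactor has degree \<open>N - 2\<close>. The bound 2 from \<open>balance_A\<close> is
  exactly \<open>N - (N - 2)\<close>, so \<open>remaining_roots_left\<close> applies.\<close>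

lemma level_balance:
  assumes c: "\<bar>c\<bar> < L"
  shows "sgn p1 - sgn p0 = 2"
    and "\<And>z. poly (cpoly (A (1 - c))) z = 0 \<Longrightarrow> 0 \<le> Re z \<Longrightarrow> \<exists>y\<in>{a<..<1}. z = of_real y"
proof -
  obtain r where r: "\<And>i. i < N \<Longrightarrow> x i < r i \<and> r i < x (Suc i) \<and> e (r i) = c"
    using level_roots[OF c] by blast
  have rpos: "0 < r i" if "i < N" for i using r[OF that] x_pos[of i] that by auto
  have rmem: "r i \<in> {a<..<1}" if "i < N" for i
    using r[OF that] x_mem[of i] x_mem[of "Suc i"] that by auto
  have "r i < r l" if "i < l" "l < N" for i l
    using r[of i] r[of l] x_le[of "Suc i" l] that by force
  hence inj: "inj_on r {..<N}"
    by (intro inj_onI) (metis lessThan_iff linorder_neqE_nat order_less_irrefl)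
  define D where "D = (\<Prod>b\<in>r ` {..<N}. [:- b, 1:] ^ 1)"
  have "D dvd A (1 - c)" unfolding D_def
  proof (rule prod_linear_powers_dvd)
    fix b assume "b \<in> r ` {..<N}"
    hence "poly (A (1 - c)) b = 0" using r rpos e_eq_iff_root by auto
    thus "[:- b, 1:] ^ 1 dvd A (1 - c)" by (simp add: poly_eq_0_iff_dvd)
  qed simp
  then obtain C where C: "A (1 - c) = D * C" by blast
  have nz: "D \<noteq> 0" "C \<noteq> 0" using A_nz[of "1 - c"] C by auto
  have dD: "degree D = N" unfolding D_def
    using inj by (subst degree_prod_sum_eq) (auto simp: card_image)
  hence dC: "degree C = N - 2" using degree_A[of "1 - c"] C nz N2 by (simp add: degree_mult_eq)
  have cD: "cpoly D = (\<Prod>b\<in>r ` {..<N}. [:- of_real b, 1:])"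
    by (simp add: D_def cpoly_prod cpoly_pCons)
  have Droots: "\<exists>y\<in>{a<..<1}. z = of_real y" if z: "poly (cpoly D) z = 0" for z
  proof -
    have "\<exists>b\<in>r ` {..<N}. poly [:- of_real b, 1:] z = 0" using z unfolding cD poly_prod by simp
    thus ?thesis using rmem by auto
  qed
  have c1: "1 - c > 0" using c L by auto
  have prod: "cpoly (A (1 - c)) = cpoly D * cpoly C" by (simp add: C cpoly_mult)
  have bal: "root_balance_sum (cpoly D * cpoly C) = sgn p1 - sgn p0"
    using balance_A[OF c1] prod by simp
  have le2: "sgn p1 - sgn p0 \<le> 2" by (auto simp: sgn_if)
  have deg: "real (degree (cpoly D)) - real (degree (cpoly C)) = 2" using dD dC N2 by simp
  have Dpos: "0 < Re z" if "poly (cpoly D) z = 0" for z using Droots[OF that] a by auto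
  have nz': "cpoly D * cpoly C \<noteq> 0" using nz by simp
  note rem = remaining_roots_left[OF nz' Dpos]
  show "sgn p1 - sgn p0 = 2" using rem(1) bal le2 deg by simp
  fix z assume "poly (cpoly (A (1 - c))) z = 0" "0 \<le> Re z"
  moreover have "\<not> poly (cpoly C) z = 0" if "0 \<le> Re z"
    using rem(2)[of z] bal le2 deg that by auto
  ultimately show "\<exists>y\<in>{a<..<1}. z = of_real y" using Droots by (auto simp: prod)
qed

lemma p0_neg: "p0 < 0" and p1_pos: "p1 > 0"
  using level_balance(1)[of 0] L by (auto simp: sgn_if split: if_splits)

text \<open>The order to which a node is at least a root of \<open>T\<close>: interior nodes are
  critical points of the error, the two ends are not.\<close>

definition node_mult :: "nat \<Rightarrow> nat" where "node_mult i = (if i = 0 \<or> i = N then 1 else 2)"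

definition D :: "real poly" where "D = (\<Prod>i\<le>N. [:- x i, 1:] ^ node_mult i)"

text \<open>Up to the factor \<open>z^(2 * j)\<close>, \<open>T\<close> is \<open>(1 - f)\<^sup>2 - L\<^sup>2\<close>, which vanishes to second order at the interior
  alternation points.\<close>

definition T :: "real poly" where "T = A (1 - L) * A (1 + L)"

lemma poly_cT: "poly (cpoly T) z = (z ^ j - poly (cpoly P) (z\<^sup>2))\<^sup>2 - of_real (L\<^sup>2) * (z ^ j)\<^sup>2"
  by (simp add: T_def cpoly_mult poly_cA power2_eq_square algebra_simps)

lemma D_over_image: "D = (\<Prod>b\<in>x ` {..N}. [:- b, 1:] ^ node_mult (inv_into {..N} x b))"
proof -
  have "(\<Prod>b\<in>x ` {..N}. [:- b, 1:] ^ node_mult (inv_into {..N} x b)) =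
      (\<Prod>i\<in>{..N}. [:- x i, 1:] ^ node_mult (inv_into {..N} x (x i)))"
    by (rule prod.reindex_cong[OF x_inj refl refl])
  also have "\<dots> = D"
    unfolding D_def by (intro prod.cong refl) (simp only: inv_into_f_f[OF x_inj])
  finally show ?thesis by simp
qed

lemma D_dvd_T: "D dvd T"
  unfolding D_over_image
proof (rule prod_linear_powers_dvd)
  fix b assume "b \<in> x ` {..N}"
  then obtain i where i: "i \<le> N" "b = x i" by auto
  have inv: "inv_into {..N} x b = i" using i by (simp add: inv_into_f_f[OF x_inj])
  define c where "c = e (x i)"
  have c: "c = L \<or> c = - L" using e_x[OF i(1)] \<sigma> by (cases "even i") (auto simp: c_def)
  have dvd: "A (1 - c) dvd T" using c by (auto simp: T_def)
  have r: "poly (A (1 - c)) (x i) = 0" using e_eq_iff_root[OF x_pos[OF i(1)], of c] by (simp add: c_def)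
  show "[:- b, 1:] ^ node_mult (inv_into {..N} x b) dvd T"
  proof (cases "i = 0 \<or> i = N")
    case True
    thus ?thesis using r dvd inv i by (simp add: node_mult_def poly_eq_0_iff_dvd) (metis dvd_trans)
  next
    case False
    hence "i \<in> {1..<N}" using i by auto
    hence Q0: "poly Q ((x i)\<^sup>2) = 0" using Q_root_iff[OF x_pos[OF i(1)]] by auto
    \<comment> \<open>At a root of \<open>A (1 - c)\<close> the derivative is, up to the factor
      \<open>x i\<close>, the value of \<open>- Q\<close> at the square of the node, and this
      vanishes at interior nodes.\<close>
    have "x i * poly (pderiv (A (1 - c))) (x i) = real j * (1 - c) * x i ^ j - 2 * (x i)\<^sup>2 * poly (pderiv P) ((x i)\<^sup>2)"
    proof -
      have "x i * x i ^ (j - 1) = x i ^ j" using j_pos by (simp flip: power_Suc)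
      thus ?thesis
        by (simp add: A_def pderiv_diff pderiv_monom pderiv_pcompose poly_monom poly_pcompose pderiv_pCons
            power2_eq_square algebra_simps)
    qed
    also have "\<dots> = - poly Q ((x i)\<^sup>2)"
    proof -
      have pe: "poly P ((x i)\<^sup>2) = (1 - c) * x i ^ j" using r by (simp add: poly_A)
      have "poly Q ((x i)\<^sup>2) = 2 * ((x i)\<^sup>2 * poly (pderiv P) ((x i)\<^sup>2)) - real j * poly P ((x i)\<^sup>2)"
        by (simp add: Q_def)
      thus ?thesis unfolding pe by (simp add: algebra_simps)
    qed
    finally have "poly (pderiv (A (1 - c))) (x i) = 0" using Q0 x_pos[OF i(1)] by simp
    hence "[:- x i, 1:]\<^sup>2 dvd A (1 - c)" by (rule dvd_if_double_root[OF r])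
    thus ?thesis using dvd inv i False by (simp add: node_mult_def) (metis dvd_trans)
  qed
qed simp

lemma sum_mult: "(\<Sum>i\<le>N. node_mult i) = 2 * N"
proof -
  have "{..N} = insert 0 (insert N {1..<N})" using N2 by auto
  hence "(\<Sum>i\<le>N. node_mult i) = node_mult 0 + (node_mult N + (\<Sum>i\<in>{1..<N}. node_mult i))" using N2 by simp
  also have "(\<Sum>i\<in>{1..<N}. node_mult i) = (\<Sum>i\<in>{1..<N}. 2)" by (intro sum.cong) (auto simp: node_mult_def)
  finally show ?thesis using N2 by (simp add: node_mult_def)
qed

definition K :: "real poly" where "K = T div D"

lemma T_eq: "T = D * K"
  using D_dvd_T by (simp add: K_def)

text \<open>The two factors of \<open>T\<close> have balance 2 each, and the degrees of
  \<open>D\<close> and \<open>K\<close> are \<open>2 * N\<close> and \<open>2 * N - 4\<close>: the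
  difference again equals the balance, so \<open>K\<close> is left with roots in the left
  half-plane.\<close>

lemma K_roots: "poly (cpoly K) z = 0 \<Longrightarrow> Re z < 0"
proof -
  have nz: "D \<noteq> 0" "K \<noteq> 0" using T_eq A_nz by (auto simp: T_def)
  have dD: "degree D = 2 * N" unfolding D_def
    by (subst degree_prod_sum_eq) (auto simp: degree_power_eq sum_mult)
  have "degree T = 4 * N - 4" unfolding T_def using A_nz by (subst degree_mult_eq) (auto simp: degree_A)
  hence dK: "degree K = 2 * N - 4" using T_eq nz dD by (simp add: degree_mult_eq)
  have cD: "cpoly D = (\<Prod>i\<le>N. [:- of_real (x i), 1:] ^ node_mult i)"
    by (simp add: D_def cpoly_prod cpoly_power cpoly_pCons)
  have "0 < Re z" if z: "poly (cpoly D) z = 0" for z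
  proof -
    obtain i where "i \<le> N" "poly [:- of_real (x i), 1:] z = 0"
      using z unfolding cD by (auto simp: poly_prod poly_power)
    thus ?thesis using x_pos[of i] by auto
  qed
  moreover have "root_balance_sum (cpoly D * cpoly K) = 4"
  proof -
    have "cpoly D * cpoly K = cpoly (A (1 - L)) * cpoly (A (1 + L))"
      using T_eq by (simp add: T_def flip: cpoly_mult)
    thus ?thesis
      using balance_A[of "1 - L"] balance_A[of "1 + L"] L A_nz p0_neg p1_pos
      by (simp add: root_balance_sum_mult)
  qed
  ultimately show "poly (cpoly K) z = 0 \<Longrightarrow> Re z < 0"
    using remaining_roots_left(2)[of "cpoly D" "cpoly K" z] nz dD dK N2 by auto
qed

end

subsection \<open>The branch of the arc cosine\<close>

text \<open>\<open>csqrt\<close> jumps across the negative real axis but is continuous up to it from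
  above, and \<open>exp\<close> maps the closed strip into \<open>Im z \<ge> 0\<close>.\<close>

lemma continuous_on_csqrt_upper: "continuous_on {z. 0 \<le> Im z} csqrt"
proof -
  have "continuous_on {z. 0 \<le> Im z} (\<lambda>z. Complex (sqrt ((cmod z + Re z) / 2)) (sqrt ((cmod z - Re z) / 2)))"
    by (intro continuous_intros) auto
  moreover have "csqrt z = Complex (sqrt ((cmod z + Re z) / 2)) (sqrt ((cmod z - Re z) / 2))"
    if "0 \<le> Im z" for z
    using that by (auto simp: complex_eq_iff)
  ultimately show ?thesis by (metis (no_types, lifting) continuous_on_cong mem_Collect_eq)
qed

lemma csqrt_of_real_neg: "r \<le> 0 \<Longrightarrow> csqrt (of_real r) = \<i> * of_real (sqrt (- r))"
  by (rule csqrt_unique) (auto simp: power_mult_distrib simp flip: of_real_power)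

lemma csqrt_of_real_pos: "0 \<le> r \<Longrightarrow> csqrt (of_real r) = of_real (sqrt r)"
  by (rule csqrt_unique) (auto simp flip: of_real_power)

lemma log_on_strip:
  assumes cont: "continuous_on closed_strip f" and hol: "f holomorphic_on open_strip"
    and nz: "\<And>\<zeta>. \<zeta> \<in> closed_strip \<Longrightarrow> f \<zeta> \<noteq> 0"
  obtains g where "continuous_on closed_strip g" "g holomorphic_on open_strip"
    "\<And>\<zeta>. \<zeta> \<in> closed_strip \<Longrightarrow> exp (g \<zeta>) = f \<zeta>"
proof -
  obtain g where g: "continuous_on closed_strip g" "\<And>\<zeta>. \<zeta> \<in> closed_strip \<Longrightarrow> f \<zeta> = exp (g \<zeta>)"
    using continuous_logarithm_on_contractible[OF cont _ nz] convex_imp_contractible[OF convex_strips(1)] by blast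
  have "(\<lambda>\<zeta>. exp (g \<zeta>)) holomorphic_on open_strip"
    using hol g(2) open_strip_subset by (subst holomorphic_cong[OF refl, of _ _ f]) auto
  hence "g holomorphic_on open_strip"
    by (rule holomorphic_on_continuous_log[OF open_open_strip continuous_on_subset[OF g(1) open_strip_subset]])
  thus ?thesis using that g by metis
qed

lemma of_real_in_closed_strip [simp]: "of_real x \<in> closed_strip"
  by (simp add: closed_strip_def)

lemma positive_exp_imp_constant_Im:
  fixes g :: "real \<Rightarrow> complex"
  assumes cont: "continuous_on S g" and S: "connected S"
    and pos: "\<And>x. x \<in> S \<Longrightarrow> \<exists>r>0. exp (g x) = of_real r" and xy: "x \<in> S" "y \<in> S"
  shows "Im (g x) = Im (g y)"
proof (rule continuous_lattice_valued_constant[OF S _ _ _ xy])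
  show "continuous_on S (\<lambda>x. Im (g x))" using cont by (intro continuous_intros)
  show "(2 * pi :: real) > 0" by simp
  fix x assume "x \<in> S"
  then obtain r where r: "r > 0" "exp (g x) = of_real r" using pos by blast
  have "exp (g x) = exp (of_real (ln r))" using r by (simp add: exp_of_real)
  then obtain n :: int where "g x = of_real (ln r) + (of_int (2 * n) * pi) * \<i>"
    unfolding exp_eq by blast
  hence "Im (g x) = 0 + 2 * pi * of_int n" by simp
  thus "\<exists>n::int. Im (g x) = 0 + 2 * pi * of_int n" by blast
qed

text \<open>A logarithm of \<open>f\<close> has constant imaginary part \<open>c\<close> on the real
  axis, a multiple of \<open>2 * pi\<close>; subtracting it before halving makes the root positive
  there.\<close>

lemma sqrt_on_strip:
  assumes cont: "continuous_on closed_strip f" and hol: "f holomorphic_on open_strip"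
    and nz: "\<And>\<zeta>. \<zeta> \<in> closed_strip \<Longrightarrow> f \<zeta> \<noteq> 0"
    and pos: "\<And>x. \<exists>r>0. f (of_real x) = of_real r"
  shows "\<exists>\<kappa>. continuous_on closed_strip \<kappa> \<and> \<kappa> holomorphic_on open_strip \<and>
    (\<forall>\<zeta>\<in>closed_strip. (\<kappa> \<zeta>)\<^sup>2 = f \<zeta>) \<and> (\<forall>x. \<exists>r>0. \<kappa> (of_real x) = of_real r)"
proof -
  obtain g where g: "continuous_on closed_strip g" "g holomorphic_on open_strip"
    "\<And>\<zeta>. \<zeta> \<in> closed_strip \<Longrightarrow> exp (g \<zeta>) = f \<zeta>"
    using log_on_strip[OF cont hol nz] by metis
  define c where "c = Im (g 0)"
  have "continuous_on UNIV (\<lambda>x::real. g (of_real x))"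
    by (intro continuous_on_compose2[OF g(1)] continuous_intros) auto
  hence Im: "Im (g (of_real x)) = c" for x
    using positive_exp_imp_constant_Im[of UNIV "\<lambda>x. g (of_real x)" x 0] pos g(3) by (simp add: c_def)
  define \<kappa> where "\<kappa> = (\<lambda>\<zeta>. exp ((g \<zeta> - \<i> * of_real c) / 2))"
  have e1: "exp (\<i> * of_real c) = 1"
  proof -
    obtain r where r: "r > 0" "f (of_real 0) = of_real r" using pos by blast
    have "exp (g 0) = of_real r" using g(3)[OF of_real_in_closed_strip[of 0]] r by simp
    hence "of_real (exp (Re (g 0))) * cis c = of_real r * cis 0"
      by (simp add: exp_eq_polar c_def)
    hence "cis c = cis 0" using r(1) by (intro cis_eqI_pos[of "exp (Re (g 0))" r]) auto
    thus ?thesis by (simp add: cis_conv_exp)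
  qed
  have "(\<kappa> \<zeta>)\<^sup>2 = f \<zeta>" if "\<zeta> \<in> closed_strip" for \<zeta>
  proof -
    have "(\<kappa> \<zeta>)\<^sup>2 = exp (2 * ((g \<zeta> - \<i> * of_real c) / 2))"
      by (simp only: \<kappa>_def exp_double)
    moreover have "2 * (w / 2) = w" for w :: complex by simp
    ultimately have "(\<kappa> \<zeta>)\<^sup>2 = exp (g \<zeta> - \<i> * of_real c)" by (simp only:)
    thus ?thesis using g(3)[OF that] e1 by (simp add: exp_diff)
  qed
  moreover have "\<exists>r>0. \<kappa> (of_real x) = of_real r" for x
  proof -
    have "g (of_real x) - \<i> * of_real c = of_real (Re (g (of_real x)))"
      using Im[of x] by (simp add: complex_eq_iff)
    hence "\<kappa> (of_real x) = of_real (exp (Re (g (of_real x)) / 2))"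
      by (simp add: \<kappa>_def exp_of_real[symmetric])
    thus ?thesis by (meson exp_gt_zero)
  qed
  moreover have "continuous_on closed_strip \<kappa>" unfolding \<kappa>_def by (intro continuous_intros g) auto
  moreover have "\<kappa> holomorphic_on open_strip" unfolding \<kappa>_def by (intro holomorphic_intros g) auto
  ultimately show ?thesis by blast
qed

text \<open>To leave \<open>[0, pi]\<close>, \<open>v\<close> would have to take a value with
  \<open>sin \<le> 0\<close> at an interior point: \<open>pi\<close> itself on the way up, or a
  value between \<open>- pi\<close> and 0 on the way down.\<close>

lemma sin_pos_stays_in_0_pi:
  fixes v :: "real \<Rightarrow> real"
  assumes cont: "continuous_on {p..q} v" and v0: "v p = 0"
    and pos: "\<And>t. p < t \<Longrightarrow> t < q \<Longrightarrow> 0 < sin (v t)" and t: "p \<le> t" "t \<le> q"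
  shows "0 \<le> v t \<and> v t \<le> pi"
proof (rule ccontr)
  assume neg: "\<not> ?thesis"
  have c: "continuous_on {p..t} v" using cont t by (auto elim: continuous_on_subset)
  have hit: False if w: "w \<in> {v t<..<0} \<or> w \<in> {0<..<v t}" and s: "sin w \<le> 0" for w
  proof -
    have "\<exists>s\<ge>p. s \<le> t \<and> v s = w"
    proof (cases "w < 0")
      case True thus ?thesis using w v0 t(1) by (intro IVT2' c) auto
    next
      case False thus ?thesis using w v0 t(1) by (intro IVT' c) auto
    qed
    then obtain s where "p \<le> s" "s \<le> t" "v s = w" by blast
    moreover have "s \<noteq> p" "s \<noteq> t" using w v0 \<open>v s = w\<close> by auto
    ultimately show False using pos[of s] t(2) \<open>sin w \<le> 0\<close> by auto
  qed
  show False
  proof (cases "v t < 0")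
    case True
    define w where "w = max (v t / 2) (- pi / 2)"
    have "v t < w" "w < 0" using True pi_gt_zero by (auto simp: w_def)
    moreover have "- pi < w" using pi_gt_zero by (simp add: w_def less_max_iff_disj)
    hence "sin w < 0" using sin_gt_zero[of "- w"] \<open>w < 0\<close> by simp
    ultimately show False using hit[of w] by simp
  next
    case False
    hence "pi \<in> {0<..<v t}" using neg pi_gt_zero by auto
    thus False using hit[of pi] by simp
  qed
qed

lemma filterlim_shift_strip_end: "filterlim (\<lambda>\<zeta>. \<zeta> + of_real t) (strip_end s) (strip_end s)"
proof -
  have "eventually (\<lambda>\<zeta>. Q (\<zeta> + of_real t)) (strip_end s)" if Q: "eventually Q (strip_end s)" for Q
  proof -
    obtain r where r: "\<And>\<zeta>. \<zeta> \<in> closed_strip \<Longrightarrow> r < s * Re \<zeta> \<Longrightarrow> Q \<zeta>"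
      using Q unfolding eventually_strip_end by blast
    have "Q (\<zeta> + of_real t)" if "\<zeta> \<in> closed_strip" "r - s * t < s * Re \<zeta>" for \<zeta>
      using that by (intro r) (auto simp: closed_strip_def algebra_simps)
    thus ?thesis unfolding eventually_strip_end by blast
  qed
  thus ?thesis by (simp add: filterlim_iff)
qed

context alternation
begin

definition F :: "complex \<Rightarrow> complex" where
  "F z = (-1) ^ k / of_real L * (1 - poly (cpoly P) (z\<^sup>2) / z ^ j)"

definition Fr :: "real \<Rightarrow> real" where "Fr y = (-1) ^ k / L * e y"

lemma F_of_real: "F (of_real y) = of_real (Fr y)"
proof -
  have "(complex_of_real y)\<^sup>2 = of_real (y\<^sup>2)" by simp
  thus ?thesis unfolding F_def Fr_def e_def by (simp only: poly_cpoly_of_real) simp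
qed

lemma Fr_cont: "0 \<notin> S \<Longrightarrow> continuous_on S Fr"
  unfolding Fr_def using L by (intro continuous_intros e_cont) auto

lemma F_squared: "z \<noteq> 0 \<Longrightarrow> of_real (L\<^sup>2) * (z ^ j)\<^sup>2 * ((F z)\<^sup>2 - 1) = poly (cpoly D) z * poly (cpoly K) z"
proof -
  assume z: "z \<noteq> 0"
  have alg: "u * v * (w - 1) = v * (u * w) - u * v" for u v w :: complex by (simp add: algebra_simps)
  have "((-1 :: complex) ^ k)\<^sup>2 = 1" by (simp flip: power_mult add: mult.commute[of k])
  hence "of_real (L\<^sup>2) * (F z)\<^sup>2 = (1 - poly (cpoly P) (z\<^sup>2) / z ^ j)\<^sup>2"
    using L by (simp add: F_def power_mult_distrib power_divide)
  hence "(z ^ j)\<^sup>2 * (of_real (L\<^sup>2) * (F z)\<^sup>2) = (z ^ j * (1 - poly (cpoly P) (z\<^sup>2) / z ^ j))\<^sup>2"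
    by (simp only: power_mult_distrib)
  hence "of_real (L\<^sup>2) * (z ^ j)\<^sup>2 * ((F z)\<^sup>2 - 1) =
     (z ^ j * (1 - poly (cpoly P) (z\<^sup>2) / z ^ j))\<^sup>2 - of_real (L\<^sup>2) * (z ^ j)\<^sup>2"
    using alg[of "of_real (L\<^sup>2)" "(z ^ j)\<^sup>2" "(F z)\<^sup>2"] by (simp only:)
  also have "z ^ j * (1 - poly (cpoly P) (z\<^sup>2) / z ^ j) = z ^ j - poly (cpoly P) (z\<^sup>2)"
    using z by (simp add: field_simps)
  finally show ?thesis using poly_cT[of z] by (simp add: T_eq cpoly_mult)
qed

text \<open>Polymorphic because it is evaluated at real and at complex points. The orientation
  \<open>x i - z\<close> makes it positive to the left of all interior nodes.\<close>

definition node_prod :: "'a::real_normed_field \<Rightarrow> 'a" where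
  "node_prod z = (\<Prod>i\<in>{1..<N}. of_real (x i) - z)"

lemma node_prod_of_real: "node_prod (of_real y) = of_real (node_prod y)"
  by (simp add: node_prod_def)

lemma poly_cD: "poly (cpoly D) z = (z - of_real a) * (z - 1) * (node_prod z)\<^sup>2"
proof -
  have "{..N} = insert 0 (insert N {1..<N})" using N2 by auto
  hence "D = [:- x 0, 1:] ^ node_mult 0 * ([:- x N, 1:] ^ node_mult N * (\<Prod>i\<in>{1..<N}. [:- x i, 1:] ^ node_mult i))"
    unfolding D_def using N2 by simp
  also have "(\<Prod>i\<in>{1..<N}. [:- x i, 1:] ^ node_mult i) = (\<Prod>i\<in>{1..<N}. [:- x i, 1:] ^ 2)"
    by (intro prod.cong) (auto simp: node_mult_def)
  finally have "D = [:- a, 1:] * ([:- 1, 1:] * (\<Prod>i\<in>{1..<N}. [:- x i, 1:] ^ 2))"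
    by (simp add: node_mult_def x_0 x_N)
  hence "poly (cpoly D) z = (z - of_real a) * ((z - 1) * (\<Prod>i\<in>{1..<N}. (z - of_real (x i))\<^sup>2))"
    by (simp only: cpoly_mult cpoly_prod cpoly_power poly_mult poly_prod poly_power) (simp add: cpoly_pCons)
  also have "(\<Prod>i\<in>{1..<N}. (z - of_real (x i))\<^sup>2) = (node_prod z)\<^sup>2"
    unfolding node_prod_def prod_power_distrib by (simp add: power2_commute)
  finally show ?thesis by (simp add: mult.assoc)
qed

lemma poly_D: "poly D y = (y - a) * (y - 1) * (node_prod y)\<^sup>2"
proof -
  have "complex_of_real (poly D y) = of_real ((y - a) * (y - 1) * (node_prod y)\<^sup>2)"
    using poly_cD[of "of_real y"] by (simp add: node_prod_of_real)
  thus ?thesis by (simp only: of_real_eq_iff)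
qed

lemma node_prod_nz: "y \<notin> x ` {1..<N} \<Longrightarrow> node_prod y \<noteq> (0::real)"
  by (auto simp: node_prod_def)

lemma Fr_squared: "y \<noteq> 0 \<Longrightarrow> L\<^sup>2 * (y ^ j)\<^sup>2 * ((Fr y)\<^sup>2 - 1) = (y - a) * (y - 1) * (node_prod y)\<^sup>2 * poly K y"
proof -
  assume y: "y \<noteq> 0"
  have "complex_of_real (L\<^sup>2 * (y ^ j)\<^sup>2 * ((Fr y)\<^sup>2 - 1)) = of_real ((y - a) * (y - 1) * (node_prod y)\<^sup>2 * poly K y)"
    using F_squared[of "of_real y"] y poly_D[of y] by (simp add: F_of_real flip: of_real_power)
  thus ?thesis by (simp only: of_real_eq_iff)
qed

lemma Fr_bound: "y \<in> {a..1} \<Longrightarrow> \<bar>Fr y\<bar> \<le> 1"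
  using e_bound[of y] L by (simp add: Fr_def abs_mult power_abs)

lemma Fr_x: "i \<le> N \<Longrightarrow> Fr (x i) = (-1) ^ k * \<sigma> * (-1) ^ i"
  using e_x[of i] L by (simp add: Fr_def)

text \<open>\<open>K\<close> has no positive zero, so one sample suffices. Between the first two
  nodes \<open>|Fr| \<le> 1\<close>, and the sign of the other factors in \<open>Fr_squared\<close>
  is known.\<close>

lemma K_pos: "y > 0 \<Longrightarrow> poly K y > 0"
proof -
  have nz: "poly K y \<noteq> 0" if "y > 0" for y
    using K_roots[of "of_real y"] that by auto
  define y0 where "y0 = (x 0 + x 1) / 2"
  have y0: "x 0 < y0" "y0 < x 1" using mono[of 0] N2 by (auto simp: y0_def)
  have y0p: "0 < y0" "a < y0" "y0 < 1" using y0 x_pos[of 0] x_mem[of 1] N2 x_0 by auto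
  have "y0 \<notin> x ` {1..<N}" using y0 x_le[of 1] by (fastforce simp: not_less)
  hence "(node_prod y0)\<^sup>2 > (0::real)" using node_prod_nz by simp
  hence neg: "(y0 - a) * (y0 - 1) * (node_prod y0)\<^sup>2 < 0" using y0p by (simp add: mult_less_0_iff zero_less_mult_iff)
  have "(Fr y0)\<^sup>2 \<le> 1" using Fr_bound[of y0] y0p by (simp add: abs_square_le_1)
  hence "L\<^sup>2 * (y0 ^ j)\<^sup>2 * ((Fr y0)\<^sup>2 - 1) \<le> 0" by (simp add: mult_le_0_iff)
  hence "(y0 - a) * (y0 - 1) * (node_prod y0)\<^sup>2 * poly K y0 \<le> 0" using Fr_squared[of y0] y0p by simp
  hence "poly K y0 \<ge> 0" using neg by (simp add: mult_le_0_iff)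
  hence K0: "poly K y0 > 0" using nz[OF y0p(1)] by simp
  assume y: "y > 0"
  show ?thesis
  proof (rule ccontr)
    assume "\<not> poly K y > 0"
    hence Ky: "poly K y < 0" using nz[OF y] by simp
    have "y < y0 \<or> y0 < y" using K0 Ky by (metis linorder_neqE_linordered_idom order_less_asym)
    thus False
    proof
      assume "y < y0"
      thus False using poly_IVT_pos[of y y0 K] Ky K0 nz y by force
    next
      assume "y0 < y"
      thus False using poly_IVT_neg[of y0 y K] Ky K0 nz y0p by force
    qed
  qed
qed

lemma Fr_sq_sign:
  assumes "y > 0" "y \<notin> x ` {1..<N}"
  shows "(Fr y)\<^sup>2 > 1 \<longleftrightarrow> y < a \<or> 1 < y" "(Fr y)\<^sup>2 < 1 \<longleftrightarrow> a < y \<and> y < 1"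
proof -
  define p where "p = L\<^sup>2 * (y ^ j)\<^sup>2"
  define q where "q = (node_prod y)\<^sup>2 * poly K y"
  have p: "p > 0" using L assms by (simp add: p_def)
  have q: "q > 0" using node_prod_nz[OF assms(2)] K_pos[OF assms(1)] by (simp add: q_def)
  have eq: "p * ((Fr y)\<^sup>2 - 1) = ((y - a) * (y - 1)) * q"
    using Fr_squared assms by (simp add: p_def q_def mult.assoc)
  have "(Fr y)\<^sup>2 > 1 \<longleftrightarrow> 0 < p * ((Fr y)\<^sup>2 - 1)" using p by (simp add: zero_less_mult_iff)
  also have "\<dots> \<longleftrightarrow> 0 < (y - a) * (y - 1)" unfolding eq using q by (metis zero_less_mult_pos2 mult_pos_pos)
  also have "\<dots> \<longleftrightarrow> y < a \<or> 1 < y" using a by (auto simp: zero_less_mult_iff)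
  finally show "(Fr y)\<^sup>2 > 1 \<longleftrightarrow> y < a \<or> 1 < y" .
  have "(Fr y)\<^sup>2 < 1 \<longleftrightarrow> p * ((Fr y)\<^sup>2 - 1) < 0" using p by (simp add: mult_less_0_iff)
  also have "\<dots> \<longleftrightarrow> (y - a) * (y - 1) < 0" unfolding eq using q by (simp add: mult_less_0_iff[of _ q])
  also have "\<dots> \<longleftrightarrow> a < y \<and> y < 1" using a by (auto simp: mult_less_0_iff)
  finally show "(Fr y)\<^sup>2 < 1 \<longleftrightarrow> a < y \<and> y < 1" .
qed

lemma node_inner: "y \<in> x ` {1..<N} \<Longrightarrow> a < y \<and> y < 1"
  using inner_mem by auto

lemma Fr_outside: "y > 0 \<Longrightarrow> y < a \<or> 1 < y \<Longrightarrow> \<bar>Fr y\<bar> > 1"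
  using Fr_sq_sign(1)[of y] node_inner[of y] by (auto simp: abs_square_less_1[symmetric] not_less dest: node_inner)
    (metis abs_square_le_1 linorder_not_less)+

lemma Fr_inside: "a < y \<Longrightarrow> y < 1 \<Longrightarrow> y \<notin> x ` {1..<N} \<Longrightarrow> \<bar>Fr y\<bar> < 1"
  using Fr_sq_sign(2)[of y] a by (simp add: abs_square_less_1)

text \<open>The sign near 0 is that of \<open>- p0 > 0\<close>, and \<open>Fr\<close> cannot change
  sign on \<open>(0, a)\<close> since \<open>|Fr| > 1\<close> there.\<close>

lemma Fr_gt_1: "0 < y \<Longrightarrow> y < a \<Longrightarrow> Fr y > 1"
proof -
  have "((\<lambda>y. (-1) ^ k * (y ^ j - poly P (y\<^sup>2))) \<longlongrightarrow> (-1) ^ k * (0 ^ j - poly P (0\<^sup>2))) (at_right (0::real))"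
    by (intro tendsto_intros)
  moreover have "(-1) ^ k * (0 ^ j - poly P (0\<^sup>2)) > 0" using p0_neg j_pos by (simp add: p0_def power_0_left right_diff_distrib)
  ultimately have "eventually (\<lambda>y. (-1) ^ k * (y ^ j - poly P (y\<^sup>2)) > 0) (at_right (0::real))"
    by (rule order_tendstoD(1))
  hence "eventually (\<lambda>y. Fr y > 0 \<and> y \<in> {0<..<a}) (at_right 0)"
    using eventually_at_right_real[OF a(1)]
  proof eventually_elim
    case (elim y)
    have "Fr y = (-1) ^ k * (y ^ j - poly P (y\<^sup>2)) / (L * y ^ j)"
      using elim by (simp add: Fr_def e_def field_simps)
    thus ?case using elim L by simp
  qed
  then obtain b where b: "Fr b > 0" "0 < b" "b < a"
    using eventually_happens[of _ "at_right (0::real)"] by fastforce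
  assume y: "0 < y" "y < a"
  show ?thesis
  proof (rule ccontr)
    assume "\<not> Fr y > 1"
    hence neg: "Fr y < 0" using Fr_outside[of y] y by auto
    have "\<exists>t\<in>{0<..<a}. Fr t = 0"
    proof (cases "y < b")
      case True
      have "continuous_on {y..b} Fr" using y by (intro Fr_cont) auto
      hence "\<exists>t\<ge>y. t \<le> b \<and> Fr t = 0" using neg b True by (intro IVT') auto
      thus ?thesis using y b by auto
    next
      case False
      have "continuous_on {b..y} Fr" using b by (intro Fr_cont) auto
      hence "\<exists>t\<ge>b. t \<le> y \<and> Fr t = 0" using neg b False by (intro IVT2') auto
      thus ?thesis using y b by force
    qed
    then obtain t where "t \<in> {0<..<a}" "Fr t = 0" by blast
    thus False using Fr_outside[of t] by auto
  qed
qed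

text \<open>By alternation the value at \<open>a\<close> is 1 or -1, and the bound
  \<open>Fr > 1\<close> to the left of \<open>a\<close> decides.\<close>

lemma Fr_a: "Fr a = 1" and sign: "(-1) ^ k * \<sigma> = 1"
proof -
  have "Fr (x 0) = (-1) ^ k * \<sigma>" using Fr_x[of 0] by simp
  hence e: "Fr a = (-1) ^ k * \<sigma>" by (simp add: x_0)
  have "isCont Fr a" using Fr_cont[of "{0<..}"] a by (simp add: continuous_on_eq_continuous_at)
  hence "(Fr \<longlongrightarrow> Fr a) (at_left a)" by (auto simp: isCont_def filterlim_at_split)
  moreover have "eventually (\<lambda>y. 1 \<le> Fr y) (at_left a)"
    using eventually_at_left_real[OF a(1)] by eventually_elim (use Fr_gt_1 in force)
  ultimately have "1 \<le> Fr a" by (rule tendsto_lowerbound) simp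
  moreover have "(-1) ^ k = (1::real) \<or> (-1) ^ k = (-1::real)" by (cases "even k") auto
  ultimately show "Fr a = 1" using e \<sigma> by auto
  thus "(-1) ^ k * \<sigma> = 1" using e by simp
qed

lemma Fr_node: "i \<le> N \<Longrightarrow> Fr (x i) = (-1) ^ i"
  using Fr_x[of i] sign by simp

lemma Fr_right: "y > 1 \<Longrightarrow> (-1) ^ N * Fr y > 1"
proof (rule ccontr)
  assume y: "y > 1" and n: "\<not> (-1) ^ N * Fr y > 1"
  have "\<bar>(-1) ^ N * Fr y\<bar> > 1" using Fr_outside[of y] y by (simp add: abs_mult power_abs)
  hence neg: "(-1) ^ N * Fr y < 0" using n by auto
  have one: "(-1) ^ N * Fr 1 = 1" using Fr_node[of N] by (simp add: x_N power_mult_distrib[symmetric])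
  have "continuous_on {1..y} (\<lambda>y. (-1) ^ N * Fr y)" by (intro continuous_intros Fr_cont) auto
  hence "\<exists>t\<ge>1. t \<le> y \<and> (-1) ^ N * Fr t = 0" using neg one y by (intro IVT2') auto
  then obtain t where t: "t \<ge> 1" "Fr t = 0" by auto
  hence "t > 1" using one by (cases "t = 1") auto
  thus False using t Fr_outside[of t] by auto
qed

text \<open>For \<open>|w| < 1\<close> the equation is a level \<open>c\<close> of the error with
  \<open>|c| < L\<close>, covered by \<open>level_balance\<close>. For \<open>w = 1\<close> or
  \<open>w = -1\<close> it says that \<open>z\<close> is a root of \<open>D * K\<close>, and
  \<open>K\<close> has no roots with \<open>Re z \<ge> 0\<close>.\<close>

lemma F_avoids:
  assumes "0 \<le> Re z" "z \<noteq> 0" "F z = of_real w" "\<bar>w\<bar> \<le> 1"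
  shows "\<exists>y\<in>{a..1}. z = of_real y"
proof (cases "\<bar>w\<bar> = 1")
  case True
  hence "(F z)\<^sup>2 = 1" using assms(3) by (auto simp: abs_if split: if_splits)
  hence "poly (cpoly D) z * poly (cpoly K) z = 0" using F_squared[OF assms(2)] by simp
  moreover have "poly (cpoly K) z \<noteq> 0" using K_roots[of z] assms(1) by auto
  ultimately have "(z - of_real a) * (z - 1) * (node_prod z)\<^sup>2 = 0" by (simp add: poly_cD)
  hence "z = of_real a \<or> z = of_real 1 \<or> (\<exists>i\<in>{1..<N}. z = of_real (x i))"
    by (auto simp: node_prod_def)
  thus ?thesis
  proof (elim disjE bexE)
    fix i assume "i \<in> {1..<N}" "z = of_real (x i)"
    thus ?thesis using inner_mem[of i] by (intro bexI[of _ "x i"]) auto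
  qed (use a in auto)
next
  case False
  define c where "c = (-1) ^ k * L * w"
  have "\<bar>c\<bar> = L * \<bar>w\<bar>" using L by (simp add: c_def abs_mult power_abs)
  also have "\<dots> < L * 1" using False assms(4) L by (intro mult_strict_left_mono) auto
  finally have c: "\<bar>c\<bar> < L" by simp
  have "of_real c = (-1) ^ k * of_real L * F z" using assms(3) by (simp add: c_def)
  also have "\<dots> = 1 - poly (cpoly P) (z\<^sup>2) / z ^ j"
    using L by (simp add: F_def power_mult_distrib[symmetric])
  finally have "poly (cpoly (A (1 - c))) z = 0"
    using assms(2) by (simp add: poly_cA field_simps)
  then obtain y where "y \<in> {a<..<1}" "z = of_real y" using level_balance(2)[OF c] assms(1) by blast
  thus ?thesis by auto
qed

lemma exp_strip:
  assumes "\<zeta> \<in> closed_strip"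
  shows "0 \<le> Re (exp \<zeta>)" "0 \<le> Im (exp \<zeta>)" "exp \<zeta> \<noteq> 0"
  using assms exp_closed_strip by (auto simp: closure_first_quadrant)

lemma exp_strip_real: "\<zeta> \<in> closed_strip \<Longrightarrow> exp \<zeta> = of_real y \<Longrightarrow> \<zeta> = of_real (ln y)"
proof -
  assume *: "\<zeta> \<in> closed_strip" "exp \<zeta> = of_real y"
  hence "y > 0" using exp_strip[OF *(1)] by (cases "y = 0") auto
  thus ?thesis using Ln_exp_closed_strip[OF *(1)] *(2) by (simp add: Ln_of_real)
qed

text \<open>The factor of the square root of \<open>1 - F^2\<close> that comes from
  \<open>K\<close>. It is obtained by choice because the roots of \<open>K\<close> are known only to
  lie in the left half-plane, which is enough for a branch on the strip.\<close>

definition kappa :: "complex \<Rightarrow> complex" where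
  "kappa = (SOME \<kappa>. continuous_on closed_strip \<kappa> \<and> \<kappa> holomorphic_on open_strip \<and>
    (\<forall>\<zeta>\<in>closed_strip. (\<kappa> \<zeta>)\<^sup>2 = poly (cpoly K) (exp \<zeta>)) \<and> (\<forall>x. \<exists>r>0. \<kappa> (of_real x) = of_real r))"

lemma kappa: "continuous_on closed_strip kappa" "kappa holomorphic_on open_strip"
    "\<And>\<zeta>. \<zeta> \<in> closed_strip \<Longrightarrow> (kappa \<zeta>)\<^sup>2 = poly (cpoly K) (exp \<zeta>)"
    "\<And>x. \<exists>r>0. kappa (of_real x) = of_real r"
proof -
  have "\<exists>\<kappa>. continuous_on closed_strip \<kappa> \<and> \<kappa> holomorphic_on open_strip \<and>
    (\<forall>\<zeta>\<in>closed_strip. (\<kappa> \<zeta>)\<^sup>2 = poly (cpoly K) (exp \<zeta>)) \<and> (\<forall>x. \<exists>r>0. \<kappa> (of_real x) = of_real r)"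
  proof (rule sqrt_on_strip)
    show "continuous_on closed_strip (\<lambda>\<zeta>. poly (cpoly K) (exp \<zeta>))" by (intro continuous_intros)
    show "(\<lambda>\<zeta>. poly (cpoly K) (exp \<zeta>)) holomorphic_on open_strip" by (intro holomorphic_intros)
    show "poly (cpoly K) (exp \<zeta>) \<noteq> 0" if "\<zeta> \<in> closed_strip" for \<zeta>
      using K_roots[of "exp \<zeta>"] exp_strip(1)[OF that] by auto
    show "\<exists>r>0. poly (cpoly K) (exp (of_real x)) = of_real r" for x
      using K_pos[of "exp x"] by (intro exI[of _ "poly K (exp x)"]) (simp add: exp_of_real)
  qed
  from someI_ex[OF this, folded kappa_def] show
    "continuous_on closed_strip kappa" "kappa holomorphic_on open_strip"
    "\<And>\<zeta>. \<zeta> \<in> closed_strip \<Longrightarrow> (kappa \<zeta>)\<^sup>2 = poly (cpoly K) (exp \<zeta>)"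
    "\<And>x. \<exists>r>0. kappa (of_real x) = of_real r" by blast+
qed

text \<open>The branch of \<open>sqrt(1 - F\<^sup>2)\<close> that is positive to the right of \<open>a\<close>. For \<open>Im z \<ge> 0\<close>, the factor
  \<open>- \<i> * csqrt (z - 1)\<close> is the square root of \<open>1 - z\<close> that is positive for \<open>z < 1\<close> and continuous on
  the closed upper half-plane.\<close>

definition S :: "complex \<Rightarrow> complex" where
  "S \<zeta> = - \<i> * csqrt (exp \<zeta> - of_real a) * csqrt (exp \<zeta> - 1) * node_prod (exp \<zeta>) * kappa \<zeta> / (of_real L * exp \<zeta> ^ j)"

text \<open>Joukowski coordinates: \<open>E\<close> and its reciprocal \<open>F - \<i> S\<close> are
  the two roots of \<open>X^2 - 2 F X + 1\<close>, and \<open>E\<close> is to become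
  \<open>exp (\<i> * psi)\<close>.\<close>

definition E :: "complex \<Rightarrow> complex" where "E \<zeta> = F (exp \<zeta>) + \<i> * S \<zeta>"

lemma S_squared: "\<zeta> \<in> closed_strip \<Longrightarrow> (S \<zeta>)\<^sup>2 = 1 - (F (exp \<zeta>))\<^sup>2"
proof -
  assume \<zeta>: "\<zeta> \<in> closed_strip"
  define z where "z = exp \<zeta>"
  have z0: "z \<noteq> 0" by (simp add: z_def)
  have "(S \<zeta>)\<^sup>2 = - ((z - of_real a) * (z - 1) * (node_prod z)\<^sup>2 * (kappa \<zeta>)\<^sup>2) / (of_real (L\<^sup>2) * (z ^ j)\<^sup>2)"
  proof -
    have "(S \<zeta>)\<^sup>2 = (- \<i>)\<^sup>2 * (z - of_real a) * (z - 1) * (node_prod z)\<^sup>2 * (kappa \<zeta>)\<^sup>2 / ((of_real L)\<^sup>2 * (z ^ j)\<^sup>2)"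
      by (simp only: S_def z_def power_mult_distrib power_divide power2_csqrt)
    moreover have "(- \<i>)\<^sup>2 * u * v * w * t = - (u * v * w * t)" for u v w t by simp
    ultimately show ?thesis by (simp only: of_real_power)
  qed
  also have "\<dots> = - (poly (cpoly D) z * poly (cpoly K) z) / (of_real (L\<^sup>2) * (z ^ j)\<^sup>2)"
    using kappa(3)[OF \<zeta>] by (simp add: poly_cD z_def)
  also have "\<dots> = 1 - (F z)\<^sup>2"
    unfolding F_squared[OF z0, symmetric] using z0 L by (simp add: field_simps)
  finally show ?thesis by (simp add: z_def)
qed

lemma E_inverse: "\<zeta> \<in> closed_strip \<Longrightarrow> E \<zeta> * (F (exp \<zeta>) - \<i> * S \<zeta>) = 1"
  using S_squared[of \<zeta>] by (simp add: E_def algebra_simps power2_eq_square)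

lemma E_nz: "\<zeta> \<in> closed_strip \<Longrightarrow> E \<zeta> \<noteq> 0"
  using E_inverse by fastforce

lemma F_cont: "continuous_on closed_strip (\<lambda>\<zeta>. F (exp \<zeta>))"
  unfolding F_def by (intro continuous_intros) (use L in auto)

lemma F_hol: "(\<lambda>\<zeta>. F (exp \<zeta>)) holomorphic_on open_strip"
  unfolding F_def by (intro holomorphic_intros) (use L in auto)

lemma S_cont: "continuous_on closed_strip S"
  unfolding S_def node_prod_def
  using L exp_strip(2)
  by (intro continuous_intros kappa(1) continuous_on_compose2[OF continuous_on_csqrt_upper]) auto

lemma S_hol: "S holomorphic_on open_strip"
proof -
  have im: "0 < Im (exp \<zeta>)" if "\<zeta> \<in> open_strip" for \<zeta>
    using that exp_open_strip by (auto simp: first_quadrant_def)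
  have "(\<lambda>\<zeta>. csqrt (exp \<zeta> - of_real c)) holomorphic_on open_strip" for c
  proof (rule holomorphic_on_csqrt')
    show "(\<lambda>\<zeta>. exp \<zeta> - of_real c) holomorphic_on open_strip" by (intro holomorphic_intros)
    show "exp \<zeta> - of_real c \<notin> \<real>\<^sub>\<le>\<^sub>0" if "\<zeta> \<in> open_strip" for \<zeta>
      using im[OF that] by (auto simp: complex_nonpos_Reals_iff)
  qed
  note h = this[of a] this[of 1, unfolded of_real_1]
  show ?thesis
    unfolding S_def[abs_def] node_prod_def using L
    by (intro holomorphic_on_divide holomorphic_on_mult h kappa(2) holomorphic_intros) auto
qed

text \<open>Each \<open>csqrt\<close> of a negative number contributes a factor \<open>\<i>\<close>,
  and \<open>node_prod\<close> changes sign at each interior node. So \<open>S\<close> is imaginary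
  outside \<open>[a, 1]\<close> and real inside, with a sign that alternates from piece to
  piece.\<close>

lemma S_real:
  shows "y > 0 \<Longrightarrow> y < a \<Longrightarrow> \<exists>r>0. S (of_real (ln y)) = \<i> * of_real r"
    and "y \<in> {a..1} \<Longrightarrow> \<exists>r. S (of_real (ln y)) = of_real r \<and> (\<forall>i<N. x i < y \<and> y < x (Suc i) \<longrightarrow> (-1) ^ i * r > 0)"
    and "y > 1 \<Longrightarrow> \<exists>r>0. S (of_real (ln y)) = - \<i> * of_real ((-1) ^ (N - 1) * r)"
proof -
  have S: "\<exists>\<rho>>0. S (of_real (ln y)) = - \<i> * csqrt (of_real (y - a)) * csqrt (of_real (y - 1)) * of_real (node_prod y * \<rho>)"
    if y: "y > 0" for y
  proof -
    obtain r where r: "r > 0" "kappa (of_real (ln y)) = of_real r" using kappa(4) by blast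
    have "exp (complex_of_real (ln y)) = of_real y" using y by (simp add: exp_of_real)
    hence "S (of_real (ln y)) = - \<i> * csqrt (of_real (y - a)) * csqrt (of_real (y - 1)) * of_real (node_prod y * (r / (L * y ^ j)))"
      by (simp add: S_def r(2) node_prod_of_real)
    moreover have "r / (L * y ^ j) > 0" using r L y by simp
    ultimately show ?thesis by blast
  qed
  show "\<exists>r>0. S (of_real (ln y)) = \<i> * of_real r" if y: "y > 0" "y < a"
  proof -
    obtain \<rho> where \<rho>: "\<rho> > 0" "S (of_real (ln y)) = - \<i> * csqrt (of_real (y - a)) * csqrt (of_real (y - 1)) * of_real (node_prod y * \<rho>)"
      using S[OF y(1)] by blast
    have "node_prod y > 0" unfolding node_prod_def using inner_mem y by (intro prod_pos) force
    moreover have "S (of_real (ln y)) = \<i> * of_real (sqrt (a - y) * sqrt (1 - y) * (node_prod y * \<rho>))"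
      using y a unfolding \<rho>(2) by (subst (1 2) csqrt_of_real_neg) (auto simp: algebra_simps)
    moreover have "sqrt (a - y) * sqrt (1 - y) > 0" using y a by simp
    ultimately show ?thesis using \<rho>(1) by (intro exI[of _ "sqrt (a - y) * sqrt (1 - y) * (node_prod y * \<rho>)"]) simp
  qed
  show "\<exists>r. S (of_real (ln y)) = of_real r \<and> (\<forall>i<N. x i < y \<and> y < x (Suc i) \<longrightarrow> (-1) ^ i * r > 0)"
    if y: "y \<in> {a..1}"
  proof -
    have yp: "y > 0" using y a by auto
    obtain \<rho> where \<rho>: "\<rho> > 0" "S (of_real (ln y)) = - \<i> * csqrt (of_real (y - a)) * csqrt (of_real (y - 1)) * of_real (node_prod y * \<rho>)"
      using S[OF yp] by blast
    have 1: "S (of_real (ln y)) = of_real (sqrt (y - a) * sqrt (1 - y) * (node_prod y * \<rho>))"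
      unfolding \<rho>(2) using y csqrt_of_real_pos[of "y - a"] csqrt_of_real_neg[of "y - 1"]
      by (simp add: algebra_simps)
    have 2: "(-1) ^ i * (sqrt (y - a) * sqrt (1 - y) * (node_prod y * \<rho>)) > 0"
      if i: "i < N" "x i < y" "y < x (Suc i)" for i
    proof -
      have "node_prod y = (\<Prod>l\<in>{1..i}. x l - y) * (\<Prod>l\<in>{Suc i..<N}. x l - y)"
      proof -
        have "{1..<N} = {1..i} \<union> {Suc i..<N}" using i(1) by auto
        thus ?thesis unfolding node_prod_def by (simp, intro prod.union_disjoint) auto
      qed
      also have "(\<Prod>l\<in>{1..i}. x l - y) = (-1) ^ i * (\<Prod>l\<in>{1..i}. y - x l)"
      proof -
        have "(\<Prod>l\<in>{1..i}. x l - y) = (\<Prod>l\<in>{1..i}. (-1) * (y - x l))" by simp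
        thus ?thesis unfolding prod.distrib by simp
      qed
      finally have inn: "(-1) ^ i * node_prod y = (\<Prod>l\<in>{1..i}. y - x l) * (\<Prod>l\<in>{Suc i..<N}. x l - y)"
        by (simp add: power_mult_distrib[symmetric] flip: mult.assoc)
      have "(\<Prod>l\<in>{1..i}. y - x l) > 0"
      proof (rule prod_pos)
        fix l assume "l \<in> {1..i}" thus "0 < y - x l" using x_le[of l i] i by auto
      qed
      moreover have "(\<Prod>l\<in>{Suc i..<N}. x l - y) > 0"
      proof (rule prod_pos)
        fix l assume "l \<in> {Suc i..<N}" thus "0 < x l - y" using x_le[of "Suc i" l] i by auto
      qed
      ultimately have "(-1) ^ i * node_prod y > 0" using inn by simp
      moreover have "sqrt (y - a) * sqrt (1 - y) > 0"
        using x_mem[of i] x_mem[of "Suc i"] i by auto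
      ultimately have "sqrt (y - a) * sqrt (1 - y) * ((-1) ^ i * node_prod y * \<rho>) > 0" using \<rho>(1) by simp
      thus ?thesis by (simp add: mult_ac)
    qed
    show ?thesis using 1 2 by blast
  qed
  show "\<exists>r>0. S (of_real (ln y)) = - \<i> * of_real ((-1) ^ (N - 1) * r)" if y: "y > 1"
  proof -
    have yp: "y > 0" using y by auto
    obtain \<rho> where \<rho>: "\<rho> > 0" "S (of_real (ln y)) = - \<i> * csqrt (of_real (y - a)) * csqrt (of_real (y - 1)) * of_real (node_prod y * \<rho>)"
      using S[OF yp] by blast
    have "node_prod y = (\<Prod>l\<in>{1..<N}. (-1) * (y - x l))" by (simp add: node_prod_def)
    hence i: "node_prod y = (-1) ^ (N - 1) * (\<Prod>l\<in>{1..<N}. y - x l)" unfolding prod.distrib by simp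
    have "(\<Prod>l\<in>{1..<N}. y - x l) > 0" using inner_mem y by (intro prod_pos) force
    moreover have "sqrt (y - a) * sqrt (y - 1) > 0" using y a by simp
    moreover have "S (of_real (ln y)) = - \<i> * of_real ((-1) ^ (N - 1) * (sqrt (y - a) * sqrt (y - 1) * ((\<Prod>l\<in>{1..<N}. y - x l) * \<rho>)))"
      unfolding \<rho>(2) i using y a csqrt_of_real_pos[of "y - a"] csqrt_of_real_pos[of "y - 1"]
      by (simp add: mult_ac)
    ultimately show ?thesis using \<rho>(1)
      by (intro exI[of _ "sqrt (y - a) * sqrt (y - 1) * ((\<Prod>l\<in>{1..<N}. y - x l) * \<rho>)"]) simp
  qed
qed

end

text \<open>Starlike about the point \<open>\<i> * pi / 4\<close>: a segment from there meets the
  real axis at most in its other end.\<close>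

lemma connected_strip_minus_real:
  "connected (closed_strip - of_real ` A)"
proof -
  have "closed_segment (\<i> * of_real (pi / 4)) \<zeta> \<subseteq> closed_strip - of_real ` A"
    if \<zeta>: "\<zeta> \<in> closed_strip - of_real ` A" for \<zeta>
  proof
    fix w assume "w \<in> closed_segment (\<i> * of_real (pi / 4)) \<zeta>"
    then obtain u where u: "0 \<le> u" "u \<le> 1" "w = (1 - u) *\<^sub>R (\<i> * of_real (pi / 4)) + u *\<^sub>R \<zeta>"
      by (auto simp: closed_segment_def)
    show "w \<in> closed_strip - of_real ` A"
    proof (cases "u = 1")
      case False
      have Im: "Im w = (1 - u) * (pi / 4) + u * Im \<zeta>" using u(3) by simp
      have "0 \<le> Im \<zeta>" "Im \<zeta> \<le> pi / 2" using \<zeta> by (auto simp: closed_strip_def)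
      hence "0 \<le> u * Im \<zeta>" "u * Im \<zeta> \<le> u * (pi / 2)"
        using u(1) by (simp, intro mult_left_mono)
      moreover have "0 < (1 - u) * (pi / 4)" "(1 - u) * (pi / 4) \<le> (1 - u) * (pi / 2)"
        using u False by (auto intro!: mult_left_mono)
      moreover have "(1 - u) * (pi / 2) + u * (pi / 2) = pi / 2" by (simp add: field_simps)
      ultimately have "0 < Im w" "Im w \<le> pi / 2" using Im by linarith+
      thus ?thesis by (auto simp: closed_strip_def)
    qed (use u \<zeta> in auto)
  qed
  moreover have "\<i> * of_real (pi / 4) \<in> closed_strip - of_real ` A"
    by (auto simp: closed_strip_def complex_eq_iff)
  ultimately have "starlike (closed_strip - of_real ` A)" unfolding starlike_def by blast
  thus ?thesis by (rule starlike_imp_connected)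
qed

lemma open_strip_approach:
  assumes "\<zeta> \<in> closed_strip"
  shows "(\<lambda>n. \<zeta> + of_real (1 / real (Suc n)) * (\<i> * of_real (pi / 4) - \<zeta>)) \<longlonglongrightarrow> \<zeta>"
    "\<zeta> + of_real (1 / real (Suc (Suc n))) * (\<i> * of_real (pi / 4) - \<zeta>) \<in> open_strip"
proof -
  have "(\<lambda>n. \<zeta> + of_real (1 / real (Suc n)) * (\<i> * of_real (pi / 4) - \<zeta>)) \<longlonglongrightarrow>
      \<zeta> + of_real 0 * (\<i> * of_real (pi / 4) - \<zeta>)"
    by (intro tendsto_intros LIMSEQ_Suc lim_1_over_n)
  thus "(\<lambda>n. \<zeta> + of_real (1 / real (Suc n)) * (\<i> * of_real (pi / 4) - \<zeta>)) \<longlonglongrightarrow> \<zeta>" by simp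
  define u where "u = 1 / real (Suc (Suc n))"
  have u: "0 < u" "u < 1" by (auto simp: u_def)
  have z: "0 \<le> Im \<zeta>" "Im \<zeta> \<le> pi / 2" using assms by (auto simp: closed_strip_def)
  have Im: "Im (\<zeta> + of_real u * (\<i> * of_real (pi / 4) - \<zeta>)) = (1 - u) * Im \<zeta> + u * (pi / 4)"
    by (simp add: algebra_simps)
  have "0 \<le> (1 - u) * Im \<zeta>" "(1 - u) * Im \<zeta> \<le> (1 - u) * (pi / 2)" "0 < u * (pi / 4)" "u * (pi / 4) < u * (pi / 2)"
    using u z by (auto intro!: mult_left_mono)
  moreover have "(1 - u) * (pi / 2) + u * (pi / 2) = pi / 2" by (simp add: field_simps)
  ultimately have "0 < Im (\<zeta> + of_real u * (\<i> * of_real (pi / 4) - \<zeta>))"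
    "Im (\<zeta> + of_real u * (\<i> * of_real (pi / 4) - \<zeta>)) < pi / 2"
    unfolding Im by linarith+
  thus "\<zeta> + of_real (1 / real (Suc (Suc n))) * (\<i> * of_real (pi / 4) - \<zeta>) \<in> open_strip"
    unfolding u_def open_strip_def by blast
qed

context alternation
begin

section \<open>The branch \<open>psi\<close> and its values on the real edge of the strip\<close>

definition B :: real where "B = arcosh (1 / L)"

lemma cosh_B: "cosh B = 1 / L" and B_pos: "B > 0"
proof -
  have "1 / L > 1" using L by simp
  thus "cosh B = 1 / L" "B > 0" unfolding B_def using cosh_arcosh_real[of "1 / L"] arcosh_real_gt_1_iff[of "1 / L"]
    by auto
qed

definition psi :: "complex \<Rightarrow> complex" where
  "psi = (SOME \<psi>. continuous_on closed_strip \<psi> \<and> \<psi> holomorphic_on open_strip \<and>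
    (\<forall>\<zeta>\<in>closed_strip. exp (\<i> * \<psi> \<zeta>) = E \<zeta>) \<and> \<psi> (of_real (ln a)) = 0)"

lemma E_cont: "continuous_on closed_strip E"
  unfolding E_def by (intro continuous_intros F_cont S_cont)

lemma E_hol: "E holomorphic_on open_strip"
  unfolding E_def[abs_def] by (intro holomorphic_intros F_hol S_hol)

lemma exp_ln_of_real: "y > 0 \<Longrightarrow> exp (complex_of_real (ln y)) = of_real y"
  by (simp add: exp_of_real)

lemma F_ln: "y > 0 \<Longrightarrow> F (exp (of_real (ln y))) = of_real (Fr y)"
  by (simp only: exp_ln_of_real F_of_real)

lemma E_a: "E (of_real (ln a)) = 1"
  using a Fr_a F_of_real[of a] by (simp add: E_def S_def exp_ln_of_real)

lemma psi: "continuous_on closed_strip psi" "psi holomorphic_on open_strip"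
    "\<And>\<zeta>. \<zeta> \<in> closed_strip \<Longrightarrow> exp (\<i> * psi \<zeta>) = E \<zeta>" "psi (of_real (ln a)) = 0"
proof -
  obtain g where g: "continuous_on closed_strip g" "g holomorphic_on open_strip"
    "\<And>\<zeta>. \<zeta> \<in> closed_strip \<Longrightarrow> exp (g \<zeta>) = E \<zeta>"
    using log_on_strip[OF E_cont E_hol E_nz] by metis
  define \<psi> where "\<psi> = (\<lambda>\<zeta>. - \<i> * (g \<zeta> - g (of_real (ln a))))"
  have "continuous_on closed_strip \<psi>" unfolding \<psi>_def by (intro continuous_intros g)
  moreover have "\<psi> holomorphic_on open_strip" unfolding \<psi>_def by (intro holomorphic_intros g)
  moreover have "exp (\<i> * \<psi> \<zeta>) = E \<zeta>" if "\<zeta> \<in> closed_strip" for \<zeta>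
  proof -
    have "\<i> * \<psi> \<zeta> = g \<zeta> - g (of_real (ln a))" by (simp add: \<psi>_def)
    moreover have "exp (g (of_real (ln a))) = 1" using g(3)[of "of_real (ln a)"] E_a by simp
    ultimately show ?thesis using g(3)[OF that] by (simp add: exp_diff)
  qed
  moreover have "\<psi> (of_real (ln a)) = 0" by (simp add: \<psi>_def)
  ultimately have "\<exists>\<psi>. continuous_on closed_strip \<psi> \<and> \<psi> holomorphic_on open_strip \<and>
    (\<forall>\<zeta>\<in>closed_strip. exp (\<i> * \<psi> \<zeta>) = E \<zeta>) \<and> \<psi> (of_real (ln a)) = 0" by blast
  from someI_ex[OF this, folded psi_def] show "continuous_on closed_strip psi" "psi holomorphic_on open_strip"
    "\<And>\<zeta>. \<zeta> \<in> closed_strip \<Longrightarrow> exp (\<i> * psi \<zeta>) = E \<zeta>" "psi (of_real (ln a)) = 0" by blast+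
qed

lemma cos_psi: "\<zeta> \<in> closed_strip \<Longrightarrow> cos (psi \<zeta>) = F (exp \<zeta>)"
  and sin_psi: "\<zeta> \<in> closed_strip \<Longrightarrow> sin (psi \<zeta>) = S \<zeta>"
proof -
  assume \<zeta>: "\<zeta> \<in> closed_strip"
  have 1: "exp (\<i> * psi \<zeta>) = F (exp \<zeta>) + \<i> * S \<zeta>" using psi(3)[OF \<zeta>] by (simp add: E_def)
  have "exp (\<i> * psi \<zeta>) * exp (- (\<i> * psi \<zeta>)) = E \<zeta> * (F (exp \<zeta>) - \<i> * S \<zeta>)"
    using E_inverse[OF \<zeta>] by (simp flip: exp_add)
  hence 2: "exp (- (\<i> * psi \<zeta>)) = F (exp \<zeta>) - \<i> * S \<zeta>"
    using psi(3)[OF \<zeta>] E_nz[OF \<zeta>] by simp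
  show "cos (psi \<zeta>) = F (exp \<zeta>)" "sin (psi \<zeta>) = S \<zeta>"
    using 1 2 by (simp_all add: cos_exp_eq sin_exp_eq)
qed

lemma norm_E: "\<zeta> \<in> closed_strip \<Longrightarrow> norm (E \<zeta>) = exp (- Im (psi \<zeta>))"
  by (subst psi(3)[symmetric]) auto

text \<open>\<open>|E| = 1\<close> means that \<open>psi\<close> is real, so that \<open>F\<close>
  takes a value in \<open>[-1, 1]\<close>; by \<open>F_avoids\<close> this happens only over
  \<open>[a, 1]\<close>. The rest of the strip is connected, so one point with
  \<open>|E| < 1\<close> decides.\<close>

lemma norm_E_less_1:
  assumes "\<zeta> \<in> closed_strip - of_real ` {ln a..0}"
  shows "norm (E \<zeta>) < 1"
proof (rule ccontr)
  assume neg: "\<not> norm (E \<zeta>) < 1"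
  define X where "X = closed_strip - complex_of_real ` {ln a..0}"
  have "connected ((\<lambda>\<zeta>. norm (E \<zeta>)) ` X)"
    unfolding X_def
    by (intro connected_continuous_image connected_strip_minus_real continuous_intros
        continuous_on_subset[OF E_cont]) auto
  moreover have "norm (E \<zeta>) \<in> (\<lambda>\<zeta>. norm (E \<zeta>)) ` X" using assms by (auto simp: X_def)
  \<comment> \<open>The test point lies over \<open>a / 2\<close>, where
    \<open>E * (Fr + r) = 1\<close> with \<open>Fr > 1\<close> and \<open>r > 0\<close>.\<close>
  moreover define \<zeta>0 where "\<zeta>0 = complex_of_real (ln (a / 2))"
  have "ln (a / 2) < ln a" using a by simp
  hence "\<zeta>0 \<in> X" by (auto simp: X_def \<zeta>0_def)
  hence "norm (E \<zeta>0) \<in> (\<lambda>\<zeta>. norm (E \<zeta>)) ` X" by auto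
  moreover have "norm (E \<zeta>0) < 1"
  proof -
    obtain r where r: "r > 0" "S \<zeta>0 = \<i> * of_real r" using S_real(1)[of "a / 2"] a by (auto simp: \<zeta>0_def)
    have F: "F (exp \<zeta>0) = of_real (Fr (a / 2))" using F_ln[of "a / 2"] a by (simp add: \<zeta>0_def)
    have "Fr (a / 2) > 1" using Fr_gt_1[of "a / 2"] a by simp
    hence w: "Fr (a / 2) + r > 1" using r by simp
    have "E \<zeta>0 * (F (exp \<zeta>0) - \<i> * S \<zeta>0) = 1" by (rule E_inverse) (simp add: \<zeta>0_def)
    hence "E \<zeta>0 * of_real (Fr (a / 2) + r) = 1" by (simp add: F r)
    hence "norm (E \<zeta>0) * norm (of_real (Fr (a / 2) + r) :: complex) = 1" by (metis norm_mult norm_one)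
    hence "norm (E \<zeta>0) * (Fr (a / 2) + r) = 1" using w by (simp only: norm_of_real)
    hence "norm (E \<zeta>0) = 1 / (Fr (a / 2) + r)" using w by (simp add: field_simps)
    thus ?thesis using w by simp
  qed
  ultimately have "1 \<in> (\<lambda>\<zeta>. norm (E \<zeta>)) ` X"
    using neg connected_contains_Icc[of "(\<lambda>\<zeta>. norm (E \<zeta>)) ` X" "norm (E \<zeta>0)" "norm (E \<zeta>)"] by auto
  then obtain \<xi> where \<xi>: "\<xi> \<in> X" "norm (E \<xi>) = 1" by auto
  hence cs: "\<xi> \<in> closed_strip" by (simp add: X_def)
  have "Im (psi \<xi>) = 0" using norm_E[OF cs] \<xi>(2) by simp
  hence "psi \<xi> = of_real (Re (psi \<xi>))" by (simp add: complex_eq_iff)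
  hence "cos (psi \<xi>) = of_real (cos (Re (psi \<xi>)))" by (metis cos_of_real)
  hence "F (exp \<xi>) = of_real (cos (Re (psi \<xi>)))" using cos_psi[OF cs] by simp
  then obtain y where y: "y \<in> {a..1}" "exp \<xi> = of_real y"
    using F_avoids[of "exp \<xi>"] exp_strip[OF cs] by force
  hence "\<xi> = of_real (ln y)" using exp_strip_real[OF cs] by blast
  moreover have "ln y \<in> {ln a..0}" using y a by auto
  ultimately show False using \<xi>(1) by (auto simp: X_def)
qed

lemma Im_psi_pos: "\<zeta> \<in> closed_strip - of_real ` {ln a..0} \<Longrightarrow> 0 < Im (psi \<zeta>)"
  using norm_E_less_1[of \<zeta>] norm_E[of \<zeta>] by simp

text \<open>In the variable \<open>y = exp \<zeta>\<close> this is 0 up to \<open>a\<close>, runs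
  from 0 to \<open>N * pi\<close> on \<open>[a, 1]\<close>, and stays there afterwards.\<close>

definition U :: "real \<Rightarrow> real" where "U y = Re (psi (of_real (ln y)))"

lemma U_cont: "continuous_on {0<..} U"
  unfolding U_def by (intro continuous_intros continuous_on_compose2[OF psi(1)]) auto

lemma psi_ln_mid: "y \<in> {a..1} \<Longrightarrow> psi (of_real (ln y)) = of_real (U y)"
proof -
  assume y: "y \<in> {a..1}"
  hence y0: "y > 0" using a by auto
  obtain r where r: "S (of_real (ln y)) = of_real r" using S_real(2)[OF y] by blast
  have "(of_real r)\<^sup>2 = 1 - (of_real (Fr y) :: complex)\<^sup>2"
    using S_squared[of "of_real (ln y)"] r by (simp add: F_ln y0)
  hence "complex_of_real (r\<^sup>2) = of_real (1 - (Fr y)\<^sup>2)" by simp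
  hence e: "(Fr y)\<^sup>2 + r\<^sup>2 = 1" by (simp only: of_real_eq_iff)
  have "E (of_real (ln y)) = Complex (Fr y) r" by (simp add: E_def F_ln y0 r complex_eq_iff)
  hence "norm (E (of_real (ln y))) = 1" using e by (simp add: complex_norm)
  hence "Im (psi (of_real (ln y))) = 0" using norm_E[of "of_real (ln y)"] by simp
  thus ?thesis by (simp add: U_def complex_eq_iff)
qed

lemma U_trig: "y \<in> {a..1} \<Longrightarrow> cos (U y) = Fr y" "y \<in> {a..1} \<Longrightarrow> S (of_real (ln y)) = of_real (sin (U y))"
proof -
  assume y: "y \<in> {a..1}"
  have "of_real (cos (U y)) = cos (psi (of_real (ln y)))" by (simp only: psi_ln_mid[OF y] cos_of_real)
  also have "\<dots> = of_real (Fr y)" using cos_psi[of "of_real (ln y)"] F_ln[of y] y a by simp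
  finally show "cos (U y) = Fr y" by (simp only: of_real_eq_iff)
  show "S (of_real (ln y)) = of_real (sin (U y))"
    by (metis of_real_in_closed_strip psi_ln_mid[OF y] sin_of_real sin_psi)
qed

text \<open>Between two nodes the sign of \<open>S\<close> makes \<open>sin (U - i * pi)\<close>
  positive, with \<open>i\<close> the index, so this difference cannot leave \<open>[0, pi]\<close>;
  at the next node its cosine is -1, so it equals \<open>pi\<close> there.\<close>

lemma U_piece:
  assumes "i < N" "U (x i) = real i * pi"
  shows "y \<in> {x i..x (Suc i)} \<Longrightarrow> real i * pi \<le> U y \<and> U y \<le> real (Suc i) * pi"
    and "U (x (Suc i)) = real (Suc i) * pi"
proof -
  define v where "v = (\<lambda>y. U y - real i * pi)"
  have sub: "{x i..x (Suc i)} \<subseteq> {a..1}" using x_mem[of i] x_mem[of "Suc i"] assms by auto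
  have sin_v: "sin (v y) = (-1) ^ i * sin (U y)" and cos_v: "cos (v y) = (-1) ^ i * cos (U y)" for y
    by (simp_all add: v_def sin_diff cos_diff mult.commute)
  have *: "0 \<le> v y \<and> v y \<le> pi" if "y \<in> {x i..x (Suc i)}" for y
  proof (rule sin_pos_stays_in_0_pi[of "x i" "x (Suc i)" v y])
    show "continuous_on {x i..x (Suc i)} v"
      unfolding v_def using x_pos[of i] assms(1) by (intro continuous_intros continuous_on_subset[OF U_cont]) auto
    show "v (x i) = 0" using assms(2) by (simp add: v_def)
    fix t assume t: "x i < t" "t < x (Suc i)"
    hence ta: "t \<in> {a..1}" using sub by auto
    obtain r where "S (of_real (ln t)) = of_real r" "(-1) ^ i * r > 0"
      using S_real(2)[OF ta] assms(1) t by blast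
    thus "0 < sin (v t)" using U_trig(2)[OF ta] sin_v[of t] by simp
  qed (use that in auto)
  show "y \<in> {x i..x (Suc i)} \<Longrightarrow> real i * pi \<le> U y \<and> U y \<le> real (Suc i) * pi"
    using *[of y] by (auto simp: v_def algebra_simps)
  have m: "x (Suc i) \<in> {x i..x (Suc i)}" using mono[OF assms(1)] by simp
  have "cos (v (x (Suc i))) = (-1) ^ i * (-1) ^ Suc i"
    using cos_v U_trig(1)[of "x (Suc i)"] Fr_node[of "Suc i"] sub m assms(1) by auto
  also have "\<dots> = cos pi" by (simp add: power_mult_distrib[symmetric])
  finally have "v (x (Suc i)) = pi"
    using *[OF m] cos_inj_pi[of "v (x (Suc i))" pi] by auto
  thus "U (x (Suc i)) = real (Suc i) * pi" by (simp add: v_def algebra_simps)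
qed

lemma U_x: "i \<le> N \<Longrightarrow> U (x i) = real i * pi"
proof (induction i)
  case 0
  thus ?case using psi(4) by (simp add: U_def x_0)
next
  case (Suc i)
  thus ?case using U_piece(2)[of i] by simp
qed

lemma U_bounds: "i < N \<Longrightarrow> y \<in> {x i..x (Suc i)} \<Longrightarrow> real i * pi \<le> U y \<and> U y \<le> real (Suc i) * pi"
  using U_piece(1) U_x by simp

lemma e_inj: "i < N \<Longrightarrow> inj_on e {x i..x (Suc i)}"
proof -
  assume i: "i < N"
  have "e y \<noteq> e z" if yz: "y < z" "y \<in> {x i..x (Suc i)}" "z \<in> {x i..x (Suc i)}" for y z
  proof
    assume eq: "e y = e z"
    have "\<exists>w. y < w \<and> w < z \<and> e z - e y = (z - y) * - (poly Q (w\<^sup>2) / w ^ Suc j)"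
    proof (rule MVT2[OF yz(1)])
      fix t assume "y \<le> t" "t \<le> z"
      thus "(e has_real_derivative - (poly Q (t\<^sup>2) / t ^ Suc j)) (at t)"
        using yz x_pos[of i] i by (intro e_deriv) auto
    qed
    then obtain w where w: "y < w" "w < z" "e z - e y = (z - y) * - (poly Q (w\<^sup>2) / w ^ Suc j)" by blast
    have wi: "x i < w" "w < x (Suc i)" "w > 0" using w yz x_pos[of i] i by auto
    hence "poly Q (w\<^sup>2) = 0" using w(3) eq yz(1) by simp
    then obtain l where "l \<in> {1..<N}" "w = x l" using Q_root_iff[OF wi(3)] by auto
    moreover have "i < l" if "x i < x l" "l \<le> N" for l using x_le[of l i] that i by (meson leI not_le less_imp_le)
    moreover have "l < Suc i" if "x l < x (Suc i)" "l \<le> N" for l using x_le[of "Suc i" l] that i by (meson leI not_le)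
    ultimately show False using wi by force
  qed
  thus ?thesis unfolding inj_on_def by (metis linorder_neqE_linordered_idom)
qed

text \<open>\<open>Fr\<close> is monotone on a piece, being injective there and extremal at the left
  end. Cosine is monotone on the interval of length \<open>pi\<close> that contains
  \<open>U\<close>, so the monotonicity passes to \<open>U\<close>.\<close>

lemma U_mono_piece:
  assumes i: "i < N" and yz: "y \<in> {x i..x (Suc i)}" "z \<in> {x i..x (Suc i)}" "y \<le> z"
  shows "U y \<le> U z"
proof -
  define f where "f = (\<lambda>y. (-1) ^ i * Fr y)"
  have sub: "{x i..x (Suc i)} \<subseteq> {a..1}" using x_mem[of i] x_mem[of "Suc i"] i by auto
  have fz: "f z \<le> f y"
  proof (rule ccontr)
    assume "\<not> f z \<le> f y"
    hence lt: "f y < f z" by simp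
    hence "y < z" using yz(3) by (cases "y = z") auto
    have "f (x i) = 1" using Fr_node[of i] i by (simp add: f_def power_mult_distrib[symmetric])
    moreover have "f z \<le> 1" using Fr_bound[of z] sub yz by (auto simp: f_def minus_one_power_iff)
    ultimately have "\<exists>t\<ge>x i. t \<le> y \<and> f t = f z"
      using lt yz x_pos[of i] i unfolding f_def by (intro IVT2' continuous_intros Fr_cont) auto
    then obtain t where t: "x i \<le> t" "t \<le> y" "f t = f z" by blast
    hence "e t = e z" using L by (simp add: f_def Fr_def)
    hence "t = z" using e_inj[OF i] t yz by (auto simp: inj_on_def)
    thus False using t \<open>y < z\<close> by simp
  qed
  have c: "cos (U t - real i * pi) = f t" if "t \<in> {x i..x (Suc i)}" for t
    using U_trig(1)[of t] sub that by (auto simp: f_def cos_diff mult.commute)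
  have "cos (U z - real i * pi) \<le> cos (U y - real i * pi)" using fz c yz by simp
  thus ?thesis using U_bounds[OF i yz(1)] U_bounds[OF i yz(2)]
    by (subst (asm) cos_mono_le_eq) (auto simp: algebra_simps)
qed

lemma piece_exists: "y \<in> {a..1} \<Longrightarrow> \<exists>i<N. y \<in> {x i..x (Suc i)}"
proof -
  have "y \<in> {x 0..x n} \<Longrightarrow> 0 < n \<Longrightarrow> \<exists>i<n. y \<in> {x i..x (Suc i)}" for n
  proof (induction n)
    case (Suc n)
    show ?case
    proof (cases "y \<le> x n \<and> 0 < n")
      case True thus ?thesis using Suc by (auto intro: less_SucI)
    next
      case False
      thus ?thesis using Suc.prems by (cases "n = 0") auto
    qed
  qed simp
  thus "y \<in> {a..1} \<Longrightarrow> \<exists>i<N. y \<in> {x i..x (Suc i)}" using N2 x_0 x_N by auto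
qed

text \<open>Where \<open>E\<close> is real of constant sign, its argument \<open>Re psi\<close> is
  locally constant. For the sign -1 the constant \<open>c = pi\<close> is subtracted first.\<close>

lemma E_lattice:
  assumes cont: "continuous_on I (\<lambda>y::real. psi (of_real (ln y)))" and conn: "connected I"
    and s: "s = 1 \<or> s = -1" and E: "\<And>y. y \<in> I \<Longrightarrow> \<exists>r>0. E (of_real (ln y)) = of_real (s * r)"
    and yz: "y \<in> I" "z \<in> I"
  shows "U y = U z"
proof -
  define c where "c = (if s = 1 then 0 else pi)"
  have cis: "exp (- (\<i> * of_real c)) = of_real s" using s by (auto simp: c_def exp_minus)
  have "Im ((\<lambda>y. \<i> * psi (of_real (ln y)) - \<i> * of_real c) y) = Im ((\<lambda>y. \<i> * psi (of_real (ln y)) - \<i> * of_real c) z)"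
  proof (rule positive_exp_imp_constant_Im[OF _ conn _ yz])
    show "continuous_on I (\<lambda>y. \<i> * psi (of_real (ln y)) - \<i> * of_real c)"
      by (intro continuous_intros cont)
    fix y assume "y \<in> I"
    then obtain r where r: "r > 0" "E (of_real (ln y)) = of_real (s * r)" using E by blast
    have "exp (\<i> * psi (of_real (ln y)) - \<i> * of_real c) =
        exp (\<i> * psi (of_real (ln y)) + - (\<i> * of_real c))" by simp
    also have "\<dots> = E (of_real (ln y)) * of_real s"
      unfolding exp_add using psi(3)[of "of_real (ln y)"] by (simp only: cis of_real_in_closed_strip)
    also have "\<dots> = of_real (s * s * r)" using r by simp
    also have "s * s * r = r" using s by auto
    finally show "\<exists>r>0. exp (\<i> * psi (of_real (ln y)) - \<i> * of_real c) = of_real r" using r(1) by blast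
  qed
  thus ?thesis by (simp add: U_def)
qed

lemma U_left: "0 < y \<Longrightarrow> y \<le> a \<Longrightarrow> U y = 0"
proof -
  assume y: "0 < y" "y \<le> a"
  have "U y = U a"
  proof (rule E_lattice[where s = 1 and I = "{0<..a}"])
    show "continuous_on {0<..a} (\<lambda>y. psi (of_real (ln y)))"
      by (intro continuous_on_compose2[OF psi(1)] continuous_intros) auto
    fix y assume yy: "y \<in> {0<..a}"
    show "\<exists>r>0. E (of_real (ln y)) = of_real (1 * r)"
    proof (cases "y = a")
      case True thus ?thesis using E_a by (intro exI[of _ 1]) simp
    next
      case False
      hence y': "0 < y" "y < a" using yy by auto
      obtain r where r: "r > 0" "S (of_real (ln y)) = \<i> * of_real r" using S_real(1)[OF y'] by blast
      have w: "Fr y + r > 0" using Fr_gt_1[OF y'] r by simp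
      have E: "E (of_real (ln y)) = of_real (Fr y - r)" using F_ln[OF y'(1)] r by (simp add: E_def)
      have "E (of_real (ln y)) * (F (exp (of_real (ln y))) - \<i> * S (of_real (ln y))) = 1"
        by (rule E_inverse) simp
      hence "complex_of_real ((Fr y - r) * (Fr y + r)) = of_real 1" using E F_ln[OF y'(1)] r by simp
      hence "(Fr y - r) * (Fr y + r) = 1" by (simp only: of_real_eq_iff)
      \<comment> \<open>\<open>E = Fr - r\<close> is positive because its reciprocal
        \<open>Fr + r\<close> is.\<close>
      hence "Fr y - r > 0" using w by (metis zero_less_mult_pos2 zero_less_one)
      thus ?thesis using E by (intro exI[of _ "Fr y - r"]) simp
    qed
  qed (use y in auto)
  thus ?thesis using U_x[of 0] by (simp add: x_0)
qed

lemma U_right: "1 \<le> y \<Longrightarrow> U y = real N * pi"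
proof -
  assume y: "1 \<le> y"
  have sN: "(-1) ^ N * (-1) ^ N = (1::real)" by (simp add: power_mult_distrib[symmetric])
  have sN1: "(-1) ^ (N - 1) = - ((-1) ^ N :: real)" using N2 by (cases N) auto
  have "U y = U 1"
  proof (rule E_lattice[where s = "(-1) ^ N" and I = "{1..}"])
    show "continuous_on {1..} (\<lambda>y. psi (of_real (ln y)))"
      by (intro continuous_on_compose2[OF psi(1)] continuous_intros) auto
    show "(-1) ^ N = (1::real) \<or> (-1) ^ N = (-1::real)" by (cases "even N") auto
    fix y :: real assume yy: "y \<in> {1..}"
    show "\<exists>r>0. E (of_real (ln y)) = of_real ((-1) ^ N * r)"
    proof (cases "y = 1")
      case True
      have "Fr 1 = (-1) ^ N" using Fr_node[of N] by (simp add: x_N)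
      hence "E (of_real (ln 1)) = of_real ((-1) ^ N)" using F_ln[of 1] by (simp add: E_def S_def)
      thus ?thesis using True by (intro exI[of _ 1]) simp
    next
      case False
      hence y': "1 < y" "0 < y" using yy by auto
      obtain r where r: "r > 0" "S (of_real (ln y)) = - \<i> * of_real ((-1) ^ (N - 1) * r)" using S_real(3)[OF y'(1)] by blast
      define f where "f = (-1) ^ N * Fr y"
      have Fr: "Fr y = (-1) ^ N * f" using sN by (simp add: f_def flip: mult.assoc)
      have f: "f > 1" using Fr_right[OF y'(1)] by (simp add: f_def)
      have w: "f + r > 0" using f r by simp
      have "\<i> * S (of_real (ln y)) = of_real ((-1) ^ (N - 1) * r)" using r(2) by simp
      also have "(-1) ^ (N - 1) * r = - ((-1) ^ N * r)" using sN1 by simp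
      finally have iS: "\<i> * S (of_real (ln y)) = of_real (- ((-1) ^ N * r))" .
      have E: "E (of_real (ln y)) = of_real ((-1) ^ N * (f - r))"
        unfolding E_def iS F_ln[OF y'(2)] Fr by (simp only: of_real_add[symmetric]) (simp add: algebra_simps)
      have "E (of_real (ln y)) * (F (exp (of_real (ln y))) - \<i> * S (of_real (ln y))) = 1"
        by (rule E_inverse) simp
      hence "complex_of_real (((-1) ^ N * (f - r)) * ((-1) ^ N * f - (- ((-1) ^ N * r)))) = of_real 1"
        unfolding E iS F_ln[OF y'(2)] Fr by simp
      hence "((-1) ^ N * (f - r)) * ((-1) ^ N * f - (- ((-1) ^ N * r))) = 1" by (simp only: of_real_eq_iff)
      moreover have "(s * (f - r)) * (s * f - (- (s * r))) = (s * s) * ((f - r) * (f + r))" for s :: real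
        by (simp add: algebra_simps)
      ultimately have "(f - r) * (f + r) = 1" using sN by (metis mult_1)
      hence "f - r > 0" using w by (metis zero_less_mult_pos2 zero_less_one)
      thus ?thesis using E by (intro exI[of _ "f - r"]) simp
    qed
  qed (use y in auto)
  thus ?thesis using U_x[of N] by (simp add: x_N)
qed

lemma U_range: "y > 0 \<Longrightarrow> 0 \<le> U y \<and> U y \<le> real N * pi"
proof -
  assume y: "y > 0"
  consider "y \<le> a" | "y \<in> {a..1}" | "1 \<le> y" by force
  thus ?thesis
  proof cases
    case 2
    then obtain i where i: "i < N" "y \<in> {x i..x (Suc i)}" using piece_exists by blast
    have "real i * pi \<ge> 0" "real (Suc i) * pi \<le> real N * pi" using i(1) by (auto intro!: mult_right_mono)
    thus ?thesis using U_bounds[OF i] by linarith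
  qed (use U_left U_right y in auto)
qed

lemma U_mono: "0 < y \<Longrightarrow> y \<le> z \<Longrightarrow> U y \<le> U z"
proof -
  assume yz: "0 < y" "y \<le> z"
  consider "y \<le> a" | "1 \<le> z" | "y \<in> {a..1}" "z \<in> {a..1}" using yz by force
  thus ?thesis
  proof cases
    case 1 thus ?thesis using U_left U_range yz by auto
  next
    case 2 thus ?thesis using U_right U_range yz by auto
  next
    case 3
    obtain i where i: "i < N" "y \<in> {x i..x (Suc i)}" using piece_exists 3 by blast
    obtain l where l: "l < N" "z \<in> {x l..x (Suc l)}" using piece_exists 3 by blast
    consider "i = l" | "Suc i \<le> l" | "Suc l \<le> i" by linarith
    thus ?thesis
    proof cases
      case 1 thus ?thesis using U_mono_piece i l yz by blast
    next
      case 2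
      hence "real (Suc i) * pi \<le> real l * pi" by (intro mult_right_mono) auto
      thus ?thesis using U_bounds[OF i] U_bounds[OF l] by linarith
    next
      case 3
      hence "x (Suc l) \<le> x i" using i by (intro x_le) auto
      hence "y = z" using i l yz by auto
      thus ?thesis by simp
    qed
  qed
qed

text \<open>Outside \<open>[a, 1]\<close> the values of \<open>psi\<close> are not real; inside,
  \<open>Fr\<close> is 1 or -1 at nodes only, where \<open>U\<close> is known. The first equivalence
  fixes the dilation in \<open>quadrant_map_eq\<close>, the second computes
  \<open>a_of_B\<close>.\<close>

lemma psi_eq_end_iff: "y > 0 \<Longrightarrow> psi (of_real (ln y)) = of_real (real N * pi) \<longleftrightarrow> y = 1"
  and psi_eq_0_iff: "y > 0 \<Longrightarrow> psi (of_real (ln y)) = 0 \<longleftrightarrow> y = a"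
proof -
  assume y: "y > 0"
  have out: "0 < Im (psi (of_real (ln y)))" if "y < a \<or> 1 < y"
    using that y a by (intro Im_psi_pos) auto
  have node: "\<exists>i\<le>N. y = x i" if "\<bar>Fr y\<bar> = 1" "y \<in> {a..1}"
  proof (cases "y \<in> x ` {1..<N}")
    case False
    hence "y = a \<or> y = 1" using Fr_inside[of y] that by auto
    thus ?thesis using x_0 x_N by (metis le0 order_refl)
  next
    case True
    then obtain l where "l \<in> {1..<N}" "y = x l" by blast
    thus ?thesis by (intro exI[of _ l]) auto
  qed
  show "psi (of_real (ln y)) = of_real (real N * pi) \<longleftrightarrow> y = 1"
  proof
    assume *: "psi (of_real (ln y)) = of_real (real N * pi)"
    hence m: "y \<in> {a..1}" using out by force
    have U: "U y = real N * pi" using * by (simp add: U_def)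
    hence "Fr y = cos (real N * pi)" using U_trig(1)[OF m] by simp
    hence "\<bar>Fr y\<bar> = 1" by (simp add: power_abs)
    then obtain i where "i \<le> N" "y = x i" using node m by blast
    thus "y = 1" using U U_x[of i] x_N by auto
  next
    assume "y = 1"
    thus "psi (of_real (ln y)) = of_real (real N * pi)" using psi_ln_mid[of 1] U_right[of 1] a by simp
  qed
  show "psi (of_real (ln y)) = 0 \<longleftrightarrow> y = a"
  proof
    assume *: "psi (of_real (ln y)) = 0"
    hence m: "y \<in> {a..1}" using out by force
    have U: "U y = 0" using * by (simp add: U_def)
    hence "Fr y = 1" using U_trig(1)[OF m] by simp
    then obtain i where "i \<le> N" "y = x i" using node m by auto
    thus "y = a" using U U_x[of i] x_0 by auto
  qed (use psi(4) in simp)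
qed

end

subsection \<open>Asymptotics and injectivity\<close>

lemma Re_cos_cosh: "Re (cos z) = cos (Re z) * cosh (Im z)"
  and Im_cos_sinh: "Im (cos z) = - (sin (Re z) * sinh (Im z))"
  by (simp_all add: Re_cos Im_cos cosh_field_def sinh_field_def field_simps)

context alternation
begin

text \<open>The order of growth of \<open>F\<close> at infinity, just as \<open>j\<close> is the
  order of its pole at 0.\<close>

definition n :: nat where "n = 2 * N - 2 - j"

lemma n_pos: "n > 0" and n_j: "j + n = 2 * N - 2" and n_eq: "real n = 2 * real N - 2 - real j"
  using j_less by (auto simp: n_def of_nat_diff)

lemma j_eq: "real j = 2 * real k - 1"
  using k by (simp add: j of_nat_diff)

lemma Im_psi_nonneg: "\<zeta> \<in> closed_strip \<Longrightarrow> 0 \<le> Im (psi \<zeta>)"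
proof (cases "\<zeta> \<in> of_real ` {ln a..0}")
  case True
  then obtain t where t: "t \<in> {ln a..0}" "\<zeta> = of_real t" by blast
  have "exp (ln a) \<le> exp t" "exp t \<le> exp 0" using t(1) by (auto simp del: exp_ln)
  hence "exp t \<in> {a..1}" using a by simp
  thus ?thesis using psi_ln_mid[of "exp t"] t(2) by simp
next
  case False
  assume "\<zeta> \<in> closed_strip"
  thus ?thesis using Im_psi_pos[of \<zeta>] False by auto
qed

lemma norm_E_le_1: "\<zeta> \<in> closed_strip \<Longrightarrow> norm (E \<zeta>) \<le> 1"
  using norm_E Im_psi_nonneg by simp

lemma eventually_closed_strip: "eventually (\<lambda>\<zeta>. \<zeta> \<in> closed_strip) (strip_end s)"
  by (auto simp: eventually_strip_end)

lemma E_quadratic: "\<zeta> \<in> closed_strip \<Longrightarrow> E \<zeta> * (2 * F (exp \<zeta>) - E \<zeta>) = 1"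
  using E_inverse[of \<zeta>] by (simp add: E_def algebra_simps)

text \<open>A fixed-point equation: as \<open>|E| \<le> 1\<close> and \<open>F\<close> tends to
  infinity at the ends, \<open>E\<close> is asymptotically \<open>1 / (2 * F)\<close>.\<close>

lemma E_formula: "\<zeta> \<in> closed_strip \<Longrightarrow> 2 * F (exp \<zeta>) - E \<zeta> \<noteq> 0"
    "\<zeta> \<in> closed_strip \<Longrightarrow> E \<zeta> = 1 / (2 * F (exp \<zeta>) - E \<zeta>)"
proof -
  assume "\<zeta> \<in> closed_strip"
  hence e: "E \<zeta> * (2 * F (exp \<zeta>) - E \<zeta>) = 1" by (rule E_quadratic)
  thus nz: "2 * F (exp \<zeta>) - E \<zeta> \<noteq> 0" by (intro notI) simp
  show "E \<zeta> = 1 / (2 * F (exp \<zeta>) - E \<zeta>)" using e nz nonzero_eq_divide_eq by blast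
qed

lemma E_times_null:
  assumes "(f \<longlongrightarrow> 0) (strip_end s)"
  shows "((\<lambda>\<zeta>. E \<zeta> * f \<zeta>) \<longlongrightarrow> 0) (strip_end s)"
proof (rule Lim_null_comparison)
  show "((\<lambda>\<zeta>. norm (f \<zeta>)) \<longlongrightarrow> 0) (strip_end s)" using assms by (rule tendsto_norm_zero)
  show "eventually (\<lambda>\<zeta>. norm (E \<zeta> * f \<zeta>) \<le> norm (f \<zeta>)) (strip_end s)"
    using eventually_closed_strip
    by eventually_elim (simp add: norm_mult mult_left_le_one_le norm_E_le_1)
qed

definition c0 :: real where "c0 = - p0 / L"
definition c1 :: real where "c1 = p1 / L"

lemma c0_pos: "c0 > 0" and c1_pos: "c1 > 0"
  using p0_neg p1_pos L by (auto simp: c0_def c1_def divide_neg_pos)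

lemma exp_tendsto_left: "((\<lambda>\<zeta>::complex. exp \<zeta> ^ j) \<longlongrightarrow> 0) (strip_end (-1))"
proof -
  have "(exp \<longlongrightarrow> (0::complex)) (strip_end (-1))"
    using tendsto_exp_strip_end_left by (simp add: filterlim_at)
  from tendsto_power[OF this, of j] show ?thesis by (simp only: zero_power[OF j_pos])
qed

lemma F_left: "((\<lambda>\<zeta>. F (exp \<zeta>) * exp \<zeta> ^ j) \<longlongrightarrow> of_real c0) (strip_end (-1))"
proof -
  have e: "(exp \<longlongrightarrow> (0::complex)) (strip_end (-1))"
    using tendsto_exp_strip_end_left by (simp add: filterlim_at)
  have "((\<lambda>\<zeta>. (-1) ^ k / of_real L * (exp \<zeta> ^ j - poly (cpoly P) ((exp \<zeta>)\<^sup>2))) \<longlongrightarrow>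
      (-1) ^ k / of_real L * (0 - poly (cpoly P) (0\<^sup>2))) (strip_end (-1))"
    by (intro tendsto_intros exp_tendsto_left e)
  moreover have "(-1) ^ k / of_real L * (0 - poly (cpoly P) (0\<^sup>2)) = complex_of_real c0"
    using poly_cpoly_of_real[of P 0] by (simp add: c0_def p0_def)
  moreover have "(-1) ^ k / of_real L * (z ^ j - poly (cpoly P) (z\<^sup>2)) = F z * z ^ j" if "z \<noteq> 0" for z
  proof -
    have "(1 - poly (cpoly P) (z\<^sup>2) / z ^ j) * z ^ j = z ^ j - poly (cpoly P) (z\<^sup>2)"
      using that by (simp add: field_simps)
    thus ?thesis by (simp only: F_def mult.assoc)
  qed
  ultimately show ?thesis by simp
qed

lemma E_left: "((\<lambda>\<zeta>. E \<zeta> / exp \<zeta> ^ j) \<longlongrightarrow> of_real (1 / (2 * c0))) (strip_end (-1))"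
proof -
  have "((\<lambda>\<zeta>. 1 / (2 * (F (exp \<zeta>) * exp \<zeta> ^ j) - E \<zeta> * exp \<zeta> ^ j)) \<longlongrightarrow> 1 / (2 * of_real c0 - 0)) (strip_end (-1))"
    using c0_pos by (intro tendsto_intros F_left E_times_null exp_tendsto_left) auto
  moreover have "eventually (\<lambda>\<zeta>. 1 / (2 * (F (exp \<zeta>) * exp \<zeta> ^ j) - E \<zeta> * exp \<zeta> ^ j) = E \<zeta> / exp \<zeta> ^ j) (strip_end (-1))"
    using eventually_closed_strip
  proof eventually_elim
    case (elim \<zeta>)
    define z where "z = exp \<zeta> ^ j"
    have "z \<noteq> 0" by (simp add: z_def)
    moreover have "2 * F (exp \<zeta>) - E \<zeta> \<noteq> 0" "E \<zeta> = 1 / (2 * F (exp \<zeta>) - E \<zeta>)"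
      by (rule E_formula[OF elim])+
    moreover have "2 * (F (exp \<zeta>) * z) - E \<zeta> * z = (2 * F (exp \<zeta>) - E \<zeta>) * z" by (simp add: algebra_simps)
    ultimately show ?case unfolding z_def[symmetric] by (metis divide_divide_eq_left)
  qed
  ultimately show ?thesis by (simp add: tendsto_cong)
qed

lemma exp_tendsto_right: "((\<lambda>\<zeta>::complex. 1 / exp \<zeta> ^ n) \<longlongrightarrow> 0) (strip_end 1)"
proof -
  have "((\<lambda>\<zeta>::complex. inverse (exp \<zeta>)) \<longlongrightarrow> 0) (strip_end 1)"
    by (rule filterlim_compose[OF tendsto_inverse_0 filterlim_exp_strip_end_right])
  from tendsto_power[OF this, of n] show ?thesis
    by (simp only: zero_power[OF n_pos]) (simp add: power_inverse divide_inverse)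
qed

lemma F_right: "((\<lambda>\<zeta>. F (exp \<zeta>) / exp \<zeta> ^ n) \<longlongrightarrow> of_real ((-1) ^ N * c1)) (strip_end 1)"
proof -
  have "filterlim (\<lambda>\<zeta>::complex. (exp \<zeta>)\<^sup>2) at_infinity (strip_end 1)"
    unfolding power2_eq_square by (intro filterlim_at_infinity_times filterlim_exp_strip_end_right)
  hence l: "((\<lambda>\<zeta>. poly (cpoly P) ((exp \<zeta>)\<^sup>2) / ((exp \<zeta>)\<^sup>2) ^ (N - 1)) \<longlongrightarrow> coeff (cpoly P) (N - 1)) (strip_end 1)"
    by (rule poly_over_power_tendsto) (simp add: degree_P)
  have "((\<lambda>\<zeta>. (-1) ^ k / of_real L * (1 / exp \<zeta> ^ n - poly (cpoly P) ((exp \<zeta>)\<^sup>2) / ((exp \<zeta>)\<^sup>2) ^ (N - 1))) \<longlongrightarrow>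
     (-1) ^ k / of_real L * (0 - coeff (cpoly P) (N - 1))) (strip_end 1)"
    by (intro tendsto_intros exp_tendsto_right l)
  moreover have "(-1) ^ k / of_real L * (0 - coeff (cpoly P) (N - 1)) = complex_of_real ((-1) ^ N * c1)"
  proof -
    have "(-1) ^ N * (-1) ^ (N - 1) = (-1 :: complex)" using N2 by (cases N) (auto simp: power_mult_distrib[symmetric])
    hence "(-1) ^ N * ((-1) ^ k * ((-1) ^ (N - 1) * w)) = - ((-1) ^ k * w)" for w :: complex
      by (metis (no_types, opaque_lifting) mult.assoc mult.commute mult_minus1)
    thus ?thesis by (simp add: c1_def p1_def)
  qed
  moreover have "(-1) ^ k / of_real L * (1 / z ^ n - poly (cpoly P) (z\<^sup>2) / (z\<^sup>2) ^ (N - 1)) = F z / z ^ n" if "z \<noteq> 0" for z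
  proof -
    have "(z\<^sup>2) ^ (N - 1) = z ^ j * z ^ n"
      by (simp add: n_j diff_mult_distrib2 flip: power_mult power_add)
    thus ?thesis using that by (simp add: F_def field_simps)
  qed
  ultimately show ?thesis by simp
qed

lemma E_right: "((\<lambda>\<zeta>. E \<zeta> * exp \<zeta> ^ n) \<longlongrightarrow> of_real ((-1) ^ N / (2 * c1))) (strip_end 1)"
proof -
  have "((\<lambda>\<zeta>. 1 / (2 * (F (exp \<zeta>) / exp \<zeta> ^ n) - E \<zeta> * (1 / exp \<zeta> ^ n))) \<longlongrightarrow> 1 / (2 * of_real ((-1) ^ N * c1) - 0)) (strip_end 1)"
    using c1_pos by (intro tendsto_intros F_right E_times_null exp_tendsto_right) auto
  moreover have "1 / (2 * of_real ((-1) ^ N * c1) - 0) = complex_of_real ((-1) ^ N / (2 * c1))"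
  proof -
    have "1 / (2 * ((-1) ^ N * c1)) = (-1) ^ N / (2 * c1)"
      using c1_pos by (simp add: field_simps power_mult_distrib[symmetric])
    hence "complex_of_real (1 / (2 * ((-1) ^ N * c1))) = of_real ((-1) ^ N / (2 * c1))"
      by (rule arg_cong)
    thus ?thesis by simp
  qed
  moreover have "eventually (\<lambda>\<zeta>. 1 / (2 * (F (exp \<zeta>) / exp \<zeta> ^ n) - E \<zeta> * (1 / exp \<zeta> ^ n)) = E \<zeta> * exp \<zeta> ^ n) (strip_end 1)"
    using eventually_closed_strip
  proof eventually_elim
    case (elim \<zeta>)
    define z where "z = exp \<zeta> ^ n"
    have z: "z \<noteq> 0" by (simp add: z_def)
    have d: "2 * F (exp \<zeta>) - E \<zeta> \<noteq> 0" "E \<zeta> = 1 / (2 * F (exp \<zeta>) - E \<zeta>)"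
      by (rule E_formula[OF elim])+
    have "2 * (F (exp \<zeta>) / z) - E \<zeta> * (1 / z) = (2 * F (exp \<zeta>) - E \<zeta>) / z" by (simp add: diff_divide_distrib)
    hence "1 / (2 * (F (exp \<zeta>) / z) - E \<zeta> * (1 / z)) = z * (1 / (2 * F (exp \<zeta>) - E \<zeta>))" by simp
    thus ?case unfolding z_def[symmetric] using d(2) by (metis mult.commute)
  qed
  ultimately show ?thesis by (simp add: tendsto_cong)
qed

lemma E_null: "s = 1 \<or> s = -1 \<Longrightarrow> (E \<longlongrightarrow> 0) (strip_end s)"
proof -
  have "((\<lambda>\<zeta>. (E \<zeta> / exp \<zeta> ^ j) * exp \<zeta> ^ j) \<longlongrightarrow> of_real (1 / (2 * c0)) * 0) (strip_end (-1))"
    by (intro tendsto_mult E_left exp_tendsto_left)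
  moreover have "((\<lambda>\<zeta>. (E \<zeta> * exp \<zeta> ^ n) * (1 / exp \<zeta> ^ n)) \<longlongrightarrow> of_real ((-1) ^ N / (2 * c1)) * 0) (strip_end 1)"
    by (intro tendsto_mult E_right exp_tendsto_right)
  ultimately show "s = 1 \<or> s = -1 \<Longrightarrow> (E \<longlongrightarrow> 0) (strip_end s)" by auto
qed

lemma Im_psi_at_top: "s = 1 \<or> s = -1 \<Longrightarrow> filterlim (\<lambda>\<zeta>. Im (psi \<zeta>)) at_top (strip_end s)"
proof -
  assume s: "s = 1 \<or> s = -1"
  have "((\<lambda>\<zeta>. norm (E \<zeta>)) \<longlongrightarrow> 0) (strip_end s)" by (intro tendsto_norm_zero E_null s)
  moreover have "eventually (\<lambda>\<zeta>. norm (E \<zeta>) \<in> {0<..} \<and> norm (E \<zeta>) \<noteq> 0) (strip_end s)"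
    using eventually_closed_strip by eventually_elim (simp add: E_nz)
  ultimately have "filterlim (\<lambda>\<zeta>. norm (E \<zeta>)) (at_right 0) (strip_end s)" by (simp add: filterlim_at)
  hence "filterlim (\<lambda>\<zeta>. ln (norm (E \<zeta>))) at_bot (strip_end s)" by (rule filterlim_compose[OF ln_at_0])
  hence lim: "filterlim (\<lambda>\<zeta>. - ln (norm (E \<zeta>))) at_top (strip_end s)" by (simp add: filterlim_uminus_at_top)
  have ev: "eventually (\<lambda>\<zeta>. - ln (norm (E \<zeta>)) = Im (psi \<zeta>)) (strip_end s)"
    using eventually_closed_strip by eventually_elim (simp add: norm_E)
  show ?thesis by (rule iffD1[OF filterlim_cong[OF refl refl ev] lim])
qed

text \<open>\<open>g\<close> is a logarithm of \<open>E / exp \<zeta> ^ j\<close> scaled to the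
  limit 1, and \<open>U = 0\<close> on the real axis near this end settles its branch. As
  \<open>Im \<zeta>\<close> runs from 0 to \<open>pi / 2\<close>, \<open>j * Im \<zeta>\<close> runs
  from 0 to \<open>k * pi - pi / 2\<close>, the width of the left channel.\<close>

lemma Re_psi_left: "((\<lambda>\<zeta>. Re (psi \<zeta>) - real j * Im \<zeta>) \<longlongrightarrow> 0) (strip_end (-1))"
proof -
  define g where "g = (\<lambda>\<zeta>. \<i> * psi \<zeta> - of_nat j * \<zeta> + of_real (ln (2 * c0)))"
  have "((\<lambda>\<zeta>. Im (g \<zeta>)) \<longlongrightarrow> 0) (strip_end (-1))"
  proof (rule Im_log_tendsto_0[where ?r0.0 = "- ln a"])
    show "continuous_on closed_strip g" unfolding g_def by (intro continuous_intros psi(1))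
    have "((\<lambda>\<zeta>. E \<zeta> / exp \<zeta> ^ j * of_real (2 * c0)) \<longlongrightarrow> of_real (1 / (2 * c0)) * of_real (2 * c0)) (strip_end (-1))"
      by (intro tendsto_intros E_left)
    moreover have "of_real (1 / (2 * c0)) * of_real (2 * c0) = (1 :: complex)"
      using c0_pos by (simp flip: of_real_mult)
    moreover have "eventually (\<lambda>\<zeta>. E \<zeta> / exp \<zeta> ^ j * of_real (2 * c0) = exp (g \<zeta>)) (strip_end (-1))"
      using eventually_closed_strip
    proof eventually_elim
      case (elim \<zeta>)
      have "exp (g \<zeta>) = exp (\<i> * psi \<zeta>) / exp (of_nat j * \<zeta>) * exp (of_real (ln (2 * c0)))"
        unfolding g_def by (simp only: exp_add exp_diff)
      thus ?case using c0_pos elim by (simp only: psi(3) exp_of_nat_mult exp_of_real) simp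
    qed
    ultimately show "((\<lambda>\<zeta>. exp (g \<zeta>)) \<longlongrightarrow> 1) (strip_end (-1))"
      using Lim_transform_eventually by fastforce
    fix t :: real assume "- ln a < -1 * t"
    hence "exp t < exp (ln a)" by simp
    hence "exp t < a" using a by (simp only: exp_ln)
    hence "U (exp t) = 0" by (intro U_left) auto
    thus "Im (g (of_real t)) = 0" by (simp add: g_def U_def)
  qed simp
  thus ?thesis by (simp add: g_def)
qed

text \<open>Here \<open>U = N * pi\<close> settles the branch;
  \<open>N * pi - n * pi / 2 = k * pi + pi / 2\<close> is the left wall of the right
  channel.\<close>

lemma Re_psi_right: "((\<lambda>\<zeta>. Re (psi \<zeta>) + real n * Im \<zeta> - real N * pi) \<longlongrightarrow> 0) (strip_end 1)"
proof -
  define g where "g = (\<lambda>\<zeta>. \<i> * psi \<zeta> + of_nat n * \<zeta> - \<i> * of_real (real N * pi) + of_real (ln (2 * c1)))"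
  have e: "exp (\<i> * of_real (real N * pi)) = (-1) ^ N"
  proof -
    have "\<i> * of_real (real N * pi) = of_nat N * (of_real pi * \<i>)" by simp
    thus ?thesis by (simp only: exp_of_nat_mult exp_pi_i)
  qed
  have "((\<lambda>\<zeta>. Im (g \<zeta>)) \<longlongrightarrow> 0) (strip_end 1)"
  proof (rule Im_log_tendsto_0[where ?r0.0 = 0])
    show "continuous_on closed_strip g" unfolding g_def by (intro continuous_intros psi(1))
    have "((\<lambda>\<zeta>. E \<zeta> * exp \<zeta> ^ n * ((-1) ^ N * of_real (2 * c1))) \<longlongrightarrow> of_real ((-1) ^ N / (2 * c1)) * ((-1) ^ N * of_real (2 * c1))) (strip_end 1)"
      by (intro tendsto_intros E_right)
    moreover have "of_real ((-1) ^ N / (2 * c1)) * ((-1) ^ N * of_real (2 * c1)) = (1 :: complex)"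
      using c1_pos by (simp add: power_mult_distrib[symmetric])
    moreover have "eventually (\<lambda>\<zeta>. E \<zeta> * exp \<zeta> ^ n * ((-1) ^ N * of_real (2 * c1)) = exp (g \<zeta>)) (strip_end 1)"
      using eventually_closed_strip
    proof eventually_elim
      case (elim \<zeta>)
      have "exp (g \<zeta>) = exp (\<i> * psi \<zeta>) * exp (of_nat n * \<zeta>) / exp (\<i> * of_real (real N * pi)) * exp (of_real (ln (2 * c1)))"
        unfolding g_def by (simp only: exp_add exp_diff)
      also have "\<dots> = E \<zeta> * exp \<zeta> ^ n / (-1) ^ N * of_real (2 * c1)"
        using c1_pos elim by (simp only: psi(3) exp_of_nat_mult exp_of_real e) simp
      also have "u / (-1) ^ N = u * (-1) ^ N" for u :: complex
        by (cases "even N") auto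
      finally show ?case by (simp only: mult.assoc)
    qed
    ultimately show "((\<lambda>\<zeta>. exp (g \<zeta>)) \<longlongrightarrow> 1) (strip_end 1)"
      using Lim_transform_eventually by fastforce
    fix t :: real assume "0 < 1 * t"
    hence "U (exp t) = real N * pi" by (intro U_right) auto
    thus "Im (g (of_real t)) = 0" by (simp add: g_def U_def)
  qed simp
  thus ?thesis by (simp add: g_def)
qed

section \<open>Boundary values on the upper edge of the strip\<close>

definition edge :: "real \<Rightarrow> complex" where "edge t = of_real t + \<i> * of_real (pi / 2)"

lemma edge_simps [simp]: "Re (edge t) = t" "Im (edge t) = pi / 2" "edge t \<in> closed_strip"
proof -
  show re: "Re (edge t) = t" and im: "Im (edge t) = pi / 2" by (simp_all add: edge_def)
  show "edge t \<in> closed_strip" by (simp add: closed_strip_def im)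
qed

lemma edge_eq: "Im \<zeta> = pi / 2 \<Longrightarrow> \<zeta> = edge (Re \<zeta>)"
  by (simp add: edge_def complex_eq_iff)

lemma filterlim_edge: "filterlim edge (strip_end 1) at_top" "filterlim edge (strip_end (-1)) at_bot"
proof -
  have "eventually (\<lambda>t. Q (edge t)) at_top" if ev: "eventually Q (strip_end 1)" for Q
  proof -
    obtain r where r: "\<forall>\<zeta>\<in>closed_strip. r < 1 * Re \<zeta> \<longrightarrow> Q \<zeta>"
      using ev unfolding eventually_strip_end by blast
    show ?thesis using eventually_gt_at_top[of r] by eventually_elim (simp add: r)
  qed
  thus "filterlim edge (strip_end 1) at_top" by (simp add: filterlim_iff)
  have "eventually (\<lambda>t. Q (edge t)) at_bot" if ev: "eventually Q (strip_end (-1))" for Q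
  proof -
    obtain r where r: "\<forall>\<zeta>\<in>closed_strip. r < -1 * Re \<zeta> \<longrightarrow> Q \<zeta>"
      using ev unfolding eventually_strip_end by blast
    show ?thesis using eventually_gt_at_bot[of "- r"] by eventually_elim (simp add: r)
  qed
  thus "filterlim edge (strip_end (-1)) at_bot" by (simp add: filterlim_iff)
qed

text \<open>\<open>psi\<close> maps the upper edge to the curve \<open>cos w * cosh v = cosh B\<close>, the boundary of the deleted set.\<close>

definition w :: "real \<Rightarrow> real" where "w t = Re (psi (edge t)) - real k * pi"
definition v :: "real \<Rightarrow> real" where "v t = Im (psi (edge t))"

lemma v_pos: "v t > 0"
proof -
  have "edge t \<noteq> of_real r" for r
  proof
    assume "edge t = of_real r"
    hence "Im (edge t) = Im (of_real r)" by (rule arg_cong)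
    thus False by simp
  qed
  thus ?thesis unfolding v_def by (intro Im_psi_pos) auto
qed

text \<open>On the imaginary axis \<open>F = (-1)^k / L * (1 - \<i> * h)\<close>; the equations are
  the real and the imaginary part of \<open>cos psi = F\<close>. Subtracting \<open>k * pi\<close>
  in \<open>w\<close> absorbs the sign.\<close>

lemma edge_trig: "cos (w t) * cosh (v t) = cosh B" "sin (w t) * sinh (v t) = h (exp t) / L"
proof -
  have y: "exp t \<noteq> 0" by simp
  have "exp (\<i> * of_real (pi / 2)) = \<i>" by (simp only: cis_conv_exp[symmetric] cis_pi_half)
  hence "exp (edge t) = \<i> * of_real (exp t)"
    by (simp only: edge_def exp_add exp_of_real mult.commute)
  hence "cos (psi (edge t)) = F (\<i> * of_real (exp t))" using cos_psi[of "edge t"] by simp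
  also have "\<dots> = (-1) ^ k / of_real L * (1 - \<i> * of_real (h (exp t)))"
    using cpoly_P_imaginary[OF y] by (simp add: F_def)
  also have "\<dots> = of_real ((-1) ^ k / L) * Complex 1 (- h (exp t))"
    by (simp add: complex_eq_iff)
  finally have c: "cos (psi (edge t)) = of_real ((-1) ^ k / L) * Complex 1 (- h (exp t))" .
  have s: "(-1) ^ k * (-1) ^ k = (1::real)" by (simp add: power_mult_distrib[symmetric])
  have Re: "Re (psi (edge t)) = w t + real k * pi" by (simp add: w_def)
  have "cos (w t + real k * pi) * cosh (v t) = (-1) ^ k / L"
    using arg_cong[OF c, of Re] by (simp add: Re_cos_cosh Re v_def)
  hence "(-1) ^ k * ((-1) ^ k * (cos (w t) * cosh (v t))) = (-1) ^ k * ((-1) ^ k / L)"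
    by (simp add: cos_add mult_ac)
  thus "cos (w t) * cosh (v t) = cosh B" using s by (simp add: cosh_B flip: mult.assoc)
  have "- (sin (w t + real k * pi) * sinh (v t)) = (-1) ^ k / L * (- h (exp t))"
    using arg_cong[OF c, of Im] by (simp add: Im_cos_sinh Re v_def)
  hence "(-1) ^ k * ((-1) ^ k * (sin (w t) * sinh (v t))) = (-1) ^ k * ((-1) ^ k * (h (exp t) / L))"
    by (simp add: sin_add mult_ac)
  thus "sin (w t) * sinh (v t) = h (exp t) / L" using s by (simp flip: mult.assoc)
qed

lemma psi_top_cont: "continuous_on UNIV (\<lambda>t. psi (edge t))"
proof (rule continuous_on_compose2[OF psi(1)])
  show "continuous_on UNIV edge" unfolding edge_def by (intro continuous_intros)
qed auto

lemma w_cont: "continuous_on I w"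
  unfolding w_def by (intro continuous_intros continuous_on_subset[OF psi_top_cont]) auto

lemma w_at_bot: "(w \<longlongrightarrow> - (pi / 2)) at_bot" and w_at_top: "(w \<longlongrightarrow> pi / 2) at_top"
proof -
  have "((\<lambda>t. Re (psi (edge t)) - real j * Im (edge t)) \<longlongrightarrow> 0) at_bot"
    by (rule filterlim_compose[OF Re_psi_left filterlim_edge(2)])
  hence "((\<lambda>t. (Re (psi (edge t)) - real j * Im (edge t)) + - (pi / 2)) \<longlongrightarrow> 0 + - (pi / 2)) at_bot"
    by (intro tendsto_intros)
  moreover have "(Re (psi (edge t)) - real j * Im (edge t)) + - (pi / 2) = w t" for t
  proof -
    have "real j * (pi / 2) + pi / 2 = real k * pi" unfolding j_eq by (simp add: field_simps)
    thus ?thesis by (simp add: w_def)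
  qed
  ultimately show "(w \<longlongrightarrow> - (pi / 2)) at_bot" by simp
  have "((\<lambda>t. Re (psi (edge t)) + real n * Im (edge t) - real N * pi) \<longlongrightarrow> 0) at_top"
    by (rule filterlim_compose[OF Re_psi_right filterlim_edge(1)])
  hence "((\<lambda>t. (Re (psi (edge t)) + real n * Im (edge t) - real N * pi) + pi / 2) \<longlongrightarrow> 0 + pi / 2) at_top"
    by (intro tendsto_intros)
  moreover have "(Re (psi (edge t)) + real n * Im (edge t) - real N * pi) + pi / 2 = w t" for t
  proof -
    have "real n * (pi / 2) + pi / 2 + real k * pi = real N * pi"
      unfolding n_eq j_eq by (simp add: field_simps)
    thus ?thesis by (simp add: w_def)
  qed
  ultimately show "(w \<longlongrightarrow> pi / 2) at_top" by simp
qed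

lemma cos_w_nz: "cos (w t) \<noteq> 0"
proof
  assume "cos (w t) = 0"
  hence "cosh B = 0" using edge_trig(1)[of t] by simp
  thus False using cosh_real_pos[of B] by simp
qed

text \<open>\<open>cos (w t)\<close> never vanishes, so \<open>w\<close> cannot pass
  \<open>pi / 2\<close> or \<open>- pi / 2\<close>; its limits at the ends show that it lies between
  them.\<close>

lemma w_range: "- (pi / 2) < w t" "w t < pi / 2"
proof -
  have ne: "w s \<noteq> pi / 2" "w s \<noteq> - (pi / 2)" for s
    using cos_w_nz[of s] by (metis cos_pi_half, metis cos_minus cos_pi_half)
  have ivt: "\<exists>s. w s = y" if "w p \<le> y" "y \<le> w q" for p q y
  proof (cases "p \<le> q")
    case True thus ?thesis using IVT'[of w p y q] that w_cont by blast
  next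
    case False thus ?thesis using IVT2'[of w p y q] that w_cont by auto
  qed
  have "eventually (\<lambda>s. w s < 0) at_bot" using w_at_bot by (rule order_tendstoD(2)) simp
  then obtain p where p: "w p < 0" by (auto simp: eventually_at_bot_linorder)
  have "eventually (\<lambda>s. w s > 0) at_top" using w_at_top by (rule order_tendstoD(1)) simp
  then obtain q where q: "w q > 0" by (auto simp: eventually_at_top_linorder)
  show "w t < pi / 2"
  proof (rule ccontr)
    assume "\<not> w t < pi / 2"
    hence "w p \<le> pi / 2" "pi / 2 \<le> w t" using p pi_gt_zero by linarith+
    thus False using ivt[of p "pi / 2" t] ne by blast
  qed
  show "- (pi / 2) < w t"
  proof (rule ccontr)
    assume "\<not> - (pi / 2) < w t"
    hence "w t \<le> - (pi / 2)" "- (pi / 2) \<le> w q" using q pi_gt_zero by linarith+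
    thus False using ivt[of t "- (pi / 2)" q] ne by blast
  qed
qed

text \<open>\<open>w\<close> determines \<open>v\<close> through the equation of the curve, then
  \<open>h (exp t)\<close> through the second equation of \<open>edge_trig\<close>, and
  \<open>h\<close> is injective.\<close>

lemma w_inj: "w s = w t \<Longrightarrow> s = t"
proof -
  assume eq: "w s = w t"
  have "cos (w t) * cosh (v s) = cos (w t) * cosh (v t)" using edge_trig(1)[of s] edge_trig(1)[of t] eq by simp
  hence "cosh (v s) = cosh (v t)" using cos_w_nz by simp
  hence "v s = v t" using v_pos[of s] v_pos[of t] by (metis arcosh_cosh_real less_imp_le)
  hence "h (exp s) = h (exp t)" using edge_trig(2)[of s] edge_trig(2)[of t] eq L by simp
  hence "exp s = exp t" by (rule inj_onD[OF h_inj]) auto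
  thus "s = t" by simp
qed

lemma w_mono: "s \<le> t \<Longrightarrow> w s \<le> w t"
proof (rule ccontr)
  assume st: "s \<le> t" "\<not> w s \<le> w t"
  hence "s < t" by (cases "s = t") auto
  have "eventually (\<lambda>r. w r < w t) at_bot" using w_at_bot w_range(1) by (rule order_tendstoD(2))
  moreover have "eventually (\<lambda>r. r < s) at_bot" by (rule eventually_gt_at_bot)
  ultimately have "eventually (\<lambda>r. w r < w t \<and> r < s) at_bot" by eventually_elim simp
  then obtain r where r: "w r < w t" "r < s" by (auto simp: eventually_at_bot_linorder)
  hence "\<exists>q\<ge>r. q \<le> s \<and> w q = w t" using st by (intro IVT' w_cont) auto
  then obtain q where "q \<le> s" "w q = w t" by blast
  thus False using w_inj[of q t] \<open>s < t\<close> by simp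
qed

lemma h_surj: "\<exists>y>0. h y = \<eta>"
proof -
  have "eventually (\<lambda>y. h y < \<eta>) (at_right 0)"
    using h_at_0(2)[OF p0_neg] by (simp add: filterlim_at_bot_dense)
  moreover have "eventually (\<lambda>y. y > 0) (at_right (0::real))" by (simp add: eventually_at_filter)
  ultimately have "eventually (\<lambda>y. h y < \<eta> \<and> y > 0) (at_right 0)" by eventually_elim simp
  then obtain p where p: "h p < \<eta>" "p > 0"
    using eventually_happens[of _ "at_right (0::real)"] by fastforce
  have "eventually (\<lambda>y. h y > \<eta> \<and> y > p) at_top"
    using h_at_top(1)[OF p1_pos] by (intro eventually_conj eventually_gt_at_top) (simp add: filterlim_at_top_dense)
  then obtain q where q: "h q > \<eta>" "q > p" by (auto simp: eventually_at_top_linorder)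
  have "\<exists>y\<ge>p. y \<le> q \<and> h y = \<eta>"
    using p q by (intro IVT' continuous_on_subset[OF h_cont]) auto
  then obtain y where "p \<le> y" "h y = \<eta>" by blast
  thus ?thesis using p by (intro exI[of _ y]) auto
qed

text \<open>\<open>h\<close> takes every real value, so some edge point has the same cosine as
  \<open>z\<close>. The sign of the imaginary parts and the width of the range of \<open>w\<close>
  exclude all other solutions of \<open>cos a1 = cos a2\<close>.\<close>

lemma edge_covers_curve:
  assumes "\<bar>Re z - real k * pi\<bar> < pi / 2" "cos (Re z - real k * pi) * cosh (Im z) = cosh B" "Im z > 0"
  shows "\<exists>t. psi (edge t) = z"
proof -
  obtain y where y: "y > 0" "h y = L * (sin (Re z - real k * pi) * sinh (Im z))" using h_surj by blast
  define t where "t = ln y"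
  define a1 where "a1 = Complex (w t) (v t)"
  define a2 where "a2 = Complex (Re z - real k * pi) (Im z)"
  have "cos a1 = cos a2"
    using edge_trig[of t] assms(2) y L
    by (simp add: complex_eq_iff Re_cos_cosh Im_cos_sinh a1_def a2_def t_def)
  then obtain r where r: "r \<in> \<int>" "a1 = a2 + of_real (2 * r * pi) \<or> a1 = - a2 + of_real (2 * r * pi)"
    unfolding complex_cos_eq by blast
  from r(1) obtain l :: int where rl: "r = of_int l" by (rule Ints_cases)
  have l: "a1 = a2 + of_real (2 * of_int l * pi) \<or> a1 = - a2 + of_real (2 * of_int l * pi)"
    using r(2) by (simp only: rl)
  have "Im a1 > 0" "Im a2 > 0" using v_pos assms(3) by (auto simp: a1_def a2_def)
  hence l': "a1 = a2 + of_real (2 * of_int l * pi)" using l by auto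
  have "w t = (Re z - real k * pi) + 2 * real_of_int l * pi"
    using arg_cong[OF l', of Re] by (simp add: a1_def a2_def)
  hence "(2 * real_of_int l) * pi < 1 * pi" "(- 1) * pi < (2 * real_of_int l) * pi"
    using w_range[of t] assms(1) by linarith+
  hence "2 * real_of_int l < 1" "-1 < 2 * real_of_int l"
    using mult_less_cancel_right_pos[OF pi_gt_zero] by blast+
  hence "l = 0" by linarith
  hence "w t = Re z - real k * pi" "v t = Im z" using l' by (auto simp: a1_def a2_def)
  hence "psi (edge t) = z" by (simp add: complex_eq_iff w_def v_def)
  thus ?thesis by blast
qed

section \<open>Monotonicity under translation, and injectivity\<close>

lemma psi_shift_mono:
  assumes "t > 0" "\<zeta> \<in> closed_strip"
  shows "Re (psi \<zeta>) \<le> Re (psi (\<zeta> + of_real t))"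
proof -
  define D where "D = (\<lambda>\<zeta>. psi (\<zeta> + of_real t) - psi \<zeta>)"
  have sh: "\<zeta> + of_real t \<in> closed_strip" if "\<zeta> \<in> closed_strip" for \<zeta> using that by (simp add: closed_strip_def)
  have sh': "\<zeta> + of_real t \<in> open_strip" if "\<zeta> \<in> open_strip" for \<zeta> using that by (simp add: open_strip_def)
  have "0 \<le> Re (D \<zeta>)"
  proof (rule strip_minimum_principle[of D \<zeta>])
    have "(psi \<circ> (\<lambda>\<zeta>. \<zeta> + of_real t)) holomorphic_on open_strip"
      by (rule holomorphic_on_compose_gen[OF _ psi(2)]) (auto intro!: holomorphic_intros sh')
    thus "D holomorphic_on open_strip" unfolding D_def o_def by (intro holomorphic_intros psi(2))
    show "continuous_on closed_strip D" unfolding D_def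
      by (intro continuous_intros psi(1) continuous_on_compose2[OF psi(1)]) (auto intro: sh)
    show "\<zeta> \<in> closed_strip" by fact
    show "0 \<le> Re (D \<zeta>)" if "Im \<zeta> = 0 \<or> Im \<zeta> = pi / 2" for \<zeta>
    proof (cases "Im \<zeta> = 0")
      case True
      hence "\<zeta> = of_real (ln (exp (Re \<zeta>)))" "\<zeta> + of_real t = of_real (ln (exp (Re \<zeta> + t)))"
        by (simp_all add: complex_eq_iff)
      thus ?thesis using U_mono[of "exp (Re \<zeta>)" "exp (Re \<zeta> + t)"] assms(1) by (simp add: D_def U_def)
    next
      case False
      hence "\<zeta> = edge (Re \<zeta>)" "\<zeta> + of_real t = edge (Re \<zeta> + t)" using that by (auto intro!: edge_eq simp: edge_def complex_eq_iff)
      thus ?thesis using w_mono[of "Re \<zeta>" "Re \<zeta> + t"] assms(1) by (simp add: D_def w_def)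
    qed
    \<comment> \<open>The asymptotics of \<open>Re psi\<close> at the ends depend on
      \<open>Im \<zeta>\<close> alone, which the translation preserves; so the difference tends to
      0.\<close>
    fix s \<epsilon> :: real assume s: "s = 1 \<or> s = -1" and \<epsilon>: "\<epsilon> > 0"
    have "((\<lambda>\<zeta>. Re (D \<zeta>)) \<longlongrightarrow> 0) (strip_end s)"
    proof (cases "s = 1")
      case True
      have "((\<lambda>\<zeta>. (Re (psi (\<zeta> + of_real t)) + real n * Im (\<zeta> + of_real t) - real N * pi) -
          (Re (psi \<zeta>) + real n * Im \<zeta> - real N * pi)) \<longlongrightarrow> 0 - 0) (strip_end 1)"
        by (intro tendsto_diff Re_psi_right filterlim_compose[OF Re_psi_right filterlim_shift_strip_end])
      thus ?thesis using True by (simp add: D_def)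
    next
      case False
      hence s: "s = -1" using s by simp
      have "((\<lambda>\<zeta>. (Re (psi (\<zeta> + of_real t)) - real j * Im (\<zeta> + of_real t)) -
          (Re (psi \<zeta>) - real j * Im \<zeta>)) \<longlongrightarrow> 0 - 0) (strip_end (-1))"
        by (intro tendsto_diff Re_psi_left filterlim_compose[OF Re_psi_left filterlim_shift_strip_end])
      thus ?thesis unfolding s by (simp add: D_def)
    qed
    hence "eventually (\<lambda>\<zeta>. - \<epsilon> < Re (D \<zeta>)) (strip_end s)" using \<epsilon> by (intro order_tendstoD(1)) auto
    thus "eventually (\<lambda>\<zeta>. - \<epsilon> \<le> Re (D \<zeta>)) (strip_end s)" by eventually_elim simp
  qed
  thus ?thesis by (simp add: D_def)
qed

lemma Re_deriv_psi_nonneg: "\<zeta> \<in> open_strip \<Longrightarrow> 0 \<le> Re (deriv psi \<zeta>)"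
proof -
  assume \<zeta>: "\<zeta> \<in> open_strip"
  have "(psi has_field_derivative deriv psi \<zeta>) (at \<zeta>)"
    using psi(2) open_open_strip \<zeta> holomorphic_derivI by blast
  hence lim: "((\<lambda>h. (psi (\<zeta> + h) - psi \<zeta>) / h) \<longlongrightarrow> deriv psi \<zeta>) (at 0)" unfolding DERIV_def .
  have "filterlim (\<lambda>t::real. complex_of_real t) (at 0) (at_right 0)"
    by (auto simp: filterlim_at eventually_at_filter intro!: tendsto_eq_intros)
  from filterlim_compose[OF lim this]
  have "((\<lambda>t. Re ((psi (\<zeta> + of_real t) - psi \<zeta>) / of_real t)) \<longlongrightarrow> Re (deriv psi \<zeta>)) (at_right 0)"
    by (rule tendsto_Re)
  moreover have "eventually (\<lambda>t. 0 \<le> Re ((psi (\<zeta> + of_real t) - psi \<zeta>) / of_real t)) (at_right (0::real))"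
  proof -
    have "0 \<le> Re ((psi (\<zeta> + of_real t) - psi \<zeta>) / of_real t)" if "t > 0" for t :: real
      using psi_shift_mono[OF that, of \<zeta>] \<zeta> open_strip_subset that by (auto simp: Re_divide_of_real)
    thus ?thesis by (auto simp: eventually_at_filter)
  qed
  ultimately show ?thesis by (rule tendsto_lowerbound) simp
qed

definition mid :: "real \<Rightarrow> complex" where "mid t = of_real t + \<i> * of_real (pi / 4)"

lemma mid_simps [simp]: "Re (mid t) = t" "Im (mid t) = pi / 4" "mid t \<in> open_strip" "mid t \<in> closed_strip"
  by (auto simp: mid_def open_strip_def closed_strip_def)

text \<open>In the degenerate case \<open>Re (deriv psi)\<close> vanishes identically and
  \<open>Re psi\<close> is constant on the middle line. Its limits there are
  \<open>j * pi / 4\<close> and \<open>N * pi - n * pi / 4\<close>, which differ because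
  \<open>j + n = 2 * N - 2\<close>.\<close>

lemma Re_deriv_psi_pos: "\<zeta> \<in> open_strip \<Longrightarrow> 0 < Re (deriv psi \<zeta>)"
proof -
  have hol: "deriv psi holomorphic_on open_strip" by (rule holomorphic_deriv[OF psi(2) open_open_strip])
  have "deriv psi constant_on open_strip \<or> (\<forall>z\<in>open_strip. 0 < Re (deriv psi z))"
    by (rule Re_nonneg_imp_constant_or_pos[OF hol open_open_strip convex_connected[OF convex_strips(2)] Re_deriv_psi_nonneg])
  moreover have False if const: "deriv psi constant_on open_strip" "\<zeta>0 \<in> open_strip" "Re (deriv psi \<zeta>0) \<le> 0" for \<zeta>0
  proof -
    have 0: "Re (deriv psi \<zeta>) = 0" if "\<zeta> \<in> open_strip" for \<zeta>
      using const that Re_deriv_psi_nonneg[of \<zeta>0] by (force simp: constant_on_def)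
    define g where "g = (\<lambda>t. Re (psi (mid t)))"
    have "(g has_real_derivative 0) (at t)" for t
    proof -
      have "(psi has_field_derivative deriv psi (mid t)) (at (mid t))"
        using psi(2) open_open_strip holomorphic_derivI by simp
      moreover have "(mid has_vector_derivative 1) (at t)"
        unfolding mid_def by (auto intro!: derivative_eq_intros)
      ultimately have "(psi \<circ> mid has_vector_derivative 1 * deriv psi (mid t)) (at t)"
        by (rule field_vector_diff_chain_at[rotated])
      hence "((\<lambda>t. Re ((psi \<circ> mid) t)) has_vector_derivative Re (1 * deriv psi (mid t))) (at t)"
        by (rule bounded_linear.has_vector_derivative[OF bounded_linear_Re])
      thus ?thesis using 0[of "mid t"] by (simp add: g_def has_real_derivative_iff_has_vector_derivative)
    qed
    hence "g t = g 0" for t using DERIV_isconst_all by blast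
    hence gc: "Re (psi (mid t)) = g 0" for t unfolding g_def .
    have f1: "filterlim mid (strip_end 1) at_top"
      unfolding filterlim_iff eventually_strip_end
    proof safe
      fix Q r assume r: "\<forall>\<zeta>\<in>closed_strip. r < 1 * Re \<zeta> \<longrightarrow> Q \<zeta>"
      show "\<forall>\<^sub>F t in at_top. Q (mid t)" using eventually_gt_at_top[of r]
        by eventually_elim (use r in \<open>simp del: mult_1_left\<close>)
    qed
    have f2: "filterlim mid (strip_end (-1)) at_bot"
      unfolding filterlim_iff eventually_strip_end
    proof safe
      fix Q r assume r: "\<forall>\<zeta>\<in>closed_strip. r < -1 * Re \<zeta> \<longrightarrow> Q \<zeta>"
      show "\<forall>\<^sub>F t in at_bot. Q (mid t)" using eventually_gt_at_bot[of "- r"]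
        by eventually_elim (use r in simp)
    qed
    have "((\<lambda>t::real. g 0 + real n * (pi / 4) - real N * pi) \<longlongrightarrow> 0) at_top"
      using filterlim_compose[OF Re_psi_right f1] by (simp only: gc mid_simps)
    hence 1: "g 0 + real n * (pi / 4) - real N * pi = 0" by (simp add: tendsto_const_iff)
    have "((\<lambda>t::real. g 0 - real j * (pi / 4)) \<longlongrightarrow> 0) at_bot"
      using filterlim_compose[OF Re_psi_left f2] by (simp only: gc mid_simps)
    hence 2: "g 0 - real j * (pi / 4) = 0" by (simp add: tendsto_const_iff)
    have "real j + real n = real (2 * N - 2)" using n_j by (metis of_nat_add)
    hence "(real j + real n) * pi = (2 * real N - 2) * pi" using N2 by (simp add: of_nat_diff)
    hence "2 * real N * pi + 2 * pi = 0" using 1 2 by (simp add: algebra_simps)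
    moreover have "2 * real N * pi \<ge> 0" by simp
    ultimately show False using pi_gt_zero by linarith
  qed
  ultimately show "\<zeta> \<in> open_strip \<Longrightarrow> 0 < Re (deriv psi \<zeta>)" by (meson not_le)
qed

lemma psi_inj: "inj_on psi open_strip"
  by (rule inj_on_convex_Re_deriv_pos[OF psi(2) open_open_strip convex_strips(2) Re_deriv_psi_pos])

end

subsection \<open>The image domain\<close>

text \<open>The deleted set widens with height, so a vertical segment running down from a point of
  \<open>Omega\<close> stays in \<open>Omega\<close>. It ends in the rectangle below height
  \<open>B\<close>, which joins all these segments.\<close>

lemma connected_Omega:
  assumes "B > 0"
  shows "connected (Omega k m B)"
proof -
  define R where "R = {w. 0 < Re w \<and> Re w < real (k + m) * pi \<and> 0 < Im w \<and> Im w < B}"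
  define V where "V = (\<lambda>w. R \<union> closed_segment (Complex (Re w) (min (Im w) (B / 2))) w)"
  have Rconv: "convex R"
  proof -
    have "R = {w. 1 \<bullet> w > 0} \<inter> {w. 1 \<bullet> w < real (k + m) * pi} \<inter> {w. \<i> \<bullet> w > 0} \<inter> {w. \<i> \<bullet> w < B}"
      by (auto simp: R_def inner_complex_def)
    thus ?thesis by (simp only:) (intro convex_Int convex_halfspace_gt convex_halfspace_lt)
  qed
  have RO: "R \<subseteq> Omega k m B" by (auto simp: R_def Omega_def)
  have VO: "V w \<subseteq> Omega k m B" if w: "w \<in> Omega k m B" for w
  proof -
    have "z \<in> Omega k m B" if z: "z \<in> closed_segment (Complex (Re w) (min (Im w) (B / 2))) w" for z
    proof -
      obtain u where u: "0 \<le> u" "u \<le> 1" "z = (1 - u) *\<^sub>R Complex (Re w) (min (Im w) (B / 2)) + u *\<^sub>R w"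
        using z by (auto simp: closed_segment_def)
      have w0: "0 < Re w" "Re w < real (k + m) * pi" "0 < Im w" using w by (auto simp: Omega_def)
      have Re: "Re z = Re w" using arg_cong[OF u(3), of Re] by (simp add: algebra_simps)
      define c where "c = min (Im w) (B / 2)"
      have c: "0 < c" "c \<le> Im w" using w0 assms by (auto simp: c_def)
      have Im: "Im z = c + u * (Im w - c)" using arg_cong[OF u(3), of Im] by (simp add: c_def algebra_simps)
      have "0 \<le> u * (Im w - c)" "u * (Im w - c) \<le> 1 * (Im w - c)"
        using u c mult_right_mono[of u 1 "Im w - c"] by auto
      hence Imz: "0 < Im z" "Im z \<le> Im w" using Im c by auto
      have "\<not> (\<bar>Re z - pi * real k\<bar> \<le> arccos (cosh B / cosh (Im z)) \<and> B \<le> Im z)"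
      proof
        assume *: "\<bar>Re z - pi * real k\<bar> \<le> arccos (cosh B / cosh (Im z)) \<and> B \<le> Im z"
        have "cosh B \<le> cosh (Im z)" "cosh (Im z) \<le> cosh (Im w)"
          using * Imz assms by (auto simp: cosh_real_nonneg_le_iff)
        hence "cosh B / cosh (Im w) \<le> cosh B / cosh (Im z)" "cosh B / cosh (Im z) \<le> 1" "0 \<le> cosh B / cosh (Im w)"
          by (auto intro!: divide_left_mono simp: cosh_real_pos)
        hence "arccos (cosh B / cosh (Im z)) \<le> arccos (cosh B / cosh (Im w))"
          using cosh_real_pos[of B] by (intro arccos_le_mono[THEN iffD2]) (linarith | simp only: abs_le_iff)+
        hence "\<bar>Re w - pi * real k\<bar> \<le> arccos (cosh B / cosh (Im w)) \<and> B \<le> Im w" using * Re Imz by auto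
        thus False using w by (auto simp: Omega_def)
      qed
      thus ?thesis using Re Imz w0 by (auto simp: Omega_def)
    qed
    thus ?thesis using RO by (auto simp: V_def)
  qed
  have "Omega k m B = \<Union> (V ` Omega k m B)"
  proof
    show "Omega k m B \<subseteq> \<Union> (V ` Omega k m B)" by (auto simp: V_def)
    show "\<Union> (V ` Omega k m B) \<subseteq> Omega k m B" using VO by blast
  qed
  moreover have "connected (\<Union> (V ` Omega k m B))"
  proof (cases "Omega k m B = {}")
    case False
    then obtain w where w: "w \<in> Omega k m B" by blast
    have "connected (V w)" if w: "w \<in> Omega k m B" for w
    proof -
      have "Complex (Re w) (min (Im w) (B / 2)) \<in> R" using w assms by (auto simp: R_def Omega_def)
      hence "R \<inter> closed_segment (Complex (Re w) (min (Im w) (B / 2))) w \<noteq> {}" by auto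
      thus ?thesis unfolding V_def
        by (intro connected_Un convex_connected[OF Rconv] connected_segment)
    qed
    moreover have "Complex (Re w) (min (Im w) (B / 2)) \<in> R" using w assms by (auto simp: R_def Omega_def)
    hence "\<Inter> (V ` Omega k m B) \<noteq> {}" using False by (auto simp: V_def)
    ultimately show ?thesis by (intro connected_Union) auto
  qed simp
  ultimately show ?thesis by simp
qed

context alternation
begin

lemma j_bounds: "real j * (pi / 2) = real k * pi - pi / 2" "real n * (pi / 2) = real N * pi - real k * pi - pi / 2"
  unfolding n_eq j_eq by (simp_all add: field_simps)

lemma kN_pi: "pi \<le> real k * pi" "real k * pi + pi \<le> real N * pi"
proof -
  have "1 \<le> real k" "real k + 1 \<le> real N" using k m by (auto simp: N)
  hence "1 * pi \<le> real k * pi" "(real k + 1) * pi \<le> real N * pi" by (intro mult_right_mono; simp)+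
  thus "pi \<le> real k * pi" "real k * pi + pi \<le> real N * pi" by (simp_all add: algebra_simps)
qed

lemma strip_end_Re_psi:
  assumes "\<epsilon> > 0"
  shows "eventually (\<lambda>\<zeta>. - \<epsilon> \<le> Re (psi \<zeta>) \<and> Re (psi \<zeta>) < real k * pi - pi / 2 + \<epsilon>) (strip_end (-1))"
    and "eventually (\<lambda>\<zeta>. real k * pi + pi / 2 - \<epsilon> < Re (psi \<zeta>) \<and> Re (psi \<zeta>) \<le> real N * pi + \<epsilon>) (strip_end 1)"
proof -
  have "eventually (\<lambda>\<zeta>. dist (Re (psi \<zeta>) - real j * Im \<zeta>) 0 < \<epsilon>) (strip_end (-1))"
    using Re_psi_left assms by (rule tendstoD)
  thus "eventually (\<lambda>\<zeta>. - \<epsilon> \<le> Re (psi \<zeta>) \<and> Re (psi \<zeta>) < real k * pi - pi / 2 + \<epsilon>) (strip_end (-1))"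
    using eventually_closed_strip
  proof eventually_elim
    case (elim \<zeta>)
    hence "0 \<le> Im \<zeta>" "Im \<zeta> \<le> pi / 2" by (auto simp: closed_strip_def)
    hence "0 \<le> real j * Im \<zeta>" "real j * Im \<zeta> \<le> real j * (pi / 2)"
      using mult_left_mono[of "Im \<zeta>" "pi / 2" "real j"] by auto
    thus ?case using elim(1) j_bounds(1) unfolding dist_real_def by linarith
  qed
  have "eventually (\<lambda>\<zeta>. dist (Re (psi \<zeta>) + real n * Im \<zeta> - real N * pi) 0 < \<epsilon>) (strip_end 1)"
    using Re_psi_right assms by (rule tendstoD)
  thus "eventually (\<lambda>\<zeta>. real k * pi + pi / 2 - \<epsilon> < Re (psi \<zeta>) \<and> Re (psi \<zeta>) \<le> real N * pi + \<epsilon>) (strip_end 1)"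
    using eventually_closed_strip
  proof eventually_elim
    case (elim \<zeta>)
    hence "0 \<le> Im \<zeta>" "Im \<zeta> \<le> pi / 2" by (auto simp: closed_strip_def)
    hence "0 \<le> real n * Im \<zeta>" "real n * Im \<zeta> \<le> real n * (pi / 2)"
      using mult_left_mono[of "Im \<zeta>" "pi / 2" "real n"] by auto
    thus ?case using elim(1) j_bounds(2) unfolding dist_real_def by linarith
  qed
qed

lemma bottom_eq: "Im \<zeta> = 0 \<Longrightarrow> \<zeta> = of_real (ln (exp (Re \<zeta>)))"
  by (simp add: complex_eq_iff)

lemma Re_psi_boundary:
  assumes "Im \<zeta> = 0 \<or> Im \<zeta> = pi / 2"
  shows "0 \<le> Re (psi \<zeta>)" "Re (psi \<zeta>) \<le> real N * pi"
proof -
  have "0 \<le> Re (psi \<zeta>) \<and> Re (psi \<zeta>) \<le> real N * pi"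
  proof (cases "Im \<zeta> = 0")
    case True
    have "Re (psi \<zeta>) = U (exp (Re \<zeta>))" using bottom_eq[OF True] by (simp add: U_def)
    thus ?thesis using U_range[of "exp (Re \<zeta>)"] by simp
  next
    case False
    hence "\<zeta> = edge (Re \<zeta>)" using assms by (intro edge_eq) auto
    hence "Re (psi \<zeta>) = w (Re \<zeta>) + real k * pi" by (metis add.commute diff_add_cancel w_def)
    thus ?thesis using w_range[of "Re \<zeta>"] kN_pi pi_gt_zero by linarith
  qed
  thus "0 \<le> Re (psi \<zeta>)" "Re (psi \<zeta>) \<le> real N * pi" by auto
qed

lemma psi_not_constant: "\<not> psi constant_on open_strip"
proof
  assume "psi constant_on open_strip"
  hence "psi (mid 0) = psi (mid 1)" by (auto simp: constant_on_def)
  hence "mid 0 = mid 1" by (rule inj_onD[OF psi_inj]) auto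
  hence "Re (mid 0) = Re (mid 1)" by (rule arg_cong)
  thus False by simp
qed

lemma Re_psi_open:
  assumes "\<zeta> \<in> open_strip"
  shows "0 < Re (psi \<zeta>)" "Re (psi \<zeta>) < real N * pi"
proof -
  note conn = convex_connected[OF convex_strips(2)]
  have 1: "0 \<le> Re (psi \<zeta>)" if "\<zeta> \<in> closed_strip" for \<zeta>
  proof (rule strip_minimum_principle[OF psi(2,1) Re_psi_boundary(1) _ that])
    fix s \<epsilon> :: real assume s: "s = 1 \<or> s = -1" and \<epsilon>: "\<epsilon> > 0"
    have "eventually (\<lambda>\<zeta>. - \<epsilon> \<le> Re (psi \<zeta>)) (strip_end 1)"
      using strip_end_Re_psi(2)[OF \<epsilon>]
      by eventually_elim (use kN_pi pi_gt_zero in linarith)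
    moreover have "eventually (\<lambda>\<zeta>. - \<epsilon> \<le> Re (psi \<zeta>)) (strip_end (-1))"
      using strip_end_Re_psi(1)[OF \<epsilon>] by eventually_elim simp
    ultimately show "eventually (\<lambda>\<zeta>. - \<epsilon> \<le> Re (psi \<zeta>)) (strip_end s)" using s by auto
  qed
  define g where "g = (\<lambda>\<zeta>. of_real (real N * pi) - psi \<zeta>)"
  have hg: "g holomorphic_on open_strip" unfolding g_def by (intro holomorphic_intros psi(2))
  have 2: "0 \<le> Re (g \<zeta>)" if "\<zeta> \<in> closed_strip" for \<zeta>
  proof (rule strip_minimum_principle[OF hg _ _ _ that])
    show "continuous_on closed_strip g" unfolding g_def by (intro continuous_intros psi(1))
    show "0 \<le> Re (g \<zeta>)" if "Im \<zeta> = 0 \<or> Im \<zeta> = pi / 2" for \<zeta>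
      using Re_psi_boundary(2)[OF that] by (simp add: g_def)
    fix s \<epsilon> :: real assume s: "s = 1 \<or> s = -1" and \<epsilon>: "\<epsilon> > 0"
    have "eventually (\<lambda>\<zeta>. - \<epsilon> \<le> Re (g \<zeta>)) (strip_end 1)"
      using strip_end_Re_psi(2)[OF \<epsilon>] by eventually_elim (simp add: g_def)
    moreover have "eventually (\<lambda>\<zeta>. - \<epsilon> \<le> Re (g \<zeta>)) (strip_end (-1))"
      using strip_end_Re_psi(1)[OF \<epsilon>]
    proof eventually_elim
      case (elim \<zeta>)
      have "Re (g \<zeta>) = real N * pi - Re (psi \<zeta>)" by (simp add: g_def)
      thus ?case using elim kN_pi pi_gt_zero by linarith
    qed
    ultimately show "eventually (\<lambda>\<zeta>. - \<epsilon> \<le> Re (g \<zeta>)) (strip_end s)" using s by auto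
  qed
  have "psi constant_on open_strip \<or> (\<forall>z\<in>open_strip. 0 < Re (psi z))"
    by (rule Re_nonneg_imp_constant_or_pos[OF psi(2) open_open_strip conn]) (use 1 open_strip_subset in auto)
  thus "0 < Re (psi \<zeta>)" using psi_not_constant assms by blast
  have "g constant_on open_strip \<or> (\<forall>z\<in>open_strip. 0 < Re (g z))"
    by (rule Re_nonneg_imp_constant_or_pos[OF hg open_open_strip conn]) (use 2 open_strip_subset in auto)
  moreover have "\<not> g constant_on open_strip"
  proof
    assume "g constant_on open_strip"
    then obtain c where "\<And>z. z \<in> open_strip \<Longrightarrow> g z = c" by (auto simp: constant_on_def)
    hence "\<And>z. z \<in> open_strip \<Longrightarrow> psi z = of_real (real N * pi) - c" by (auto simp: g_def algebra_simps)
    thus False using psi_not_constant unfolding constant_on_def by blast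
  qed
  ultimately show "Re (psi \<zeta>) < real N * pi" using assms by (auto simp: g_def)
qed

lemma open_strip_sequence:
  assumes "\<zeta> \<in> closed_strip"
  obtains z where "z \<longlonglongrightarrow> \<zeta>" "\<And>i. z i \<in> open_strip"
  using that[OF LIMSEQ_Suc[OF open_strip_approach(1)[OF assms]]] open_strip_approach(2)[OF assms] by blast

text \<open>The values near \<open>\<zeta>0\<close> fill a neighbourhood of
  \<open>psi \<zeta>0\<close>; interior points converging to \<open>\<zeta>1\<close> would take
  values in this neighbourhood a second time.\<close>

lemma psi_open_closed_inj:
  assumes "\<zeta>0 \<in> open_strip" "\<zeta>1 \<in> closed_strip" "psi \<zeta>0 = psi \<zeta>1"
  shows "\<zeta>1 = \<zeta>0"
proof (rule ccontr)
  assume ne: "\<zeta>1 \<noteq> \<zeta>0"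
  obtain e0 where e0: "e0 > 0" "ball \<zeta>0 e0 \<subseteq> open_strip"
    using open_open_strip assms(1) open_contains_ball by blast
  define e where "e = min e0 (dist \<zeta>0 \<zeta>1 / 2)"
  have e: "e > 0" "ball \<zeta>0 e \<subseteq> open_strip" "e \<le> dist \<zeta>0 \<zeta>1 / 2" using e0 ne by (auto simp: e_def)
  have "open (psi ` ball \<zeta>0 e)"
    by (rule open_mapping_thm3[OF holomorphic_on_subset[OF psi(2) e(2)] open_ball inj_on_subset[OF psi_inj e(2)]])
  moreover have "psi \<zeta>1 \<in> psi ` ball \<zeta>0 e" using assms(3) e(1) by (metis centre_in_ball imageI)
  moreover obtain z where z: "z \<longlonglongrightarrow> \<zeta>1" "\<And>i. z i \<in> open_strip" using open_strip_sequence[OF assms(2)] by blast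
  have "(\<lambda>i. psi (z i)) \<longlonglongrightarrow> psi \<zeta>1"
    by (rule continuous_on_tendsto_compose[OF psi(1) z(1) assms(2)])
      (simp add: subsetD[OF open_strip_subset z(2)])
  ultimately have "eventually (\<lambda>i. psi (z i) \<in> psi ` ball \<zeta>0 e) sequentially" by (rule topological_tendstoD[rotated])
  moreover have "eventually (\<lambda>i. dist (z i) \<zeta>1 < e) sequentially" using z(1) e(1) by (rule tendstoD)
  ultimately have "eventually (\<lambda>i. False) sequentially"
  proof eventually_elim
    case (elim i)
    then obtain y where y: "y \<in> ball \<zeta>0 e" "psi (z i) = psi y" by auto
    hence "z i = y" using inj_onD[OF psi_inj y(2) z(2)] e(2) by auto
    hence "dist \<zeta>0 (z i) < e" using y(1) by simp
    moreover have "dist \<zeta>0 \<zeta>1 \<le> dist \<zeta>0 (z i) + dist (z i) \<zeta>1" by (rule dist_triangle)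
    ultimately show False using elim(2) e(3) by linarith
  qed
  thus False by simp
qed

text \<open>\<open>G \<zeta> \<ge> 0\<close> means that \<open>psi \<zeta>\<close> lies in the deleted set.\<close>

definition G :: "complex \<Rightarrow> real" where
  "G \<zeta> = min (cos (Re (psi \<zeta>) - real k * pi) * cosh (Im (psi \<zeta>)) - cosh B) (pi / 2 - \<bar>Re (psi \<zeta>) - real k * pi\<bar>)"

lemma cosh_B_gt_1: "cosh B > 1"
  using cosh_B L by simp

text \<open>A zero of \<open>G\<close> would put an interior value on the boundary curve, whose
  points are values on the upper edge, against \<open>psi_open_closed_inj\<close>. So
  \<open>G\<close> has constant sign on the open strip, and it is negative near
  \<open>ln a\<close>.\<close>

lemma G_neg: "\<zeta> \<in> open_strip \<Longrightarrow> G \<zeta> < 0"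
proof (rule ccontr)
  assume \<zeta>: "\<zeta> \<in> open_strip" and neg: "\<not> G \<zeta> < 0"
  have nz: "G \<xi> \<noteq> 0" if \<xi>: "\<xi> \<in> open_strip" for \<xi>
  proof
    assume 0: "G \<xi> = 0"
    define u where "u = Re (psi \<xi>) - real k * pi"
    have g: "cos u * cosh (Im (psi \<xi>)) \<ge> cosh B" "\<bar>u\<bar> \<le> pi / 2" and
      d: "cos u * cosh (Im (psi \<xi>)) = cosh B \<or> \<bar>u\<bar> = pi / 2"
      using 0 by (auto simp: G_def u_def min_def split: if_splits)
    \<comment> \<open>If the minimum vanishes, its first term does: for \<open>|u| = pi / 2\<close>
      the cosine is 0, while \<open>cosh B > 1\<close>.\<close>
    have "\<bar>u\<bar> \<noteq> pi / 2"
    proof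
      assume "\<bar>u\<bar> = pi / 2"
      hence "cos u = 0" by (metis cos_abs_real cos_pi_half)
      thus False using g(1) cosh_B_gt_1 by simp
    qed
    hence "\<bar>u\<bar> < pi / 2" "cos u * cosh (Im (psi \<xi>)) = cosh B" using g d by auto
    moreover have "Im (psi \<xi>) > 0"
      using \<xi> open_strip_subset by (intro Im_psi_pos) (auto simp: open_strip_def)
    ultimately obtain t where "psi (edge t) = psi \<xi>" using edge_covers_curve[of "psi \<xi>"] by (auto simp: u_def)
    hence "edge t = \<xi>" using psi_open_closed_inj[OF \<xi>, of "edge t"] by simp
    thus False using \<xi> edge_simps(2)[of t] by (auto simp: open_strip_def)
  qed
  have contG: "continuous_on closed_strip G" unfolding G_def
    by (intro continuous_intros psi(1)) auto
  define \<zeta>a where "\<zeta>a = complex_of_real (ln a)"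
  have "G \<zeta>a \<le> cos (- (real k * pi)) * 1 - cosh B" using psi(4) by (simp add: G_def \<zeta>a_def)
  also have "\<dots> < 0" using cos_le_one[of "- (real k * pi)"] cosh_B_gt_1 by linarith
  finally have Ga: "G \<zeta>a < 0" .
  have \<zeta>a: "\<zeta>a \<in> closed_strip" by (simp add: \<zeta>a_def)
  obtain z where z: "z \<longlonglongrightarrow> \<zeta>a" "\<And>i. z i \<in> open_strip" using open_strip_sequence[OF \<zeta>a] by blast
  have "(\<lambda>i. G (z i)) \<longlonglongrightarrow> G \<zeta>a"
    by (rule continuous_on_tendsto_compose[OF contG z(1) \<zeta>a])
      (simp add: subsetD[OF open_strip_subset z(2)])
  hence "eventually (\<lambda>i. G (z i) < 0) sequentially" using Ga by (rule order_tendstoD(2))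
  then obtain i where i: "G (z i) < 0" by (auto simp: eventually_sequentially)
  have "connected (G ` open_strip)"
    by (intro connected_continuous_image continuous_on_subset[OF contG open_strip_subset]
        convex_connected convex_strips)
  hence "0 \<in> G ` open_strip"
    using connected_contains_Icc[of "G ` open_strip" "G (z i)" "G \<zeta>"] i neg z(2) \<zeta> by auto
  thus False using nz by auto
qed

lemma psi_open_in_Omega: "\<zeta> \<in> open_strip \<Longrightarrow> psi \<zeta> \<in> Omega k m B"
proof -
  assume \<zeta>: "\<zeta> \<in> open_strip"
  define u where "u = Re (psi \<zeta>) - real k * pi"
  define y where "y = Im (psi \<zeta>)"
  have y: "y > 0" unfolding y_def using \<zeta> open_strip_subset by (intro Im_psi_pos) (auto simp: open_strip_def)
  have "\<not> (\<bar>u\<bar> \<le> arccos (cosh B / cosh y) \<and> B \<le> y)"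
  proof
    assume *: "\<bar>u\<bar> \<le> arccos (cosh B / cosh y) \<and> B \<le> y"
    define t where "t = cosh B / cosh y"
    have t: "0 \<le> t" "t \<le> 1" using * B_pos y by (auto simp: t_def cosh_real_nonneg_le_iff)
    have "\<bar>u\<bar> \<le> pi / 2" using * arccos_le_pi2[OF t] by (simp add: t_def)
    moreover have "cos (arccos t) \<le> cos \<bar>u\<bar>"
      using * t arccos_le_pi2[OF t] arccos_ubound[of t] by (intro cos_monotone_0_pi_le) (auto simp: t_def)
    hence "t \<le> cos u" using t by simp
    hence "cosh B \<le> cos u * cosh y" using cosh_real_pos[of y] by (simp add: t_def field_simps)
    ultimately have "G \<zeta> \<ge> 0" by (simp add: G_def u_def y_def)
    thus False using G_neg[OF \<zeta>] by simp
  qed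
  hence "\<not> (\<bar>Re (psi \<zeta>) - pi * real k\<bar> \<le> arccos (cosh B / cosh (Im (psi \<zeta>))) \<and> B \<le> Im (psi \<zeta>))"
    by (simp add: u_def y_def mult.commute)
  thus ?thesis using Re_psi_open[OF \<zeta>] y by (auto simp: Omega_def y_def N)
qed

text \<open>The three parts of the real edge go to the left wall, the bottom and the right wall; the
  upper edge goes to points with equality in the condition on \<open>Re\<close> that defines the
  deleted set.\<close>

lemma psi_boundary_notin_Omega: "\<zeta> \<in> closed_strip \<Longrightarrow> \<zeta> \<notin> open_strip \<Longrightarrow> psi \<zeta> \<notin> Omega k m B"
proof -
  assume "\<zeta> \<in> closed_strip" "\<zeta> \<notin> open_strip"
  hence "Im \<zeta> = 0 \<or> Im \<zeta> = pi / 2" by (auto simp: closed_strip_def open_strip_def)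
  thus ?thesis
  proof
    assume "Im \<zeta> = 0"
    hence z: "\<zeta> = of_real (ln (exp (Re \<zeta>)))" by (rule bottom_eq)
    define y where "y = exp (Re \<zeta>)"
    have y: "y > 0" "psi \<zeta> = psi (of_real (ln y))" using z by (auto simp: y_def)
    consider "y \<le> a" | "y \<in> {a..1}" | "1 \<le> y" by force
    thus ?thesis
    proof cases
      case 1
      hence "Re (psi \<zeta>) = 0" using U_left[of y] y by (simp add: U_def)
      thus ?thesis by (auto simp: Omega_def)
    next
      case 2
      hence "Im (psi \<zeta>) = 0" using psi_ln_mid[of y] y by simp
      thus ?thesis by (auto simp: Omega_def)
    next
      case 3
      hence "Re (psi \<zeta>) = real N * pi" using U_right[of y] y by (simp add: U_def)
      thus ?thesis by (auto simp: Omega_def N)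
    qed
  next
    assume "Im \<zeta> = pi / 2"
    hence z: "\<zeta> = edge (Re \<zeta>)" by (rule edge_eq)
    define t where "t = Re \<zeta>"
    have Re: "Re (psi \<zeta>) = w t + real k * pi" and Im: "Im (psi \<zeta>) = v t"
      using z by (simp_all add: t_def w_def v_def)
    have cw: "cosh B / cosh (v t) = cos (w t)"
      using edge_trig(1)[of t] cosh_real_pos[of "v t"] by (simp add: field_simps)
    have w: "\<bar>w t\<bar> < pi / 2" using w_range[of t] by (simp add: abs_less_iff)
    hence "arccos (cos \<bar>w t\<bar>) = \<bar>w t\<bar>" using pi_gt_zero by (intro arccos_cos) linarith+
    hence 1: "arccos (cosh B / cosh (v t)) = \<bar>w t\<bar>" by (simp add: cw)
    have "cosh B \<le> cosh (v t)"
      using edge_trig(1)[of t] mult_right_mono[OF cos_le_one[of "w t"], of "cosh (v t)"] by simp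
    hence 2: "B \<le> v t" using B_pos v_pos[of t] by (simp add: cosh_real_nonneg_le_iff)
    show ?thesis using 1 2 by (auto simp: Omega_def Re Im mult.commute)
  qed
qed

text \<open>\<open>Im psi\<close> tends to infinity at both ends, so a bounded sequence of values
  comes from a compact rectangle.\<close>

lemma closed_psi_image: "closed (psi ` closed_strip)"
  unfolding closed_sequential_limits
proof safe
  fix f l assume f: "\<forall>i. f i \<in> psi ` closed_strip" and lim: "f \<longlonglongrightarrow> l"
  hence "\<forall>i. \<exists>z. z \<in> closed_strip \<and> f i = psi z" by blast
  then obtain z where z: "\<And>i. z i \<in> closed_strip" "\<And>i. f i = psi (z i)" by metis
  have "\<exists>r. \<forall>\<zeta>\<in>closed_strip. r < s * Re \<zeta> \<longrightarrow> Im l + 1 < Im (psi \<zeta>)" if "s = 1 \<or> s = -1" for s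
  proof -
    have "eventually (\<lambda>\<zeta>. Im l + 1 < Im (psi \<zeta>)) (strip_end s)"
      using Im_psi_at_top[OF that] unfolding filterlim_at_top_dense by (rule spec)
    thus ?thesis unfolding eventually_strip_end .
  qed
  from this[of 1] this[of "-1"] obtain r1 r2 where r: "\<forall>\<zeta>\<in>closed_strip. r1 < 1 * Re \<zeta> \<longrightarrow> Im l + 1 < Im (psi \<zeta>)"
    "\<forall>\<zeta>\<in>closed_strip. r2 < -1 * Re \<zeta> \<longrightarrow> Im l + 1 < Im (psi \<zeta>)"
    by auto
  define K where "K = cbox (Complex (- r2) 0) (Complex r1 (pi / 2))"
  have K: "K \<subseteq> closed_strip" by (auto simp: K_def in_cbox_complex_iff closed_strip_def)
  have "compact (psi ` K)" unfolding K_def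
    by (intro compact_continuous_image continuous_on_subset[OF psi(1) K[unfolded K_def]] compact_cbox)
  hence "closed (psi ` K)" by (rule compact_imp_closed)
  moreover have "(\<lambda>i. Im (f i)) \<longlonglongrightarrow> Im l" by (intro tendsto_intros lim)
  hence "eventually (\<lambda>i. Im (f i) < Im l + 1) sequentially" by (rule order_tendstoD(2)) simp
  hence "eventually (\<lambda>i. f i \<in> psi ` K) sequentially"
  proof eventually_elim
    case (elim i)
    have "Re (z i) \<le> r1" "- r2 \<le> Re (z i)"
      using bspec[OF r(1) z(1)[of i]] bspec[OF r(2) z(1)[of i]] elim z(2)[of i] by auto
    hence "z i \<in> K" using z(1)[of i] by (auto simp: K_def in_cbox_complex_iff closed_strip_def)
    thus ?case using z(2) by auto
  qed
  ultimately have "l \<in> psi ` K" using lim by (intro Lim_in_closed_set[of _ f sequentially]) auto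
  thus "l \<in> psi ` closed_strip" using K by auto
qed

lemma psi_image: "psi ` open_strip = Omega k m B"
proof
  show "psi ` open_strip \<subseteq> Omega k m B" using psi_open_in_Omega by auto
  have o: "open (psi ` open_strip)" by (rule open_mapping_thm3[OF psi(2) open_open_strip psi_inj])
  have sub: "Omega k m B \<subseteq> psi ` open_strip \<union> - (psi ` closed_strip)"
    using psi_boundary_notin_Omega by auto
  have "psi ` open_strip \<inter> - (psi ` closed_strip) \<inter> Omega k m B = {}" using open_strip_subset by auto
  moreover have "psi (mid 0) \<in> psi ` open_strip \<inter> Omega k m B"
    by (intro IntI imageI psi_open_in_Omega) simp_all
  hence "psi ` open_strip \<inter> Omega k m B \<noteq> {}" by blast
  ultimately have "- (psi ` closed_strip) \<inter> Omega k m B = {}"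
    using connectedD[OF connected_Omega[OF B_pos, of k m] o closed_psi_image[unfolded closed_def]] sub
    by blast
  thus "Omega k m B \<subseteq> psi ` open_strip" using sub by auto
qed

section \<open>Transfer to the quadrant, and identification of \<open>B\<close>\<close>

definition phi :: "complex \<Rightarrow> complex" where "phi z = psi (Ln z)"

lemma Ln_not_nonpos: "z \<in> closure first_quadrant - {0} \<Longrightarrow> z \<notin> \<real>\<^sub>\<le>\<^sub>0"
  by (auto simp: closure_first_quadrant complex_nonpos_Reals_iff complex_eq_iff)

lemma phi_of_real: "y > 0 \<Longrightarrow> phi (of_real y) = psi (of_real (ln y))"
  by (simp add: phi_def Ln_of_real)

lemma is_quadrant_map_phi: "is_quadrant_map k m B phi"
  unfolding is_quadrant_map_def
proof (intro conjI)
  have LnQ: "Ln ` first_quadrant = open_strip"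
  proof
    show "Ln ` first_quadrant \<subseteq> open_strip" using Ln_first_quadrant by auto
    show "open_strip \<subseteq> Ln ` first_quadrant"
    proof
      fix \<zeta> assume \<zeta>: "\<zeta> \<in> open_strip"
      hence "Ln (exp \<zeta>) = \<zeta>" "exp \<zeta> \<in> first_quadrant"
        using Ln_exp_closed_strip open_strip_subset exp_open_strip by auto
      thus "\<zeta> \<in> Ln ` first_quadrant" by force
    qed
  qed
  have "Ln holomorphic_on first_quadrant"
    using Ln_not_nonpos first_quadrant_subset by (intro holomorphic_on_Ln) blast
  hence "(psi \<circ> Ln) holomorphic_on first_quadrant"
    by (rule holomorphic_on_compose_gen[OF _ psi(2)]) (simp add: LnQ)
  thus "phi holomorphic_on first_quadrant" by (simp add: phi_def[abs_def] o_def)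
  have "inj_on Ln first_quadrant"
    using first_quadrant_subset by (intro inj_onI) (metis Diff_iff exp_Ln insertCI subsetD)
  hence "inj_on phi first_quadrant"
    using comp_inj_on[of Ln first_quadrant psi] psi_inj by (simp add: LnQ phi_def[abs_def] o_def)
  moreover have "phi ` first_quadrant = psi ` (Ln ` first_quadrant)" by (simp add: phi_def image_image)
  ultimately show "bij_betw phi first_quadrant (Omega k m B)"
    by (simp add: bij_betw_def LnQ psi_image)
  have "continuous_on (closure first_quadrant - {0}) Ln"
    using Ln_not_nonpos by (intro continuous_intros) auto
  thus "continuous_on (closure first_quadrant - {0}) phi"
    unfolding phi_def using Ln_closed_quadrant by (intro continuous_on_compose2[OF psi(1)]) auto
  have quarter: "pi / 4 > 0" by simp
  show "filterlim phi (infty_left k) (at 0 within closure first_quadrant)"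
    unfolding infty_left_def filterlim_inf filterlim_filtercomap_iff filterlim_principal o_def phi_def
  proof
    show "filterlim (\<lambda>z. Im (psi (Ln z))) at_top (at 0 within closure first_quadrant)"
      by (rule filterlim_compose[OF Im_psi_at_top filterlim_Ln_at_0]) simp
    have "eventually (\<lambda>\<zeta>. psi \<zeta> \<in> {w. Re w < pi * real k}) (strip_end (-1))"
      using strip_end_Re_psi(1)[OF quarter] by eventually_elim (simp add: mult.commute[of pi], use pi_gt_zero in linarith)
    thus "\<forall>\<^sub>F z in at 0 within closure first_quadrant. psi (Ln z) \<in> {w. Re w < pi * real k}"
      using filterlim_Ln_at_0 unfolding filterlim_iff by blast
  qed
  show "filterlim phi (infty_right k) (inf at_infinity (principal (closure first_quadrant)))"
    unfolding infty_right_def filterlim_inf filterlim_filtercomap_iff filterlim_principal o_def phi_def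
  proof
    show "filterlim (\<lambda>z. Im (psi (Ln z))) at_top (inf at_infinity (principal (closure first_quadrant)))"
      by (rule filterlim_compose[OF Im_psi_at_top filterlim_Ln_at_infinity]) simp
    have "eventually (\<lambda>\<zeta>. psi \<zeta> \<in> {w. Re w > pi * real k}) (strip_end 1)"
      using strip_end_Re_psi(2)[OF quarter] by eventually_elim (simp add: mult.commute[of pi], use pi_gt_zero in linarith)
    thus "\<forall>\<^sub>F z in inf at_infinity (principal (closure first_quadrant)). psi (Ln z) \<in> {w. Re w > pi * real k}"
      using filterlim_Ln_at_infinity unfolding filterlim_iff by blast
  qed
  show "phi 1 = complex_of_real (real (k + m) * pi)"
    using psi_eq_end_iff[of 1] phi_of_real[of 1] by (simp add: N)
qed

text \<open>\<open>quadrant_map\<close> is an arbitrary choice that agrees with \<open>phi\<close>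
  up to a dilation. On the real edge \<open>psi\<close> takes the value \<open>N * pi\<close> only
  over 1, so the normalisation at 1 makes the dilation trivial.\<close>

lemma quadrant_map_eq: "z \<in> closure first_quadrant - {0} \<Longrightarrow> quadrant_map k m B z = phi z"
proof -
  have "is_quadrant_map k m B (quadrant_map k m B)"
    unfolding quadrant_map_def by (rule someI[of "is_quadrant_map k m B", OF is_quadrant_map_phi])
  then obtain l :: real where l: "l > 0" "\<And>z. z \<in> closure first_quadrant - {0} \<Longrightarrow> quadrant_map k m B z = phi (of_real l * z)"
    using quadrant_maps_eq_up_to_scaling[OF is_quadrant_map_phi] by blast
  have "1 \<in> closure first_quadrant - {0}" by (simp add: closure_first_quadrant)
  moreover have "quadrant_map k m B 1 = complex_of_real (real N * pi)"
    using \<open>is_quadrant_map k m B (quadrant_map k m B)\<close> unfolding is_quadrant_map_def N by blast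
  ultimately have "phi (of_real l) = complex_of_real (real N * pi)" using l(2)[of 1] by simp
  hence "l = 1" using psi_eq_end_iff[OF l(1)] phi_of_real[OF l(1)] by simp
  thus "z \<in> closure first_quadrant - {0} \<Longrightarrow> quadrant_map k m B z = phi z" using l(2)[of z] by simp
qed

lemma positive_in_quadrant: "y > 0 \<Longrightarrow> of_real y \<in> closure first_quadrant - {0}"
  by (simp add: closure_first_quadrant)

lemma a_of_B_eq: "a_of_B k m B = a"
  unfolding a_of_B_def
proof (rule the_equality)
  show "0 < a \<and> a < 1 \<and> quadrant_map k m B (complex_of_real a) = 0"
    using a quadrant_map_eq[OF positive_in_quadrant[OF a(1)]] phi_of_real[OF a(1)] psi_eq_0_iff[OF a(1)] by simp
  fix b :: real assume b: "0 < b \<and> b < 1 \<and> quadrant_map k m B (complex_of_real b) = 0"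
  thus "b = a" using quadrant_map_eq[OF positive_in_quadrant, of b] phi_of_real[of b] psi_eq_0_iff[of b] by simp
qed

lemma extremal_formula:
  assumes "y > 0"
  shows "complex_of_real (extremal_laurent k m a y) =
    1 - (-1) ^ k * complex_of_real (approx_error k m a) * cos (quadrant_map k m B (complex_of_real y))"
    and "approx_error k m a = L"
proof -
  note ext = alternation_imp_extremal[OF k m a P[unfolded N j] mono[unfolded N] xa[unfolded N] \<sigma> alt[unfolded N j] L(1)]
  show err: "approx_error k m a = L" by (rule ext(1)) (auto simp: N)
  have "extremal_laurent k m a y = 1 - e y"
    using ext(2)[of y] assms unfolding e_def unfolding j by simp
  moreover have "e y = (-1) ^ k * L * Fr y"
    using L by (simp add: Fr_def power_mult_distrib[symmetric] flip: mult.assoc)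
  moreover have "cos (quadrant_map k m B (complex_of_real y)) = of_real (Fr y)"
    using quadrant_map_eq[OF positive_in_quadrant[OF assms]] phi_of_real[OF assms]
      cos_psi[of "of_real (ln y)"] F_ln[OF assms] by simp
  ultimately show "complex_of_real (extremal_laurent k m a y) =
    1 - (-1) ^ k * complex_of_real (approx_error k m a) * cos (quadrant_map k m B (complex_of_real y))"
    using err by simp
qed

end

lemma alternation_exists:
  assumes "k \<ge> 1" "m \<ge> 1" "0 < a" "a < 1" "0 < L" "L < 1" "odd_error (k + m) (2 * k - 1) a L"
  shows "\<exists>\<sigma> P x. alternation k m (k + m) (2 * k - 1) a L \<sigma> P x"
proof -
  have "odd (2 * k - 1)" using assms(1) by simp
  then obtain P x \<sigma> where "odd_approx_by (k + m) (2 * k - 1) a L P"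
    "\<forall>i<k + m. x i < x (Suc i)" "x ` {..k + m} \<subseteq> {a..1}" "\<sigma> = 1 \<or> \<sigma> = -1"
    "\<forall>i\<le>k + m. 1 - poly P ((x i)\<^sup>2) / x i ^ (2 * k - 1) = \<sigma> * (-1) ^ i * L"
    using odd_error_alternation[of "2 * k - 1" a L "k + m"] assms by blast
  hence "alternation k m (k + m) (2 * k - 1) a L \<sigma> P x"
    using assms by unfold_locales auto
  thus ?thesis by blast
qed

lemma odd_error_unique: "odd_error N j a c \<Longrightarrow> odd_error N j a c' \<Longrightarrow> c = c'"
  unfolding odd_error_def by (meson linorder_neqE_linordered_idom)

theorem theorem3p1:
  fixes k m :: nat and a :: real
  assumes "k \<ge> 1" and "m \<ge> 1" and "0 < a" and "a < 1"
  shows "approx_error k m a = 1 / cosh (B_of_a k m a) \<and>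
         (\<forall>x>0. complex_of_real (extremal_laurent k m a x) =
            1 - (-1) ^ k * complex_of_real (approx_error k m a) *
              cos (quadrant_map k m (B_of_a k m a) (complex_of_real x)))"
proof -
  obtain L where L0: "0 < L" "L < 1" "odd_error (k + m) (2 * k - 1) a L"
    using odd_error_exists[of k "k + m" a] assms by auto
  obtain \<sigma> P x where "alternation k m (k + m) (2 * k - 1) a L \<sigma> P x"
    using alternation_exists[OF assms L0] by blast
  then interpret alternation k m "k + m" "2 * k - 1" a L \<sigma> P x .
  \<comment> \<open>\<open>B_of_a\<close> is built with \<open>inv_into\<close>, so it yields some
    preimage of \<open>a\<close> once there is one; \<open>a_of_B_eq\<close> exhibits
    \<open>B\<close>.\<close>
  have "a \<in> a_of_B k m ` {0<..}" using a_of_B_eq B_pos by force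
  hence B': "a_of_B k m (B_of_a k m a) = a" "B_of_a k m a > 0"
    unfolding B_of_a_def using f_inv_into_f[of a "a_of_B k m" "{0<..}"] inv_into_into[of a "a_of_B k m" "{0<..}"] by auto
  define L' where "L' = 1 / cosh (B_of_a k m a)"
  have "cosh (B_of_a k m a) > cosh 0" using B'(2) by (intro cosh_real_strict_mono) auto
  hence L': "0 < L'" "L' < 1" by (auto simp: L'_def)
  \<comment> \<open>To compare the chosen preimage with \<open>B\<close>, it is realised by an
    extremal problem of its own, at an endpoint \<open>a'\<close> with error \<open>L'\<close>. Then
    \<open>a_of_B_eq\<close> gives \<open>a' = a\<close>, and uniqueness of the error gives
    \<open>L' = L\<close>.\<close>
  obtain a' where a': "0 < a'" "a' < 1" "odd_error (k + m) (2 * k - 1) a' L'"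
    using odd_error_attained[of k "k + m" L'] assms L' by auto
  obtain \<sigma>' P' x' where "alternation k m (k + m) (2 * k - 1) a' L' \<sigma>' P' x'"
    using alternation_exists[OF assms(1,2) a'(1,2) L' a'(3)] by blast
  then interpret alt': alternation k m "k + m" "2 * k - 1" a' L' \<sigma>' P' x' .
  have B_eq: "alt'.B = B_of_a k m a"
    using B'(2) unfolding alt'.B_def by (simp add: L'_def arcosh_cosh_real)
  have "a' = a" using B_eq alt'.a_of_B_eq B'(1) by simp
  hence "L' = L" using odd_error_unique L0(3) a'(3) by blast
  hence "B_of_a k m a = B" using B_eq by simp
  thus ?thesis using extremal_formula \<open>L' = L\<close> extremal_formula(2)[of 1] by (auto simp: L'_def)
qed

end
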